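(* Let $L$ be a link that is not an unlink. Let $n \le 202$ be even and let $m \ge n+2$ be an integer. (i) If $n = 4k+2$ for some integer $k\ge 0$, then $\beta_n(L) \le \beta_m(L)$. (ii) If $n = 4k$ for some integer $k \ge 1$, then $\beta_n(L) \le \beta_m(L)+1$; moreover, if $m \equiv 0$ or $m\equiv 1 \pmod 4$, then $\beta_n(L) \le \beta_m(L)$.
   Context: An $n$-crossing ($n\ge 2$) in a link projection is a point where $n$ strands meet, each bisecting the crossing, with the strands assigned distinct levels $1,\dots,n$ (level $1$ on top) recording their heights. An $m$-string $n$-crossing braid is a braid diagram on $m$ strings all of whose crossings are $n$-crossings; each such crossing involves strings in consecutive positions $j,\dots,j+n-1$ and reverses their order. The $n$-crossing braid index $\beta_n(L)$ is the minimum number of strings of an $n$-crossing braid whose closure is isotopic to $L$, with $\beta_n(L)=\infty$ if none exists. *)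

theory Defs
  imports "HOL-Analysis.Analysis" "HOL-Library.Extended_Nat"
begin

type_synonym R3 = "real \<times> real \<times> real"

definition std_unlink :: "nat \<Rightarrow> R3 set" where
  "std_unlink c = (\<Union>i<c. {(x, y, z). z = 0 \<and> (x - 3 * real i)\<^sup>2 + y\<^sup>2 = 1})"

definition is_link :: "R3 set \<Rightarrow> bool" where
  "is_link L \<longleftrightarrow> (\<exists>c\<ge>1. std_unlink c homeomorphic L)"

definition isotopic :: "R3 set \<Rightarrow> R3 set \<Rightarrow> bool" where
  "isotopic A B \<longleftrightarrow> (\<exists>H :: real \<times> R3 \<Rightarrow> R3.
      continuous_on ({0..1} \<times> UNIV) H \<and>
      (\<forall>x. H (0, x) = x) \<and>
      (\<forall>t\<in>{0..1}. \<exists>g. homeomorphism UNIV UNIV (\<lambda>x. H (t, x)) g) \<and>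
      (\<lambda>x. H (1, x)) ` A = B)"

definition is_unlink :: "R3 set \<Rightarrow> bool" where
  "is_unlink L \<longleftrightarrow> (\<exists>c\<ge>1. isotopic (std_unlink c) L)"

text \<open>An n-crossing in an m-string braid: a pair (j, lev) where the crossing involves the
  strings in positions j, ..., j+n-1 (0-based), reversing their order, and lev i is the level
  (1 = top) of the strand entering at position j+i; the levels are distinct and form {1..n}.\<close>
type_synonym ncrossing = "nat \<times> (nat \<Rightarrow> nat)"

definition valid_ncrossing :: "nat \<Rightarrow> nat \<Rightarrow> ncrossing \<Rightarrow> bool" where
  "valid_ncrossing m n cr \<longleftrightarrow> (case cr of (j, lev) \<Rightarrow>
      j + n \<le> m \<and> bij_betw lev {0..<n} {1..n})"

definition is_ncrossing_braid :: "nat \<Rightarrow> nat \<Rightarrow> ncrossing list \<Rightarrow> bool" where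
  "is_ncrossing_braid m n bs \<longleftrightarrow> (\<forall>cr\<in>set bs. valid_ncrossing m n cr)"

text \<open>Geometric realisation of the k-th crossing (occupying the slab k \<le> y \<le> k+1).
  String positions are x = 0..m-1 at height z = 0; strands of the crossing go straight through
  the centre of the crossing in projection, dipping to height z = - level there.\<close>
definition crossing_set :: "nat \<Rightarrow> nat \<Rightarrow> nat \<Rightarrow> ncrossing \<Rightarrow> R3 set" where
  "crossing_set m n k cr = (case cr of (j, lev) \<Rightarrow>
     (\<Union>p<m.
       if j \<le> p \<and> p < j + n then
         (let c = (real j + (real n - 1) / 2, real k + 1/2, - real (lev (p - j)))
          in closed_segment (real p, real k, 0) c \<union>
             closed_segment c (real (2 * j + n - 1 - p), real k + 1, 0))
       else closed_segment (real p, real k, 0) (real p, real k + 1, 0)))"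

text \<open>Closure arcs: string position p is joined from (p, N, 0) back to (p, 0, 0) by a
  rectangular arc in the plane z = 0 passing to the left of the braid (nested arcs).\<close>
definition closure_arc :: "nat \<Rightarrow> nat \<Rightarrow> R3 set" where
  "closure_arc N p = (let d = real p + 1; q = real p; t = real N in
     closed_segment (q, t, 0) (q, t + d, 0) \<union>
     closed_segment (q, t + d, 0) (- d, t + d, 0) \<union>
     closed_segment (- d, t + d, 0) (- d, - d, 0) \<union>
     closed_segment (- d, - d, 0) (q, - d, 0) \<union>
     closed_segment (q, - d, 0) (q, 0, 0))"

definition braid_closure :: "nat \<Rightarrow> nat \<Rightarrow> ncrossing list \<Rightarrow> R3 set" where
  "braid_closure m n bs =
     (\<Union>k<length bs. crossing_set m n k (bs ! k)) \<union> (\<Union>p<m. closure_arc (length bs) p)"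

text \<open>The n-crossing braid index (\<infinity> if no n-crossing braid closes to L).\<close>
definition crossing_braid_index :: "nat \<Rightarrow> R3 set \<Rightarrow> enat" where
  "crossing_braid_index n L =
     (INF m \<in> {m. \<exists>bs. is_ncrossing_braid m n bs \<and> isotopic (braid_closure m n bs) L}. enat m)"

end

theory Submission
  imports Defs
begin

text \<open>A layered letter is a permutation \<open>\<pi>\<close> of the strings together with a height for each string: the
  strings drop to their heights, are moved to their new positions and come back up. Two layered
  letters whose heights fit together compose to a layered letter, and a letter depends only on the
  order of the heights of inverted pairs; both facts follow from straight-line homotopies of point
  configurations. Hence, if \<open>\<pi>\<close> is a product of reversals of \<open>n\<close> consecutive positions, then a letter
  with permutation \<open>\<pi>\<close> is a product of \<open>n\<close>-crossings, whatever its heights. For even \<open>n\<close> and at least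
  \<open>n + 2\<close> strings these reversals generate the alternating group, or the symmetric group if
  \<open>n mod 4 = 2\<close>, because four of them compose to a 3-cycle. An \<open>m\<close>-crossing is a single
  letter, so only odd \<open>m\<close>-crossings with \<open>4 dvd n\<close> remain. Two consecutive odd letters can be
  factored into even ones, and an odd number of odd letters is made even by a stabilisation, which
  costs one string. If there are no crossings at all, the empty braid serves for every \<open>n\<close>, so that
  links closed by trivial braids need no separate treatment.\<close>

section \<open>Ambient isotopies\<close>

text \<open>\<open>isotopic\<close> asks for a motion of all of space, so a move of the link alone
  is not enough. Every basic move is therefore an explicit displacement of space that preserves each
  plane y = const or each line parallel to the y-axis; bijectivity is then checked inside the
  fibres, by a contraction or by monotonicity. On the algebraic side parity is the obstacle. A
  reversal of n positions consists of n div 2 transpositions, so for n divisible by 4 all products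
  of reversals are even, and the permutation of an odd letter is not among them. Only two odd
  letters together have a chance, because the heights of the strings between them can be chosen
  freely. A stabilisation repairs an odd number of odd letters because the 2-crossing that it adds
  is a transposition. The gap m \<ge> n + 2 has its origin in the 3-cycle: it is built from windows
  starting at j, j + 1 and j + 2, which cover n + 2 positions, and a braid with at least one
  m-crossing has that many strings.\<close>

lemma isotopicE:
  assumes "isotopic A B"
  obtains H :: "real \<times> R3 \<Rightarrow> R3" where "continuous_on ({0..1} \<times> UNIV) H" "\<And>x. H (0, x) = x"
      "\<And>t. t \<in> {0..1} \<Longrightarrow> \<exists>g. homeomorphism UNIV UNIV (\<lambda>x. H (t, x)) g"
      "(\<lambda>x. H (1, x)) ` A = B"
proof -
  from assms obtain H :: "real \<times> R3 \<Rightarrow> R3" where "continuous_on ({0..1} \<times> UNIV) H" "\<forall>x. H (0, x) = x"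
      "\<forall>t\<in>{0..1}. \<exists>g. homeomorphism UNIV UNIV (\<lambda>x. H (t, x)) g"
      "(\<lambda>x. H (1, x)) ` A = B"
    unfolding isotopic_def by (elim exE conjE) (erule that, assumption+)
  then show thesis by (intro that[of H]) (assumption | erule spec | erule bspec)+
qed

lemma isotopic_intro:
  fixes H :: "real \<times> R3 \<Rightarrow> R3"
  assumes "continuous_on ({0..1} \<times> UNIV) H" "\<And>x. H (0, x) = x"
    and "\<And>t. 0 \<le> t \<Longrightarrow> t \<le> 1 \<Longrightarrow> \<exists>g. homeomorphism UNIV UNIV (\<lambda>x. H (t, x)) g"
    and "(\<lambda>x. H (1, x)) ` A = B"
  shows "isotopic A B"
  unfolding isotopic_def
  using assms by (intro exI[of _ H] conjI ballI allI) simp_all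

lemma isotopic_refl: "isotopic A A"
proof (rule isotopic_intro)
  show "continuous_on ({0..1} \<times> UNIV) (snd :: real \<times> R3 \<Rightarrow> R3)"
    by (intro continuous_intros)
  show "\<exists>g. homeomorphism UNIV UNIV (\<lambda>x :: R3. snd (t, x)) g" for t :: real
    by (rule exI[of _ id]) (simp add: homeomorphism_def continuous_on_id)
qed auto

text \<open>Inverting the map at every time would require joint continuity of the inverses. Running
  the isotopy backwards from its end, as H (1 - t) after the single inverse \<open>g\<close> of the
  time-one map, needs only the continuity of \<open>g\<close>.\<close>

lemma isotopic_sym:
  assumes "isotopic A B"
  shows "isotopic B A"
proof -
  obtain H :: "real \<times> R3 \<Rightarrow> R3" where H: "continuous_on ({0..1} \<times> UNIV) H" "\<And>x. H (0, x) = x"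
      "\<And>t. t \<in> {0..1} \<Longrightarrow> \<exists>g. homeomorphism UNIV UNIV (\<lambda>x. H (t, x)) g"
      "(\<lambda>x. H (1, x)) ` A = B"
    using isotopicE[OF assms] by blast
  obtain g where g: "homeomorphism UNIV UNIV (\<lambda>x. H (1, x)) g" using H(3)[of 1] by fastforce
  have gH: "g (H (1, x)) = x" "H (1, g x) = x" for x
    using homeomorphism_apply1[OF g] homeomorphism_apply2[OF g] by blast+
  have cg: "continuous_on UNIV g" using g by (auto simp: homeomorphism_def)
  show ?thesis
  proof (rule isotopic_intro)
    have "continuous_on ({0..1} \<times> UNIV) (\<lambda>q :: real \<times> R3. (1 - fst q, g (snd q)))"
      by (auto intro!: continuous_intros continuous_on_compose2[OF cg])
    then show "continuous_on ({0..1} \<times> UNIV) (\<lambda>q. H (1 - fst q, g (snd q)))"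
      by (rule continuous_on_compose2[OF H(1)]) auto
    show "(\<lambda>x. H (1 - fst (1 :: real, x), g (snd (1 :: real, x)))) ` B = A"
      using H(2) gH(1) by (simp add: H(4)[symmetric] image_image)
    show "H (1 - fst (0 :: real, x), g (snd (0 :: real, x))) = x" for x
      using gH(2) by simp
    fix t :: real assume "0 \<le> t" "t \<le> 1"
    then obtain f where f: "homeomorphism UNIV UNIV (\<lambda>x. H (1 - t, x)) f"
      using H(3)[of "1 - t"] by auto
    have "homeomorphism UNIV UNIV g (\<lambda>x. H (1, x))"
      using g homeomorphism_sym by blast
    from homeomorphism_compose[OF this f]
    show "\<exists>h. homeomorphism UNIV UNIV (\<lambda>x. H (1 - fst (t, x), g (snd (t, x)))) h"
      by (auto simp: o_def)
  qed
qed

text \<open>The two isotopies run simultaneously, the second applied to the image of the first, so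
  that nothing has to be glued in time.\<close>

lemma isotopic_trans [trans]:
  assumes "isotopic A B" "isotopic B C"
  shows "isotopic A C"
proof -
  obtain H :: "real \<times> R3 \<Rightarrow> R3" where H: "continuous_on ({0..1} \<times> UNIV) H" "\<And>x. H (0, x) = x"
      "\<And>t. t \<in> {0..1} \<Longrightarrow> \<exists>g. homeomorphism UNIV UNIV (\<lambda>x. H (t, x)) g"
      "(\<lambda>x. H (1, x)) ` A = B"
    using isotopicE[OF assms(1)] by blast
  obtain K :: "real \<times> R3 \<Rightarrow> R3" where K: "continuous_on ({0..1} \<times> UNIV) K" "\<And>x. K (0, x) = x"
      "\<And>t. t \<in> {0..1} \<Longrightarrow> \<exists>g. homeomorphism UNIV UNIV (\<lambda>x. K (t, x)) g"
      "(\<lambda>x. K (1, x)) ` B = C"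
    using isotopicE[OF assms(2)] by blast
  show ?thesis
  proof (rule isotopic_intro)
    have "continuous_on ({0..1} \<times> UNIV) (\<lambda>q. (fst q, H q))"
      by (intro continuous_intros H(1))
    then show "continuous_on ({0..1} \<times> UNIV) (\<lambda>q. K (fst q, H q))"
      by (rule continuous_on_compose2[OF K(1)]) auto
    fix t :: real assume "0 \<le> t" "t \<le> 1"
    then have t: "t \<in> {0..1}" by simp
    obtain f g where "homeomorphism UNIV UNIV (\<lambda>x. H (t, x)) f"
        "homeomorphism UNIV UNIV (\<lambda>x. K (t, x)) g"
      using H(3)[OF t] K(3)[OF t] by auto
    from homeomorphism_compose[OF this]
    show "\<exists>h. homeomorphism UNIV UNIV (\<lambda>x. K (fst (t, x), H (t, x))) h"
      by (auto simp: o_def)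
  qed (use H(2,4) K(2,4) in \<open>auto simp: image_image\<close>)
qed

text \<open>This transports a move from a standard position to any other. The homeomorphism
  \<open>f\<close> itself may reverse orientation, since it is undone before the isotopy and redone
  after it.\<close>

lemma isotopic_conjugate:
  assumes "isotopic A B" "homeomorphism UNIV UNIV f g"
  shows "isotopic (f ` A) (f ` B)"
proof -
  obtain H :: "real \<times> R3 \<Rightarrow> R3" where H: "continuous_on ({0..1} \<times> UNIV) H" "\<And>x. H (0, x) = x"
      "\<And>t. t \<in> {0..1} \<Longrightarrow> \<exists>g. homeomorphism UNIV UNIV (\<lambda>x. H (t, x)) g"
      "(\<lambda>x. H (1, x)) ` A = B"
    using isotopicE[OF assms(1)] by blast
  have fg: "g (f x) = x" "f (g x) = x" for x using assms(2) homeomorphism_apply1 homeomorphism_apply2 by blast+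
  have cg: "continuous_on UNIV g" "continuous_on UNIV f"
    using assms(2) by (auto simp: homeomorphism_def)
  show ?thesis
  proof (rule isotopic_intro)
    have "continuous_on ({0..1} \<times> UNIV) (\<lambda>q :: real \<times> R3. (fst q, g (snd q)))"
      by (intro continuous_intros continuous_on_compose2[OF cg(1)]) auto
    then have "continuous_on ({0..1} \<times> UNIV) (\<lambda>q. H (fst q, g (snd q)))"
      by (rule continuous_on_compose2[OF H(1)]) auto
    then show "continuous_on ({0..1} \<times> UNIV) (\<lambda>q. f (H (fst q, g (snd q))))"
      by (rule continuous_on_compose2[OF cg(2)]) auto
    fix t :: real assume "0 \<le> t" "t \<le> 1"
    then have t: "t \<in> {0..1}" by simp
    obtain h where h: "homeomorphism UNIV UNIV (\<lambda>x. H (t, x)) h"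
      using H(3)[OF t] by auto
    have "homeomorphism UNIV UNIV g f" using assms(2) homeomorphism_sym by blast
    from homeomorphism_compose[OF homeomorphism_compose[OF this h] assms(2)]
    show "\<exists>k. homeomorphism UNIV UNIV (\<lambda>x. f (H (fst (t, x), g (snd (t, x))))) k"
      by (auto simp: o_def)
  qed (use H(2,4) fg in \<open>auto simp: image_image\<close>)
qed

text \<open>By invariance of domain a continuous bijection of space is a homeomorphism, so only
  bijectivity at each time has to be checked.\<close>

lemma isotopicI:
  fixes H :: "real \<times> R3 \<Rightarrow> R3"
  assumes "continuous_on UNIV H" "\<And>x. H (0, x) = x"
    and bij: "\<And>t. 0 \<le> t \<Longrightarrow> t \<le> 1 \<Longrightarrow> bij (\<lambda>x. H (t, x))"
    and "(\<lambda>x. H (1, x)) ` A = B"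
  shows "isotopic A B"
proof (rule isotopic_intro)
  show "continuous_on ({0..1} \<times> UNIV) H" using assms(1) continuous_on_subset by blast
  fix t :: real assume "0 \<le> t" "t \<le> 1"
    then have t: "t \<in> {0..1}" by simp
  have "continuous_on UNIV (\<lambda>x. H (t, x))"
    by (rule continuous_on_compose2[OF assms(1)]) (auto intro!: continuous_intros)
  then obtain g where "homeomorphism UNIV ((\<lambda>x. H (t, x)) ` UNIV) (\<lambda>x. H (t, x)) g"
    using invariance_of_domain_homeomorphism[of UNIV "\<lambda>x. H (t, x)"] bij[of t] t
    by (auto simp: bij_def)
  then show "\<exists>g. homeomorphism UNIV UNIV (\<lambda>x. H (t, x)) g"
    using bij[of t] t by (auto simp: bij_def)
qed (use assms in auto)

text \<open>Solving P + t v(P) = Q means finding a fixed point of P \<mapsto> Q - t v(P). This map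
  preserves the plane y = const through Q and is a contraction there, so Banach's theorem gives
  exactly one solution.\<close>

lemma isotopic_fibre_contraction:
  fixes v :: "R3 \<Rightarrow> R3"
  assumes "continuous_on UNIV v" and c: "0 \<le> c" "c < 1"
    and y0: "\<And>P. fst (snd (v P)) = 0"
    and lip: "\<And>P Q. fst (snd P) = fst (snd Q) \<Longrightarrow> dist (v P) (v Q) \<le> c * dist P Q"
  shows "isotopic A ((\<lambda>P. P + v P) ` A)"
proof (rule isotopicI[where H = "\<lambda>q. snd q + fst q *\<^sub>R v (snd q)"])
  show "continuous_on UNIV (\<lambda>q. snd q + fst q *\<^sub>R v (snd q))"
    by (intro continuous_intros continuous_on_compose2[OF assms(1)]) auto
  fix t :: real assume t: "0 \<le> t" "t \<le> 1"
  have tlip: "dist (t *\<^sub>R v P) (t *\<^sub>R v Q) \<le> c * dist P Q" if "fst (snd P) = fst (snd Q)" for P Q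
  proof -
    have "dist (t *\<^sub>R v P) (t *\<^sub>R v Q) = t * dist (v P) (v Q)"
      using t by (simp add: dist_norm flip: scaleR_diff_right)
    also have "\<dots> \<le> 1 * (c * dist P Q)" using lip[OF that] t by (intro mult_mono) auto
    finally show ?thesis by simp
  qed
  have "\<exists>!P. P + t *\<^sub>R v P = Q" for Q
  proof -
    let ?S = "{P :: R3. fst (snd P) = fst (snd Q)}"
    have "closed ?S"
      by (rule closed_Collect_eq) (intro continuous_intros)+
    then have "complete ?S" by (simp only: complete_eq_closed)
    moreover have "Q \<in> ?S" by simp
    ultimately have "\<exists>!P. P \<in> ?S \<and> Q - t *\<^sub>R v P = P"
      using y0 tlip c by (intro Banach_fix[of _ c]) (auto simp: dist_norm norm_minus_commute)
    moreover have "P \<in> ?S \<and> Q - t *\<^sub>R v P = P \<longleftrightarrow> P + t *\<^sub>R v P = Q" for P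
      using y0[of P] by (auto simp: algebra_simps)
    ultimately show ?thesis by simp
  qed
  then show "bij (\<lambda>P. snd (t, P) + fst (t, P) *\<^sub>R v (snd (t, P)))"
    by (auto simp: bij_iff)
qed auto

lemma strict_mono_bounded_surj:
  fixes f :: "real \<Rightarrow> real"
  assumes "continuous_on UNIV f" "strict_mono f" "\<And>y. \<bar>f y - y\<bar> \<le> M"
  shows "bij f"
proof -
  have "\<exists>x. f x = y" for y
  proof -
    have "f (y - M) \<le> y" "y \<le> f (y + M)" "y - M \<le> y + M"
      using assms(3)[of "y - M"] assms(3)[of "y + M"] by linarith+
    then show ?thesis
      using IVT'[of f "y - M" y "y + M"] continuous_on_subset[OF assms(1)] by blast
  qed
  then show ?thesis
    using strict_mono_imp_inj_on[OF assms(2)] unfolding bij_def surj_def by metis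
qed

text \<open>On each line parallel to the y-axis the map at time t is a convex combination of two
  strictly increasing functions, the identity and the final map. It stays within bounded distance of
  the identity and is thus a bijection of the line.\<close>

lemma isotopic_fibre_monotone:
  fixes e :: "R3 \<Rightarrow> real"
  assumes cont: "continuous_on UNIV e" and bnd: "\<And>P. \<bar>e P\<bar> \<le> M"
    and mono: "\<And>x y y' z. y < y' \<Longrightarrow> y + e (x, y, z) < y' + e (x, y', z)"
  shows "isotopic A ((\<lambda>(x, y, z). (x, y + e (x, y, z), z)) ` A)"
proof (rule isotopicI[where H = "\<lambda>(t, x, y, z). (x, y + t * e (x, y, z), z)"])
  have [simp]: "(\<lambda>(t, x, y, z). (x, y + t * e (x, y, z), z)) =
    (\<lambda>q. (fst (snd q), fst (snd (snd q)) + fst q * e (snd q), snd (snd (snd q))))"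
    by auto
  show "continuous_on UNIV (\<lambda>(t, x, y, z). (x, y + t * e (x, y, z), z))"
    by (auto intro!: continuous_intros continuous_on_compose2[OF cont])
  fix t :: real assume t: "0 \<le> t" "t \<le> 1"
  have b: "bij (\<lambda>y. y + t * e (x, y, z))" for x z
  proof (rule strict_mono_bounded_surj[where M = M])
    show "continuous_on UNIV (\<lambda>y. y + t * e (x, y, z))"
      by (intro continuous_intros continuous_on_compose2[OF cont]) auto
    show "\<bar>y + t * e (x, y, z) - y\<bar> \<le> M" for y
      using mult_mono[OF t(2) bnd[of "(x, y, z)"]] t by (auto simp: abs_mult)
    show "strict_mono (\<lambda>y. y + t * e (x, y, z))"
    proof (rule strict_monoI)
      fix y y' :: real assume y: "y < y'"
      \<comment> \<open>The increment at time t, written as the convex combination of the increments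
        of the identity and of the final map.\<close>
      have "0 < (1 - t) * (y' - y) + t * ((y' + e (x, y', z)) - (y + e (x, y, z)))"
      proof (cases "t = 1")
        case True then show ?thesis using mono[OF y] by simp
      next
        case False
        then show ?thesis using mono[OF y, of x z] t y
          by (intro add_pos_nonneg mult_pos_pos mult_nonneg_nonneg) auto
      qed
      then show "y + t * e (x, y, z) < y' + t * e (x, y', z)" by (simp add: algebra_simps)
    qed
  qed
  show "bij (\<lambda>P. case (t, P) of (t, x, y, z) \<Rightarrow> (x, y + t * e (x, y, z), z))"
    unfolding bij_iff
  proof
    fix Q :: R3
    obtain x y z where Q: "Q = (x, y, z)" by (rule prod_cases3)
    from b[of x z] have "\<exists>!y0. y0 + t * e (x, y0, z) = y"
      unfolding bij_iff by (rule spec)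
    then obtain y0 where y0: "y0 + t * e (x, y0, z) = y"
        "\<And>y'. y' + t * e (x, y', z) = y \<Longrightarrow> y' = y0"
      by (elim ex1E) (rule that; blast)
    show "\<exists>!P. (case (t, P) of (t, x, y, z) \<Rightarrow> (x, y + t * e (x, y, z), z)) = Q"
    proof (rule ex1I[of _ "(x, y0, z)"])
      show "(case (t, x, y0, z) of (t, x, y, z) \<Rightarrow> (x, y + t * e (x, y, z), z)) = Q"
        using y0(1) Q by simp
      fix P assume P: "(case (t, P) of (t, x, y, z) \<Rightarrow> (x, y + t * e (x, y, z), z)) = Q"
      obtain x' y' z' where P': "P = (x', y', z')" by (rule prod_cases3)
      have "x' = x" "z' = z" "y' + t * e (x, y', z) = y" using P unfolding P' Q by auto
      then show "P = (x, y0, z)" using y0(2)[of y'] P' by metis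
    qed
  qed
qed auto

section \<open>Moving point configurations\<close>

text \<open>With y as time, this is the track of \<open>s\<close> points moving in the (x,
  z)-plane.\<close>

definition band :: "nat \<Rightarrow> real \<Rightarrow> real \<Rightarrow> (nat \<Rightarrow> real \<Rightarrow> real \<times> real) \<Rightarrow> R3 set" where
  "band s a b f = {(x, y, z). a \<le> y \<and> y \<le> b \<and> (\<exists>p<s. f p y = (x, z))}"

text \<open>The displacement \<open>w\<close> is a sum of cone-shaped bumps of radius
  \<open>d\<close>, one around each moving point, weighted by g - f. A bump vanishes at all other
  points, so every point goes exactly to its new place. Each bump has Lipschitz constant 1/d, hence
  the sum has constant s * \<epsilon> / d < 1 and \<open>isotopic_fibre_contraction\<close> applies.
  \<open>K\<close> is fixed: at inner times it stays at distance at least 1 \<ge> d from the points,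
  and at the ends the weights are zero.\<close>

lemma band_isotopic_small:
  fixes f g :: "nat \<Rightarrow> real \<Rightarrow> real \<times> real"
  assumes ab: "a \<le> b"
    and cont: "\<And>p. p < s \<Longrightarrow> continuous_on {a..b} (f p)" "\<And>p. p < s \<Longrightarrow> continuous_on {a..b} (g p)"
    and ends: "\<And>p. p < s \<Longrightarrow> f p a = g p a" "\<And>p. p < s \<Longrightarrow> f p b = g p b"
    and d: "0 < d" "d \<le> 1"
    and sep: "\<And>p q y. p < s \<Longrightarrow> q < s \<Longrightarrow> p \<noteq> q \<Longrightarrow> a \<le> y \<Longrightarrow> y \<le> b \<Longrightarrow> d \<le> dist (f p y) (f q y)"
    and right: "\<And>p y. p < s \<Longrightarrow> a \<le> y \<Longrightarrow> y \<le> b \<Longrightarrow> 0 \<le> fst (f p y)"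
    and eps: "\<And>p y. p < s \<Longrightarrow> a \<le> y \<Longrightarrow> y \<le> b \<Longrightarrow> dist (g p y) (f p y) \<le> \<epsilon>"
    and small: "real s * \<epsilon> < d" "0 \<le> \<epsilon>"
    and K: "\<And>x y z. (x, y, z) \<in> K \<Longrightarrow> a < y \<Longrightarrow> y < b \<Longrightarrow> x \<le> -1"
  shows "isotopic (band s a b f \<union> K) (band s a b g \<union> K)"
proof -
  \<comment> \<open>Time is clamped to [a, b]. Beyond the interval the displacement is the one at an
    end, where f and g agree, so it vanishes there.\<close>
  define cl where "cl y = max a (min b y)" for y
  have cl: "a \<le> cl y" "cl y \<le> b" for y using ab by (auto simp: cl_def)
  have cl_id: "cl y = y" if "a \<le> y" "y \<le> b" for y using that by (simp add: cl_def)
  have cl_cont: "continuous_on UNIV cl"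
    unfolding cl_def by (intro continuous_intros)
  define \<phi> where "\<phi> p y q = max 0 (1 - dist q (f p (cl y)) / d)" for p y and q :: "real \<times> real"
  define w where "w y q = (\<Sum>p<s. \<phi> p y q *\<^sub>R (g p (cl y) - f p (cl y)))" for y and q :: "real \<times> real"
  define v :: "R3 \<Rightarrow> R3" where "v P = (let u = w (fst (snd P)) (fst P, snd (snd P)) in (fst u, 0, snd u))" for P
  have cf: "continuous_on UNIV (\<lambda>P :: R3. f p (cl (fst (snd P))))" "continuous_on UNIV (\<lambda>P :: R3. g p (cl (fst (snd P))))"
    if "p < s" for p
  proof -
    have *: "continuous_on UNIV (\<lambda>P :: R3. cl (fst (snd P)))"
      by (rule continuous_on_compose2[OF cl_cont]) (auto intro!: continuous_intros)
    show "continuous_on UNIV (\<lambda>P :: R3. f p (cl (fst (snd P))))" 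
      by (rule continuous_on_compose2[OF cont(1)[OF that] *]) (use cl in auto)
    show "continuous_on UNIV (\<lambda>P :: R3. g p (cl (fst (snd P))))" 
      by (rule continuous_on_compose2[OF cont(2)[OF that] *]) (use cl in auto)
  qed
  have "isotopic A ((\<lambda>P. P + v P) ` A)" for A
  proof (rule isotopic_fibre_contraction)
    have "continuous_on UNIV (\<lambda>P. w (fst (snd P)) (fst P, snd (snd P)))"
      unfolding w_def \<phi>_def using d
      by (intro continuous_on_sum continuous_intros cf) auto
    then show "continuous_on UNIV v"
      unfolding v_def Let_def by (intro continuous_intros)
    show "0 \<le> real s * \<epsilon> / d" "real s * \<epsilon> / d < 1" using d small by auto
    show "fst (snd (v P)) = 0" for P by (simp add: v_def Let_def)
    fix P Q :: R3 assume PQ: "fst (snd P) = fst (snd Q)"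
    define y where "y = fst (snd P)"
    define q where "q = (fst P, snd (snd P))"
    define q' where "q' = (fst Q, snd (snd Q))"
    have "dist (v P) (v Q) = dist (w y q) (w y q')"
      using PQ by (simp add: v_def y_def q_def q'_def Let_def dist_prod_def)
    also have "\<dots> = norm (\<Sum>p<s. (\<phi> p y q - \<phi> p y q') *\<^sub>R (g p (cl y) - f p (cl y)))"
      by (simp add: w_def dist_norm sum_subtractf scaleR_diff_left)
    also have "\<dots> \<le> (\<Sum>p<s. dist q q' / d * \<epsilon>)"
    proof (rule order_trans[OF norm_sum], rule sum_mono)
      fix p assume p: "p \<in> {..<s}"
      have "\<bar>dist q (f p (cl y)) - dist q' (f p (cl y))\<bar> \<le> dist q q'"
        using dist_triangle2[of q "f p (cl y)" q'] dist_triangle2[of q' "f p (cl y)" q] 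
          dist_triangle[of q "f p (cl y)" q'] dist_triangle[of q' "f p (cl y)" q]
        by (simp add: dist_commute abs_le_iff)
      then have "\<bar>dist q (f p (cl y)) / d - dist q' (f p (cl y)) / d\<bar> \<le> dist q q' / d"
        using d by (simp add: divide_right_mono flip: diff_divide_distrib)
      then have "\<bar>\<phi> p y q - \<phi> p y q'\<bar> \<le> dist q q' / d" unfolding \<phi>_def by linarith
      moreover have "norm (g p (cl y) - f p (cl y)) \<le> \<epsilon>"
        using eps[of p "cl y"] p cl by (simp add: dist_norm)
      ultimately show "norm ((\<phi> p y q - \<phi> p y q') *\<^sub>R (g p (cl y) - f p (cl y))) \<le> dist q q' / d * \<epsilon>"
        unfolding norm_scaleR by (intro mult_mono) auto
    qed
    also have "\<dots> = real s * \<epsilon> / d * dist q q'" by simp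
    also have "dist q q' = dist P Q"
      using PQ by (simp add: q_def q'_def dist_prod_def)
    finally show "dist (v P) (v Q) \<le> real s * \<epsilon> / d * dist P Q" .
  qed
  moreover have "(\<lambda>P. P + v P) ` (band s a b f \<union> K) = band s a b g \<union> K"
  proof -
    have wb: "w y (f p y) = g p y - f p y" if "p < s" "a \<le> y" "y \<le> b" for p y
    proof -
      have "w y (f p y) = (\<Sum>r<s. if r = p then g p y - f p y else 0)"
        unfolding w_def
      proof (rule sum.cong[OF refl])
        fix r assume "r \<in> {..<s}"
        then show "\<phi> r y (f p y) *\<^sub>R (g r (cl y) - f r (cl y)) = (if r = p then g p y - f p y else 0)"
          using sep[OF that(1), of r y] that cl_id d by (auto simp: \<phi>_def max_def field_simps)
      qed
      then show ?thesis using that by simp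
    qed
    have vK: "v P = 0" if "P \<in> K" for P
    proof -
      obtain x y z where P: "P = (x, y, z)" by (rule prod_cases3)
      have "\<phi> p y (x, z) *\<^sub>R (g p (cl y) - f p (cl y)) = 0" if p: "p < s" for p
      proof (cases "a < y \<and> y < b")
        case True
        then have "x \<le> -1" using K \<open>P \<in> K\<close> P by blast
        moreover have "0 \<le> fst (f p (cl y))" using right[OF p] cl by auto
        ultimately have "1 \<le> dist (x, z) (f p (cl y))"
          using dist_fst_le[of "(x, z)" "f p (cl y)"] by (simp add: dist_real_def)
        then have "\<phi> p y (x, z) = 0" using d by (simp add: \<phi>_def max_def field_simps)
        then show ?thesis by simp
      next
        case False
        then have "cl y = a \<or> cl y = b" using ab by (auto simp: cl_def)
        then show ?thesis using ends[OF p] by auto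
      qed
      then have "w y (x, z) = 0" unfolding w_def by (intro sum.neutral) auto
      then show ?thesis by (simp add: v_def P Let_def zero_prod_def)
    qed
    have eq: "(x, y, z) + v (x, y, z) = (fst (g p y), y, snd (g p y))"
      if "p < s" "a \<le> y" "y \<le> b" "f p y = (x, z)" for p x y z
      using wb[OF that(1-3)] that(4) by (simp add: v_def Let_def)
    have "(\<lambda>P. P + v P) ` band s a b f = band s a b g"
    proof (intro set_eqI iffI)
      fix P assume "P \<in> (\<lambda>P. P + v P) ` band s a b f"
      then obtain x y z p where "p < s" "a \<le> y" "y \<le> b" "f p y = (x, z)" "P = (x, y, z) + v (x, y, z)"
        unfolding band_def by auto
      then show "P \<in> band s a b g" using eq by (auto simp: band_def)
    next
      fix P assume "P \<in> band s a b g"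
      then obtain x y z p where p: "p < s" "a \<le> y" "y \<le> b" "g p y = (x, z)" "P = (x, y, z)"
        unfolding band_def by auto
      obtain x' z' where f: "f p y = (x', z')" by (rule prod.exhaust)
      have "P = (x', y, z') + v (x', y, z')" using eq[OF p(1-3) f] p by simp
      moreover have "(x', y, z') \<in> band s a b f" using p f by (auto simp: band_def)
      ultimately show "P \<in> (\<lambda>P. P + v P) ` band s a b f" by blast
    qed
    moreover have "(\<lambda>P. P + v P) ` K = K" using vK by auto
    ultimately show ?thesis by (simp add: image_Un)
  qed
  ultimately show ?thesis by metis
qed

lemma uniform_lower_bound:
  fixes h :: "'i \<Rightarrow> 'x \<Rightarrow> real"
  assumes "finite I" "\<And>i. i \<in> I \<Longrightarrow> \<exists>d>0. \<forall>x\<in>X. d \<le> h i x"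
  shows "\<exists>d>0. \<forall>i\<in>I. \<forall>x\<in>X. d \<le> h i x"
  using assms
proof (induction I)
  case (insert i I)
  obtain d e where "d > 0" "\<forall>i\<in>I. \<forall>x\<in>X. d \<le> h i x" "e > 0" "\<forall>x\<in>X. e \<le> h i x"
    using insert by (metis insert_iff)
  then show ?case by (intro exI[of _ "min d e"]) (auto simp: min_le_iff_disj)
qed (auto intro: exI[of _ 1])

text \<open>By compactness the interpolated points keep a common positive distance and the two
  motions are a bounded distance apart. Hence the straight-line homotopy can be cut into finitely
  many steps that are small enough for \<open>band_isotopic_small\<close>.\<close>

lemma band_isotopic_linear:
  fixes f g :: "nat \<Rightarrow> real \<Rightarrow> real \<times> real"
  assumes ab: "a \<le> b"
    and cont: "\<And>p. p < s \<Longrightarrow> continuous_on {a..b} (f p)" "\<And>p. p < s \<Longrightarrow> continuous_on {a..b} (g p)"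
    and ends: "\<And>p. p < s \<Longrightarrow> f p a = g p a" "\<And>p. p < s \<Longrightarrow> f p b = g p b"
    and sep: "\<And>p q t y. p < s \<Longrightarrow> q < s \<Longrightarrow> p < q \<Longrightarrow> a \<le> y \<Longrightarrow> y \<le> b \<Longrightarrow> 0 \<le> t \<Longrightarrow> t \<le> 1 \<Longrightarrow>
        (1 - t) *\<^sub>R f p y + t *\<^sub>R g p y \<noteq> (1 - t) *\<^sub>R f q y + t *\<^sub>R g q y"
    and right: "\<And>p y. p < s \<Longrightarrow> a \<le> y \<Longrightarrow> y \<le> b \<Longrightarrow> 0 \<le> fst (f p y)"
      "\<And>p y. p < s \<Longrightarrow> a \<le> y \<Longrightarrow> y \<le> b \<Longrightarrow> 0 \<le> fst (g p y)"
    and K: "\<And>x y z. (x, y, z) \<in> K \<Longrightarrow> a < y \<Longrightarrow> y < b \<Longrightarrow> x \<le> -1"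
  shows "isotopic (band s a b f \<union> K) (band s a b g \<union> K)"
proof -
  define F where "F t p y = (1 - t) *\<^sub>R f p y + t *\<^sub>R g p y" for t p y
  have cF: "continuous_on ({0..1} \<times> {a..b}) (\<lambda>r. F (fst r) p (snd r))" if "p < s" for p
    unfolding F_def
    by (intro continuous_intros continuous_on_compose2[OF cont(1)[OF that]] continuous_on_compose2[OF cont(2)[OF that]]) auto
  have cpt: "compact ({0..1::real} \<times> {a..b})" by (intro compact_Times) auto
  have ne: "{0..1::real} \<times> {a..b} \<noteq> {}" using ab by auto
  have sep': "F t p y \<noteq> F t q y" if "p < s" "q < s" "p \<noteq> q" "a \<le> y" "y \<le> b" "0 \<le> t" "t \<le> 1" for p q t y
    using sep[of p q y t] sep[of q p y t] that unfolding F_def by (metis linorder_neqE_nat)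
  have "\<exists>d>0. \<forall>i\<in>{(p, q). p < s \<and> q < s \<and> p \<noteq> q}. \<forall>r\<in>{0..1} \<times> {a..b}.
      d \<le> dist (F (fst r) (fst i) (snd r)) (F (fst r) (snd i) (snd r))"
  proof (rule uniform_lower_bound)
    show "finite {(p, q). p < s \<and> q < s \<and> p \<noteq> q}"
      by (rule finite_subset[of _ "{..<s} \<times> {..<s}"]) auto
    fix i assume "i \<in> {(p, q). p < s \<and> q < s \<and> p \<noteq> q}"
    then have i: "fst i < s" "snd i < s" "fst i \<noteq> snd i" by auto
    have "continuous_on ({0..1} \<times> {a..b}) (\<lambda>r. dist (F (fst r) (fst i) (snd r)) (F (fst r) (snd i) (snd r)))"
      by (intro continuous_on_dist cF i)
    then obtain r0 where r0: "r0 \<in> {0..1} \<times> {a..b}"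
      "\<forall>r\<in>{0..1} \<times> {a..b}. dist (F (fst r0) (fst i) (snd r0)) (F (fst r0) (snd i) (snd r0))
         \<le> dist (F (fst r) (fst i) (snd r)) (F (fst r) (snd i) (snd r))"
      using continuous_attains_inf[OF cpt ne] by blast
    have "F (fst r0) (fst i) (snd r0) \<noteq> F (fst r0) (snd i) (snd r0)"
      using r0(1) by (intro sep' i) auto
    then show "\<exists>d>0. \<forall>r\<in>{0..1} \<times> {a..b}. d \<le> dist (F (fst r) (fst i) (snd r)) (F (fst r) (snd i) (snd r))"
      using r0(2) by (intro exI[of _ "dist (F (fst r0) (fst i) (snd r0)) (F (fst r0) (snd i) (snd r0))"]) auto
  qed
  then obtain d where d: "d > 0" "\<And>p q t y. p < s \<Longrightarrow> q < s \<Longrightarrow> p \<noteq> q \<Longrightarrow> a \<le> y \<Longrightarrow> y \<le> b \<Longrightarrow> 0 \<le> t \<Longrightarrow> t \<le> 1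
      \<Longrightarrow> d \<le> dist (F t p y) (F t q y)"
    by fastforce
  \<comment> \<open>An upper bound for the distances is wanted. Passing to inverses turns it into a
    lower bound, so that \<open>uniform_lower_bound\<close> serves again; the summand 1 keeps the
    inverted quantity positive.\<close>
  have "\<exists>e>0. \<forall>p\<in>{..<s}. \<forall>y\<in>{a..b}. e \<le> inverse (1 + dist (g p y) (f p y))"
  proof (rule uniform_lower_bound)
    fix p assume "p \<in> {..<s}"
    then have "continuous_on {a..b} (\<lambda>y. dist (g p y) (f p y))"
      using cont by (intro continuous_on_dist) auto
    then obtain y0 where y0: "\<forall>y\<in>{a..b}. dist (g p y) (f p y) \<le> dist (g p y0) (f p y0)"
      using continuous_attains_sup[of "{a..b}" "\<lambda>y. dist (g p y) (f p y)"] ab by auto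
    have pos: "0 < 1 + dist (g p y) (f p y)" for y
      using zero_le_dist[of "g p y" "f p y"] by linarith
    show "\<exists>e>0. \<forall>y\<in>{a..b}. e \<le> inverse (1 + dist (g p y) (f p y))"
      using y0 pos by (intro exI[of _ "inverse (1 + dist (g p y0) (f p y0))"] conjI ballI le_imp_inverse_le) auto
  qed auto
  then obtain e where e: "e > 0" "\<And>p y. p < s \<Longrightarrow> a \<le> y \<Longrightarrow> y \<le> b \<Longrightarrow> e \<le> inverse (1 + dist (g p y) (f p y))"
    by auto
  define M where "M = inverse e"
  have M: "dist (g p y) (f p y) \<le> M" if "p < s" "a \<le> y" "y \<le> b" for p y
  proof -
    have "0 < 1 + dist (g p y) (f p y)" using zero_le_dist[of "g p y" "f p y"] by linarith
    then show ?thesis using e(2)[OF that] e(1)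
      by (simp add: M_def field_simps) 
  qed
  have "M > 0" using e by (simp add: M_def)
  \<comment> \<open>Each of the k steps moves a point by at most M / k, and k is large enough for s
    * (M / k) < min d 1.\<close>
  obtain k :: nat where k: "real s * M / min d 1 < real k" using reals_Archimedean2 by blast
  have "0 \<le> real s * M / min d 1" using \<open>M > 0\<close> d by auto
  then have "k > 0" using k by (cases "k = 0") auto
  have main: "isotopic (band s a b f \<union> K) (band s a b (F (real i / real k)) \<union> K)" if "i \<le> k" for i
    using that
  proof (induction i)
    case 0
    have "F 0 = f" by (simp add: F_def fun_eq_iff)
    then show ?case by (simp add: isotopic_refl)
  next
    case (Suc i)
    let ?t = "real i / real k" and ?u = "real (Suc i) / real k"
    have t: "0 \<le> ?t" "?t \<le> 1" "?u - ?t = 1 / real k" 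
      using Suc.prems \<open>k > 0\<close> by (auto simp: field_simps)
    have cF': "continuous_on {a..b} (F t p)" if "p < s" for t p
      unfolding F_def by (intro continuous_intros cont that)
    have "isotopic (band s a b (F ?t) \<union> K) (band s a b (F ?u) \<union> K)"
    proof (rule band_isotopic_small[where d = "min d 1" and \<epsilon> = "M / real k"])
      show "F ?t p a = F ?u p a" "F ?t p b = F ?u p b" if "p < s" for p
        using ends[OF that] by (simp_all add: F_def flip: scaleR_add_left)
      show "min d 1 \<le> dist (F ?t p y) (F ?t q y)"
        if "p < s" "q < s" "p \<noteq> q" "a \<le> y" "y \<le> b" for p q y
        using d(2)[OF that, of ?t] t by simp
      show "0 \<le> fst (F ?t p y)" if "p < s" "a \<le> y" "y \<le> b" for p y
        using right[OF that] t unfolding F_def by simp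
      show "dist (F ?u p y) (F ?t p y) \<le> M / real k" if "p < s" "a \<le> y" "y \<le> b" for p y
      proof -
        have "F ?u p y - F ?t p y = (?u - ?t) *\<^sub>R (g p y - f p y)"
          by (simp add: F_def algebra_simps)
        then have "dist (F ?u p y) (F ?t p y) = \<bar>?u - ?t\<bar> * dist (g p y) (f p y)"
          by (simp add: dist_norm)
        also have "\<dots> = dist (g p y) (f p y) / real k" by (simp only: t(3)) simp
        also have "\<dots> \<le> M / real k" using M[OF that] by (simp add: divide_right_mono)
        finally show ?thesis .
      qed
      show "real s * (M / real k) < min d 1"
        using k \<open>k > 0\<close> d(1) by (simp add: pos_divide_less_eq mult.commute del: min_less_iff_conj)
      show "min d 1 \<le> 1" by simp
    qed (use ab cF' d \<open>M > 0\<close> K in auto)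
    with Suc show ?case using isotopic_trans by simp
  qed
  have "F 1 = g" by (simp add: F_def fun_eq_iff)
  then show ?thesis using main[of k] \<open>k > 0\<close> by simp
qed

section \<open>The group generated by reversals of windows\<close>

definition window_rev :: "nat \<Rightarrow> nat \<Rightarrow> nat \<Rightarrow> nat" where
  "window_rev j n p = (if j \<le> p \<and> p < j + n then 2 * j + n - 1 - p else p)"

lemma window_rev_involution: "window_rev j n (window_rev j n p) = p"
  by (auto simp: window_rev_def)

lemma window_rev_permutes: "j + n \<le> s \<Longrightarrow> window_rev j n permutes {..<s}"
  unfolding permutes_def
  by (metis window_rev_involution lessThan_iff not_le_imp_less window_rev_def less_le_trans add_less_imp_less_left)

text \<open>A reversal is a product of n div 2 disjoint transpositions; the induction peels off the
  outermost pair.\<close>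

lemma evenperm_window_rev: "evenperm (window_rev j n) \<longleftrightarrow> even (n div 2)"
proof (induction n arbitrary: j rule: induct_nat_012)
  case 0
  have "window_rev j 0 = id" by (auto simp: window_rev_def fun_eq_iff)
  then show ?case by (simp add: evenperm_id)
next
  case 1
  have "window_rev j (Suc 0) = id" by (auto simp: window_rev_def fun_eq_iff)
  then show ?case by (simp add: evenperm_id)
next
  case (ge2 n)
  have eq: "window_rev j (Suc (Suc n)) = Transposition.transpose j (j + n + 1) \<circ> window_rev (Suc j) n"
    by (auto simp: window_rev_def Transposition.transpose_def fun_eq_iff)
  have "permutation (window_rev (Suc j) n)"
    using window_rev_permutes[of "Suc j" n "Suc j + n"] permutation_permutes by blast
  then show ?case
    unfolding eq using ge2(1)[of "Suc j"]
    by (subst evenperm_comp) (auto simp: permutation_swap_id evenperm_swap)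
qed

text \<open>The reversals are involutions, so their products already form a group.\<close>
inductive_set rev_group :: "nat \<Rightarrow> nat \<Rightarrow> (nat \<Rightarrow> nat) set" for s n where
  id: "id \<in> rev_group s n"
| step: "h \<in> rev_group s n \<Longrightarrow> j + n \<le> s \<Longrightarrow> h \<circ> window_rev j n \<in> rev_group s n"

lemma rev_group_gen: "j + n \<le> s \<Longrightarrow> window_rev j n \<in> rev_group s n"
  using rev_group.step[OF rev_group.id] by (metis id_comp)

lemma rev_group_comp:
  assumes "g \<in> rev_group s n" "h \<in> rev_group s n" shows "g \<circ> h \<in> rev_group s n"
  using assms(2,1) by (induction) (auto simp: o_assoc intro: rev_group.step)

lemma rev_group_permutes: "h \<in> rev_group s n \<Longrightarrow> h permutes {..<s}"
proof (induction rule: rev_group.induct)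
  case (step h j)
  show ?case by (rule permutes_compose[OF window_rev_permutes[OF step(2)] step(3)])
qed (rule permutes_id)

lemma rev_group_inv: "h \<in> rev_group s n \<Longrightarrow> inv h \<in> rev_group s n"
proof (induction rule: rev_group.induct)
  case (step h j)
  have "inv (window_rev j n) = window_rev j n"
    by (rule inv_unique_comp) (auto simp: window_rev_involution)
  then have "inv (h \<circ> window_rev j n) = window_rev j n \<circ> inv h"
    using o_inv_distrib[of h "window_rev j n"] rev_group_permutes[OF step(1)]
      window_rev_permutes[OF step(2)] permutes_bij by metis
  then show ?case using rev_group_comp[OF rev_group_gen[OF step(2)] step(3)] by (simp only:)
qed (simp only: inv_id rev_group.id)

text \<open>Transpositions are their own inverses, so this says that two of them lie in the same
  left coset of the group. Once all transpositions are linked, the group contains every product of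
  two of them, that is, the alternating group.\<close>

definition linked :: "nat \<Rightarrow> nat \<Rightarrow> nat \<times> nat \<Rightarrow> nat \<times> nat \<Rightarrow> bool" where
  "linked s n e f \<longleftrightarrow> Transposition.transpose (fst e) (snd e) \<circ> Transposition.transpose (fst f) (snd f) \<in> rev_group s n"

lemma linked_refl: "linked s n e e"
  by (simp add: linked_def rev_group.id)

lemma linked_swap: "linked s n (a, b) f \<longleftrightarrow> linked s n (b, a) f" "linked s n f (a, b) \<longleftrightarrow> linked s n f (b, a)"
  by (simp_all add: linked_def transpose_commute)

lemma linked_trans:
  assumes "linked s n e f" "linked s n f g" shows "linked s n e g"
proof -
  have "Transposition.transpose (fst e) (snd e) \<circ> Transposition.transpose (fst g) (snd g)
     = (Transposition.transpose (fst e) (snd e) \<circ> Transposition.transpose (fst f) (snd f)) \<circ>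
       (Transposition.transpose (fst f) (snd f) \<circ> Transposition.transpose (fst g) (snd g))"
    by (simp add: fun_eq_iff)
  then show ?thesis using assms rev_group_comp unfolding linked_def by metis
qed

lemma linked_sym:
  assumes "linked s n e f" shows "linked s n f e"
proof -
  have "inv (Transposition.transpose (fst e) (snd e) \<circ> Transposition.transpose (fst f) (snd f))
     = Transposition.transpose (fst f) (snd f) \<circ> Transposition.transpose (fst e) (snd e)"
    by (rule inv_unique_comp) (auto simp: fun_eq_iff)
  then show ?thesis using assms rev_group_inv unfolding linked_def by metis
qed

text \<open>Conjugation by \<open>h\<close> merely relabels the two transpositions, so one linked
  pair yields its whole orbit under the group.\<close>

lemma linked_conj:
  assumes "linked s n (a, b) (c, d)" "h \<in> rev_group s n"
  shows "linked s n (h a, h b) (h c, h d)"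
proof -
  have b: "bij h" using rev_group_permutes[OF assms(2)] permutes_bij by blast
  have "Transposition.transpose (h x) (h y) = h \<circ> Transposition.transpose x y \<circ> inv h" for x y
  proof
    fix z
    obtain w where "z = h w" using b by (metis bij_pointE)
    then show "Transposition.transpose (h x) (h y) z = (h \<circ> Transposition.transpose x y \<circ> inv h) z"
      using b by (simp add: Transposition.transpose_def bij_is_inj inj_eq)
  qed
  then have "Transposition.transpose (h a) (h b) \<circ> Transposition.transpose (h c) (h d) =
     h \<circ> (Transposition.transpose a b \<circ> Transposition.transpose c d) \<circ> inv h"
    using b by (auto simp: fun_eq_iff bij_is_inj)
  then show ?thesis using assms rev_group_comp rev_group_inv unfolding linked_def by (metis fst_conv snd_conv)
qed

text \<open>A 3-cycle on a, b, z can be written as (a b)(a z) and also as (a z)(b z).\<close>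

lemma linked_triangle:
  assumes "linked s n (a, z) (b, z)" "a \<noteq> b" "a \<noteq> z" "b \<noteq> z"
  shows "linked s n (a, b) (a, z)"
proof -
  have "Transposition.transpose a b \<circ> Transposition.transpose a z =
     Transposition.transpose a z \<circ> Transposition.transpose b z"
    using assms(2-4) by (auto simp: fun_eq_iff Transposition.transpose_def)
  then show ?thesis using assms(1) by (simp add: linked_def)
qed

text \<open>All transpositions considered share the apex j + n + 1. The element h =
  \<open>?r 1 \<circ> ?r 0\<close> fixes the apex and acts on the offsets 0, ..., n as i \<mapsto> i
  + 2 modulo n + 1. As n + 1 is odd, this is a single cycle. The 3-cycle \<open>eq\<close> links the
  offsets n - 1 and 0, and conjugation by h carries this link around the cycle: first along the even
  offsets, then from n to 1, then along the odd ones.\<close>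

lemma linked_window:
  assumes n: "even n" "n \<ge> 2" and j: "j + n + 2 \<le> s" and i: "i \<le> n"
  shows "linked s n (j + i, j + n + 1) (j, j + n + 1)"
proof -
  let ?r = "\<lambda>k. window_rev (j + k) n"
  have r: "?r k \<in> rev_group s n" if "k \<le> 2" for k using that j by (intro rev_group_gen) auto
  define h where "h = ?r 1 \<circ> ?r 0"
  have h: "h \<in> rev_group s n" unfolding h_def using r[of 1] r[of 0] by (intro rev_group_comp) auto
  obtain m where m: "n = Suc (Suc m)" using n(2) by (intro that[of "n - 2"]) simp
  \<comment> \<open>The 3-cycle on j, j + n - 1 and j + n + 1 as a product of four reversals. The
    cases below follow a position through the four factors.\<close>
  have eq: "Transposition.transpose j (j + n + 1) \<circ> Transposition.transpose (j + n - 1) (j + n + 1) =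
     ?r 1 \<circ> (?r 2 \<circ> (?r 1 \<circ> ?r 0))"
  proof
    fix x
    consider "x < j \<or> j + n + 1 < x" | "x = j" | "j < x" "x < j + n - 1" | "x = j + n - 1" "x \<noteq> j"
      | "x = j + n" | "x = j + n + 1" by linarith
    then have "?r 1 (?r 2 (?r 1 (?r 0 x))) =
        Transposition.transpose j (j + n + 1) (Transposition.transpose (j + n - 1) (j + n + 1) x)"
    proof cases
      case 1
      then have "?r 0 x = x" "?r 1 x = x" "?r 2 x = x" by (auto simp: window_rev_def)
      moreover have "x \<noteq> j" "x \<noteq> j + n - 1" "x \<noteq> j + n + 1" using 1 n(2) by auto
      ultimately show ?thesis by (simp add: Transposition.transpose_def)
    next
      case 2
      have "?r 0 j = j + m + 1" "?r 1 (j + m + 1) = j + 2" "?r 2 (j + 2) = j + m + 3"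
        "?r 1 (j + m + 3) = j + m + 3"
        unfolding m by (simp_all add: window_rev_def)
      with 2 m show ?thesis by (simp add: Transposition.transpose_def)
    next
      case 3
      \<comment> \<open>Naming the offset \<open>i\<close> of the position and its complement
        \<open>e\<close> in the window removes the truncated subtractions from
        \<open>window_rev\<close>.\<close>
      then have "x = Suc (j + (x - Suc j))" "n = (x - Suc j) + (j + n - 2 - x) + 3" by linarith+
      then obtain i e where ie: "x = Suc (j + i)" "n = i + e + 3" by blast
      have "?r 0 x = j + e + 1" "?r 1 (j + e + 1) = j + i + 3"
        "?r 2 (j + i + 3) = j + e + 3" "?r 1 (j + e + 3) = x"
        unfolding ie by (simp_all add: window_rev_def)
      moreover have "x \<noteq> j" "x \<noteq> j + n - 1" "x \<noteq> j + n + 1" using 3 by auto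
      ultimately show ?thesis by (simp add: Transposition.transpose_def)
    next
      case 4
      have x: "x = j + m + 1" using 4 m by linarith
      have "?r 0 (j + m + 1) = j" "?r 1 j = j" "?r 2 j = j"
        unfolding m by (simp_all add: window_rev_def)
      then show ?thesis unfolding x m by (simp add: Transposition.transpose_def)
    next
      case 5
      have x: "x = j + m + 2" using 5 m by linarith
      have "?r 0 (j + m + 2) = j + m + 2" "?r 1 (j + m + 2) = j + 1" "?r 2 (j + 1) = j + 1"
        "?r 1 (j + 1) = j + m + 2"
        unfolding m by (simp_all add: window_rev_def)
      then show ?thesis unfolding x m by (simp add: Transposition.transpose_def)
    next
      case 6
      have x: "x = j + m + 3" using 6 m by linarith
      have "?r 0 (j + m + 3) = j + m + 3" "?r 1 (j + m + 3) = j + m + 3" "?r 2 (j + m + 3) = j + 2"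
        "?r 1 (j + 2) = j + m + 1"
        unfolding m by (simp_all add: window_rev_def)
      then show ?thesis unfolding x m by (simp add: Transposition.transpose_def)
    qed
    then show "(Transposition.transpose j (j + n + 1) \<circ> Transposition.transpose (j + n - 1) (j + n + 1)) x =
     (?r 1 \<circ> (?r 2 \<circ> (?r 1 \<circ> ?r 0))) x" by (simp only: comp_apply)
  qed
  have "linked s n (j, j + n + 1) (j + n - 1, j + n + 1)"
    unfolding linked_def fst_conv snd_conv eq
    by (intro rev_group_comp r) simp_all
  then have base: "linked s n (j + n - 1, j + n + 1) (j, j + n + 1)" by (rule linked_sym)
  have h2: "h (j + k) = j + k + 2" if "k + 2 \<le> n" for k
  proof -
    obtain d where d: "n = k + 2 + d" using \<open>k + 2 \<le> n\<close> le_Suc_ex by blast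
    have "?r 0 (j + k) = j + d + 1" "?r 1 (j + d + 1) = j + k + 2"
      unfolding d by (simp_all add: window_rev_def)
    then show ?thesis by (simp only: h_def comp_apply)
  qed
  have "?r 0 (j + m + 1) = j" "?r 1 j = j"
    "?r 0 (j + m + 2) = j + m + 2" "?r 1 (j + m + 2) = j + 1"
    "?r 0 (j + m + 3) = j + m + 3" "?r 1 (j + m + 3) = j + m + 3"
    unfolding m by (simp_all add: window_rev_def)
  moreover have "j + n - 1 = j + m + 1" "j + n = j + m + 2" "j + n + 1 = j + m + 3"
    unfolding m by simp_all
  ultimately have hn: "h (j + n - 1) = j" "h (j + n) = j + 1" "h (j + n + 1) = j + n + 1"
    by (simp_all only: h_def comp_apply)
  have ev: "linked s n (j + 2 * k, j + n + 1) (j + 2 * k + 2, j + n + 1)" if "2 * k + 2 \<le> n" for k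
    using that
  proof (induction k)
    case 0
    show ?case using linked_conj[OF base h] h2[of 0] n(2) unfolding hn by simp
  next
    case (Suc k)
    have "h (j + 2 * k) = j + 2 * Suc k" "h (j + 2 * k + 2) = j + 2 * Suc k + 2"
      using h2[of "2 * k"] h2[of "2 * k + 2"] Suc.prems by (simp_all add: add.assoc)
    moreover have "linked s n (j + 2 * k, j + n + 1) (j + 2 * k + 2, j + n + 1)"
      using Suc by simp
    ultimately show ?case using linked_conj[OF _ h] hn(3) by metis
  qed
  obtain l where l: "n = 2 * l + 2"
    using n by (intro that[of "(n - 2) div 2"]) auto
  \<comment> \<open>Here evenness of n enters: the last even step, from n - 2 to n, is carried by
    \<open>h\<close> to a step from n to 1, which joins the odd offsets to the even ones.\<close>
  have mid: "linked s n (j + n, j + n + 1) (j + 1, j + n + 1)"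
  proof -
    have "linked s n (j + 2 * l, j + n + 1) (j + n, j + n + 1)" "h (j + 2 * l) = j + n"
      using ev[of l] h2[of "2 * l"] l by (simp_all add: add.assoc)
    then show ?thesis using linked_conj[OF _ h] hn by metis
  qed
  have od: "linked s n (j + 2 * k + 1, j + n + 1) (j + 2 * k + 3, j + n + 1)" if "2 * k + 3 \<le> n" for k
    using that
  proof (induction k)
    case 0
    have "h (j + 1) = j + 3" using h2[of 1] 0 by simp
    then show ?case using linked_conj[OF mid h] unfolding hn by simp
  next
    case (Suc k)
    have "h (j + 2 * k + 1) = j + 2 * Suc k + 1" "h (j + 2 * k + 3) = j + 2 * Suc k + 3"
      using h2[of "2 * k + 1"] h2[of "2 * k + 3"] Suc.prems by (simp_all add: add.assoc)
    moreover have "linked s n (j + 2 * k + 1, j + n + 1) (j + 2 * k + 3, j + n + 1)"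
      using Suc by simp
    ultimately show ?case using linked_conj[OF _ h] hn(3) by metis
  qed
  have even_case: "linked s n (j + 2 * k, j + n + 1) (j, j + n + 1)" if "2 * k \<le> n" for k
    using that
  proof (induction k)
    case (Suc k)
    have eq: "j + 2 * Suc k = j + 2 * k + 2" by simp
    show ?case unfolding eq
      using linked_trans[OF linked_sym[OF ev[of k]] Suc.IH] Suc.prems by simp
  qed (simp add: linked_refl)
  have odd_case: "linked s n (j + 2 * k + 1, j + n + 1) (j, j + n + 1)" if "2 * k + 1 \<le> n" for k
    using that
  proof (induction k)
    case 0
    show ?case using linked_trans[OF linked_sym[OF mid]] even_case[of "Suc l"] l by simp
  next
    case (Suc k)
    have eq: "j + 2 * Suc k + 1 = j + 2 * k + 3" by simp
    show ?case unfolding eq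
      using linked_trans[OF linked_sym[OF od[of k]] Suc.IH] Suc.prems by simp
  qed
  show ?thesis
  proof (cases "even i")
    case True
    then obtain k where "i = 2 * k" by (rule evenE)
    then show ?thesis using even_case[of k] i by simp
  next
    case False
    then obtain k where "i = 2 * k + 1" by (rule oddE)
    then show ?thesis using odd_case[of k] i by (simp add: add.assoc)
  qed
qed

lemma linked_adjacent:
  assumes n: "even n" "n \<ge> 2" and s: "n + 2 \<le> s" and i: "i + 2 < s"
  shows "linked s n (i, i + 1) (i + 1, i + 2)"
proof -
  \<comment> \<open>The block of n + 2 positions starts at i if there is room, and otherwise is
    pushed back to end at s - 1. In the extreme case k + 1 = n the position i + 2 is the apex
    itself.\<close>
  define j where "j = min i (s - n - 2)"
  define k where "k = i - j"
  have jk: "i = j + k" "j + n + 2 \<le> s" "k + 1 \<le> n"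
    using s i n unfolding j_def k_def min_def by (auto split: if_splits)
  let ?z = "j + n + 1"
  have w: "linked s n (j + a, ?z) (j + b, ?z)" if "a \<le> n" "b \<le> n" for a b
    using linked_trans[OF linked_window[OF n jk(2) that(1)] linked_sym[OF linked_window[OF n jk(2) that(2)]]] .
  have A: "linked s n (i, i + 1) (i, ?z)"
    using linked_triangle[OF w[of k "k + 1"]] jk by simp
  show ?thesis
  proof (cases "k + 1 = n")
    case True
    then have "?z = i + 2" using jk by simp
    then show ?thesis using linked_trans[OF A] w[of k "k + 1"] jk by simp
  next
    case False
    then have "linked s n (i + 1, i + 2) (i + 1, ?z)"
      using linked_triangle[OF w[of "k + 1" "k + 2"]] jk by simp
    moreover have "linked s n (i, ?z) (i + 1, ?z)" using w[of k "k + 1"] jk by simp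
    ultimately show ?thesis using linked_trans[OF A] linked_trans linked_sym by blast
  qed
qed

text \<open>Adjacent transpositions are chained to (0, 1). A longer one is reached by moving its
  right end from c to c + 1: (a, c) and (c, c + 1) are linked already, and
  \<open>linked_triangle\<close> with apex c gives the pair (a, c + 1), (a, c).\<close>

lemma linked_all:
  assumes n: "even n" "n \<ge> 2" and s: "n + 2 \<le> s" and ab: "a < b" "b < s"
  shows "linked s n (a, b) (0, 1)"
proof -
  have adj: "linked s n (i, i + 1) (0, 1)" if "i + 1 < s" for i
    using that
  proof (induction i)
    case (Suc i)
    then show ?case
      using linked_trans[OF linked_sym[OF linked_adjacent[OF n s, of i]]] by simp
  qed (simp add: linked_refl)
  have "linked s n (a, a + Suc d) (0, 1)" if "a + Suc d < s" for d
    using that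
  proof (induction d)
    case 0
    then show ?case using adj[of a] by simp
  next
    case (Suc d)
    have "linked s n (a + Suc d, a + Suc (Suc d)) (0, 1)" using adj[of "a + Suc d"] Suc.prems by simp
    moreover have IH: "linked s n (a, a + Suc d) (0, 1)" using Suc by simp
    ultimately have "linked s n (a, a + Suc d) (a + Suc (Suc d), a + Suc d)"
      using linked_trans[OF IH linked_sym] linked_swap(2) by blast
    then have "linked s n (a + Suc d, a) (a + Suc (Suc d), a + Suc d)" using linked_swap(1) by blast
    then have "linked s n (a + Suc (Suc d), a + Suc d) (a, a + Suc d)"
      using linked_sym linked_swap by blast
    then have "linked s n (a, a + Suc (Suc d)) (a, a + Suc d)"
      by (intro linked_triangle linked_sym[of s n "(a + Suc (Suc d), a + Suc d)"]) auto
    then show ?case using linked_trans[OF _ IH] by blast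
  qed
  from this[of "b - a - 1"] ab show ?thesis by simp
qed

lemma even_mem_rev_group:
  assumes n: "even n" "n \<ge> 2" and s: "n + 2 \<le> s" and h: "h permutes {..<s}" "evenperm h"
  shows "h \<in> rev_group s n"
proof -
  let ?t = "Transposition.transpose (0 :: nat) 1"
  \<comment> \<open>The induction adds one transposition at a time and so passes through odd
    permutations. These are recorded through their product with the fixed transposition
    \<open>?t\<close>.\<close>
  have "(evenperm h \<longrightarrow> h \<in> rev_group s n) \<and> (\<not> evenperm h \<longrightarrow> ?t \<circ> h \<in> rev_group s n)"
    using h(1) finite_lessThan
  proof (induction rule: permutes_induct)
    case id
    then show ?case by (simp only: evenperm_id rev_group.id simp_thms)
  next
    case (swap a b p)
    let ?u = "Transposition.transpose a b"
    show ?case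
    proof (cases "a = b")
      case True
      then show ?thesis using swap by simp
    next
      case False
      have l: "linked s n (a, b) (0, 1)"
        using linked_all[OF n s] swap False linked_swap(1) by (metis lessThan_iff linorder_neqE_nat)
      have ut: "?u \<circ> ?t \<in> rev_group s n" "?t \<circ> ?u \<in> rev_group s n"
        using l linked_sym[OF l] by (simp_all add: linked_def)
      have p: "permutation p" using swap permutation_permutes finite_lessThan by blast
      have e: "evenperm (?u \<circ> p) \<longleftrightarrow> \<not> evenperm p"
        using p False by (simp add: evenperm_comp permutation_swap_id evenperm_swap)
      show ?thesis
      proof (cases "evenperm p")
        case True
        then have "?t \<circ> (?u \<circ> p) \<in> rev_group s n"
          using swap rev_group_comp[OF ut(2), of p] by (simp only: o_assoc)
        with True e show ?thesis by blast
      next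
        case False
        then have "?t \<circ> p \<in> rev_group s n" using swap by blast
        then have "(?u \<circ> ?t) \<circ> (?t \<circ> p) \<in> rev_group s n" by (rule rev_group_comp[OF ut(1)])
        moreover have "(?u \<circ> ?t) \<circ> (?t \<circ> p) = ?u \<circ> p" by (simp add: fun_eq_iff)
        ultimately show ?thesis using e False by metis
      qed
    qed
  qed
  then show ?thesis using h by blast
qed

text \<open>A reversal is itself odd here, so composing with one reduces an odd permutation to an
  even one.\<close>

lemma mem_rev_group:
  assumes n: "even n" "n \<ge> 2" "odd (n div 2)" and s: "n + 2 \<le> s" and h: "h permutes {..<s}"
  shows "h \<in> rev_group s n"
proof (cases "evenperm h")
  case True
  then show ?thesis using even_mem_rev_group assms by blast
next
  case False
  let ?r = "window_rev 0 n"
  have r: "?r permutes {..<s}" "?r \<in> rev_group s n"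
    using s by (auto intro: window_rev_permutes rev_group_gen)
  have "permutation h" "permutation ?r" using h r permutation_permutes finite_lessThan by blast+
  then have "evenperm (h \<circ> ?r)" using False n by (simp add: evenperm_comp evenperm_window_rev)
  then have "h \<circ> ?r \<in> rev_group s n"
    by (intro even_mem_rev_group n s permutes_compose[OF r(1) h])
  then have "(h \<circ> ?r) \<circ> ?r \<in> rev_group s n" using rev_group_comp r by blast
  moreover have "(h \<circ> ?r) \<circ> ?r = h" by (simp add: fun_eq_iff window_rev_involution)
  ultimately show ?thesis by simp
qed

section \<open>Words of layered letters and their closures\<close>

lemma closed_segment_graph_y:
  fixes x0 y0 z0 x1 y1 z1 :: real
  assumes "y0 < y1"
  shows "closed_segment (x0, y0, z0) (x1, y1, z1) =
    {(x, y, z). y0 \<le> y \<and> y \<le> y1 \<and> x = x0 + (y - y0) / (y1 - y0) * (x1 - x0)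
       \<and> z = z0 + (y - y0) / (y1 - y0) * (z1 - z0)}" (is "?L = ?R")
proof (intro set_eqI iffI)
  fix P :: R3 assume "P \<in> ?L"
  then obtain u where u: "0 \<le> u" "u \<le> 1" "P = (1 - u) *\<^sub>R (x0, y0, z0) + u *\<^sub>R (x1, y1, z1)"
    unfolding closed_segment_def by blast
  have "(y0 + u * (y1 - y0) - y0) / (y1 - y0) = u" using assms by simp
  moreover have "P = (x0 + u * (x1 - x0), y0 + u * (y1 - y0), z0 + u * (z1 - z0))"
    using u(3) by (simp add: algebra_simps)
  moreover have "y0 + u * (y1 - y0) \<le> y1"
    using mult_right_mono[of u 1 "y1 - y0"] u(1,2) assms by (simp add: algebra_simps)
  ultimately show "P \<in> ?R" using u assms by auto
next
  fix P :: R3 assume "P \<in> ?R"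
  then obtain x y z where P: "P = (x, y, z)" "y0 \<le> y" "y \<le> y1"
    "x = x0 + (y - y0) / (y1 - y0) * (x1 - x0)" "z = z0 + (y - y0) / (y1 - y0) * (z1 - z0)" by blast
  define u where "u = (y - y0) / (y1 - y0)"
  have "0 \<le> u" "u \<le> 1" "y = y0 + u * (y1 - y0)" using P assms by (auto simp: u_def field_simps)
  moreover have "P = (1 - u) *\<^sub>R (x0, y0, z0) + u *\<^sub>R (x1, y1, z1)"
    using P calculation(3) unfolding u_def[symmetric] by (simp add: algebra_simps)
  ultimately show "P \<in> ?L" unfolding closed_segment_def by blast
qed

lemma closed_segment_graph_x:
  fixes x0 x1 y z :: real
  assumes "x0 < x1"
  shows "closed_segment (x0, y, z) (x1, y, z) = {(x, y', z'). x0 \<le> x \<and> x \<le> x1 \<and> y' = y \<and> z' = z}"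
    (is "?L = ?R")
proof (intro set_eqI iffI)
  fix P :: R3 assume "P \<in> ?L"
  then obtain u where u: "0 \<le> u" "u \<le> 1" "P = (1 - u) *\<^sub>R (x0, y, z) + u *\<^sub>R (x1, y, z)"
    unfolding closed_segment_def by blast
  have "P = (x0 + u * (x1 - x0), y, z)" using u(3) by (simp add: algebra_simps)
  moreover have "x0 + u * (x1 - x0) \<le> x1"
    using mult_right_mono[of u 1 "x1 - x0"] u(1,2) assms by (simp add: algebra_simps)
  ultimately show "P \<in> ?R" using u assms by auto
next
  fix P :: R3 assume "P \<in> ?R"
  then obtain x where P: "P = (x, y, z)" "x0 \<le> x" "x \<le> x1" by blast
  define u where "u = (x - x0) / (x1 - x0)"
  have "0 \<le> u" "u \<le> 1" "x = x0 + u * (x1 - x0)" using P assms by (auto simp: u_def field_simps)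
  moreover have "P = (1 - u) *\<^sub>R (x0, y, z) + u *\<^sub>R (x1, y, z)"
    using P calculation(3) by (simp add: algebra_simps)
  ultimately show "P \<in> ?L" unfolding closed_segment_def by blast
qed

lemma mem_closure_arc:
  "(x, y, z) \<in> closure_arc N p \<longleftrightarrow> z = 0 \<and>
    (x = real p \<and> (real N \<le> y \<and> y \<le> real N + real p + 1 \<or> - (real p + 1) \<le> y \<and> y \<le> 0) \<or>
     - (real p + 1) \<le> x \<and> x \<le> real p \<and> (y = real N + real p + 1 \<or> y = - (real p + 1)) \<or>
     x = - (real p + 1) \<and> - (real p + 1) \<le> y \<and> y \<le> real N + real p + 1)"
proof -
  define d where "d = real p + 1"
  have d: "d > 0" "- d < real p" "real p = d - 1" by (auto simp: d_def)
  have "closure_arc N p =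
     closed_segment (real p, real N, 0) (real p, real N + d, 0) \<union>
     closed_segment (- d, real N + d, 0) (real p, real N + d, 0) \<union>
     closed_segment (- d, - d, 0) (- d, real N + d, 0) \<union>
     closed_segment (- d, - d, 0) (real p, - d, 0) \<union>
     closed_segment (real p, - d, 0) (real p, 0, 0)"
    unfolding closure_arc_def Let_def d_def
    by (simp only: closed_segment_commute[of "(real p, real N + (real p + 1), 0)" "(- (real p + 1), real N + (real p + 1), 0)"]
        closed_segment_commute[of "(- (real p + 1), real N + (real p + 1), 0)" "(- (real p + 1), - (real p + 1), 0)"])
  moreover have "real N < real N + d" "- d < real N + d" "- d < 0" using d by linarith+
  ultimately show ?thesis
    using d(2) by (auto simp: closed_segment_graph_y closed_segment_graph_x add.assoc simp flip: d_def)
qed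

section \<open>Letters, words and their congruence\<close>

type_synonym letter = "(nat \<Rightarrow> nat) \<times> (nat \<Rightarrow> real)"

text \<open>The value at t = 1/2 is 1, so a strand with entry l passes the middle of its slab at z =
  - l, as in \<open>crossing_set\<close>. Larger entries are therefore deeper.\<close>

definition tent :: "real \<Rightarrow> real" where
  "tent t = min (2 * t) (2 * (1 - t))"

definition strand :: "letter \<Rightarrow> nat \<Rightarrow> real \<Rightarrow> real \<times> real" where
  "strand a p t = (real p + t * (real (fst a p) - real p), - snd a p * tent t)"

definition slab :: "nat \<Rightarrow> nat \<Rightarrow> letter \<Rightarrow> R3 set" where
  "slab s k a = band s (real k) (real k + 1) (\<lambda>p y. strand a p (y - real k))"

fun slabs :: "nat \<Rightarrow> nat \<Rightarrow> letter list \<Rightarrow> R3 set" where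
  "slabs s k [] = {}"
| "slabs s k (a # w) = slab s k a \<union> slabs s (Suc k) w"

definition arcs :: "nat \<Rightarrow> nat \<Rightarrow> R3 set" where
  "arcs s N = (\<Union>p<s. closure_arc N p)"

definition word_closure :: "nat \<Rightarrow> letter list \<Rightarrow> R3 set" where
  "word_closure s w = slabs s 0 w \<union> arcs s (length w)"

text \<open>Quantifying over the contexts \<open>u\<close> and \<open>v\<close> makes the relation a
  congruence for concatenation. The two words may have different lengths; the closure arcs
  adapt.\<close>

definition word_equiv :: "nat \<Rightarrow> letter list \<Rightarrow> letter list \<Rightarrow> bool" where
  "word_equiv s w w' \<longleftrightarrow> (\<forall>u v. isotopic (word_closure s (u @ w @ v)) (word_closure s (u @ w' @ v)))"

lemma word_equiv_refl: "word_equiv s w w"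
  by (simp add: word_equiv_def isotopic_refl)

lemma word_equiv_sym: "word_equiv s w w' \<Longrightarrow> word_equiv s w' w"
  by (simp add: word_equiv_def isotopic_sym)

lemma word_equiv_trans [trans]: "word_equiv s w w' \<Longrightarrow> word_equiv s w' w'' \<Longrightarrow> word_equiv s w w''"
  unfolding word_equiv_def using isotopic_trans by blast

lemma word_equiv_append:
  assumes "word_equiv s a a'" "word_equiv s b b'"
  shows "word_equiv s (a @ b) (a' @ b')"
  unfolding word_equiv_def
proof (intro allI)
  fix u v :: "letter list"
  have "isotopic (word_closure s (u @ a @ b @ v)) (word_closure s (u @ a' @ b @ v))"
    using assms(1) unfolding word_equiv_def by blast
  moreover have "isotopic (word_closure s ((u @ a') @ b @ v)) (word_closure s ((u @ a') @ b' @ v))"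
    using assms(2) unfolding word_equiv_def by blast
  ultimately show "isotopic (word_closure s (u @ (a @ b) @ v)) (word_closure s (u @ (a' @ b') @ v))"
    using isotopic_trans by simp
qed

lemma word_equiv_isotopic: "word_equiv s w w' \<Longrightarrow> isotopic (word_closure s w) (word_closure s w')"
  unfolding word_equiv_def by (metis append.left_neutral append.right_neutral)

lemma slabs_append: "slabs s k (u @ v) = slabs s k u \<union> slabs s (k + length u) v"
  by (induction u arbitrary: k) auto

lemma slab_bounds: "(x, y, z) \<in> slab s k a \<Longrightarrow> real k \<le> y \<and> y \<le> real k + 1"
  by (auto simp: slab_def band_def)

lemma slabs_bounds: "(x, y, z) \<in> slabs s k w \<Longrightarrow> real k \<le> y \<and> y \<le> real k + real (length w)"
proof (induction w arbitrary: k)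
  case (Cons a w)
  then consider "(x, y, z) \<in> slab s k a" | "(x, y, z) \<in> slabs s (Suc k) w" by auto
  then show ?case
  proof cases
    case 2
    then show ?thesis using Cons.IH[of "Suc k"] by simp
  qed (use slab_bounds[of x y z s k a] in simp)
qed simp

lemma slab_shift: "(x, y, z) \<in> slab s (Suc k) a \<longleftrightarrow> (x, y - 1, z) \<in> slab s k a"
  by (auto simp: slab_def band_def algebra_simps)

lemma slabs_shift: "(x, y, z) \<in> slabs s (Suc k) w \<longleftrightarrow> (x, y - 1, z) \<in> slabs s k w"
  by (induction w arbitrary: k) (simp_all add: slab_shift)

definition word_rest :: "nat \<Rightarrow> letter list \<Rightarrow> nat \<Rightarrow> letter list \<Rightarrow> R3 set" where
  "word_rest s u j v = slabs s 0 u \<union> slabs s (length u + j) v \<union> arcs s (length u + j + length v)"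

lemma word_closure_context:
  "word_closure s (u @ w @ v) = slabs s (length u) w \<union> word_rest s u (length w) v"
  by (auto simp: word_closure_def word_rest_def slabs_append add.assoc)

text \<open>At the inner times of the omitted factor only the left-hand sides of the closure arcs
  are present, at x = - (p + 1). This supplies the hypothesis on \<open>K\<close> in
  \<open>band_isotopic_linear\<close>.\<close>

lemma word_rest_left:
  assumes "(x, y, z) \<in> word_rest s u j v" "real (length u) < y" "y < real (length u) + real j"
  shows "x \<le> -1"
  using assms slabs_bounds[of x y z s 0 u] slabs_bounds[of x y z s "length u + j" v]
  by (auto simp: word_rest_def arcs_def mem_closure_arc)

lemma strand_right:
  assumes "0 \<le> t" "t \<le> 1"
  shows "0 \<le> fst (strand a p t)"
proof -
  have "fst (strand a p t) = (1 - t) * real p + t * real (fst a p)"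
    by (simp add: strand_def algebra_simps)
  then show ?thesis using assms by simp
qed

lemma continuous_strand: "continuous_on S (strand a p)"
  unfolding strand_def tent_def by (intro continuous_intros)

lemma tent_pos: "0 < t \<Longrightarrow> t < 1 \<Longrightarrow> 0 < tent t"
  by (simp add: tent_def)

text \<open>The straight-line homotopy changes heights only. Two strings that share their
  x-coordinate at some time are inverted by \<pi> and do so strictly inside the slab; for such a
  pair the hypothesis keeps the sign of the height difference constant throughout the
  interpolation.\<close>

lemma word_equiv_levels:
  assumes "\<pi> permutes {..<s}"
    and "\<And>p q. p < q \<Longrightarrow> q < s \<Longrightarrow> \<pi> q < \<pi> p \<Longrightarrow>
      l p < l q \<and> l' p < l' q \<or> l q < l p \<and> l' q < l' p"
  shows "word_equiv s [(\<pi>, l)] [(\<pi>, l')]"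
  unfolding word_equiv_def
proof (intro allI)
  fix u v :: "letter list"
  let ?k = "real (length u)"
  have "isotopic (band s ?k (?k + 1) (\<lambda>p y. strand (\<pi>, l) p (y - ?k)) \<union> word_rest s u 1 v)
                 (band s ?k (?k + 1) (\<lambda>p y. strand (\<pi>, l') p (y - ?k)) \<union> word_rest s u 1 v)"
  proof (rule band_isotopic_linear)
    show "continuous_on {?k..?k + 1} (\<lambda>y. strand (\<pi>, l) p (y - ?k))" for p
      by (rule continuous_on_compose2[OF continuous_strand[of UNIV]]) (auto intro!: continuous_intros)
    show "continuous_on {?k..?k + 1} (\<lambda>y. strand (\<pi>, l') p (y - ?k))" for p
      by (rule continuous_on_compose2[OF continuous_strand[of UNIV]]) (auto intro!: continuous_intros)
    fix p q t y
    assume pq: "p < s" "q < s" "p < q" and y: "?k \<le> y" "y \<le> ?k + 1" and t: "0 \<le> t" "t \<le> (1 :: real)"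
    define r where "r = y - ?k"
    have r: "0 \<le> r" "r \<le> 1" using y by (auto simp: r_def)
    show "(1 - t) *\<^sub>R strand (\<pi>, l) p (y - ?k) + t *\<^sub>R strand (\<pi>, l') p (y - ?k) \<noteq>
          (1 - t) *\<^sub>R strand (\<pi>, l) q (y - ?k) + t *\<^sub>R strand (\<pi>, l') q (y - ?k)"
    proof
      assume "(1 - t) *\<^sub>R strand (\<pi>, l) p (y - ?k) + t *\<^sub>R strand (\<pi>, l') p (y - ?k) =
          (1 - t) *\<^sub>R strand (\<pi>, l) q (y - ?k) + t *\<^sub>R strand (\<pi>, l') q (y - ?k)"
      then have e1: "(1 - t) * (real p + r * (real (\<pi> p) - real p)) + t * (real p + r * (real (\<pi> p) - real p)) =
           (1 - t) * (real q + r * (real (\<pi> q) - real q)) + t * (real q + r * (real (\<pi> q) - real q))"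
        and e2: "(1 - t) * (- l p * tent r) + t * (- l' p * tent r) = (1 - t) * (- l q * tent r) + t * (- l' q * tent r)"
        by (auto simp: strand_def r_def)
      from e1 have x: "(1 - r) * (real q - real p) + r * (real (\<pi> q) - real (\<pi> p)) = 0"
        by (simp add: algebra_simps)
      have "\<pi> p \<noteq> \<pi> q" using permutes_inj[OF assms(1)] pq by (auto dest: injD)
      moreover have "\<not> \<pi> p < \<pi> q"
      proof
        assume "\<pi> p < \<pi> q"
        then have "(1 - r) * (real q - real p) + r * (real (\<pi> q) - real (\<pi> p)) > 0"
          using pq r by (cases "r = 1") (auto intro!: add_pos_nonneg mult_pos_pos mult_nonneg_nonneg)
        with x show False by simp
      qed
      ultimately have inv: "\<pi> q < \<pi> p" by simp
      have "r \<noteq> 0" "r \<noteq> 1" using x pq inv by auto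
      then have "tent r > 0" using r by (intro tent_pos) auto
      from e2 have "tent r * ((1 - t) * (l p - l q) + t * (l' p - l' q)) = 0" by (simp add: algebra_simps)
      then have z: "(1 - t) * (l p - l q) + t * (l' p - l' q) = 0" using \<open>tent r > 0\<close> by simp
      from assms(2)[OF pq(3,2) inv] show False
      proof
        assume "l p < l q \<and> l' p < l' q"
        then have "(1 - t) * (l q - l p) + t * (l' q - l' p) > 0"
          using t by (cases "t = 1") (auto intro!: add_pos_nonneg mult_pos_pos mult_nonneg_nonneg)
        with z show False by (simp add: algebra_simps)
      next
        assume "l q < l p \<and> l' q < l' p"
        then have "(1 - t) * (l p - l q) + t * (l' p - l' q) > 0"
          using t by (cases "t = 1") (auto intro!: add_pos_nonneg mult_pos_pos mult_nonneg_nonneg)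
        with z show False by simp
      qed
    qed
  next
    fix p y assume "?k \<le> y" "y \<le> ?k + 1"
    then show "0 \<le> fst (strand (\<pi>, l) p (y - ?k))" "0 \<le> fst (strand (\<pi>, l') p (y - ?k))"
      by (auto intro!: strand_right)
  next
    fix x y z assume "(x, y, z) \<in> word_rest s u 1 v" "?k < y" "y < ?k + 1"
    then show "x \<le> -1" using word_rest_left[of x y z s u 1 v] by simp
  qed (auto simp: strand_def tent_def)
  then show "isotopic (word_closure s (u @ [(\<pi>, l)] @ v)) (word_closure s (u @ [(\<pi>, l')] @ v))"
    using word_closure_context[of s u "[(\<pi>, l)]" v] word_closure_context[of s u "[(\<pi>, l')]" v]
    by (simp add: slab_def)
qed


text \<open>Identity up to k, compression of the interval from k to k + 2 onto the one from k to k +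
  1, and translation by -1 beyond: two slabs become one.\<close>

definition squeeze :: "real \<Rightarrow> real \<Rightarrow> real" where
  "squeeze k y = y - min 1 (max 0 ((y - k) / 2))"

definition unsqueeze :: "real \<Rightarrow> real \<Rightarrow> real" where
  "unsqueeze k y = y + min 1 (max 0 (y - k))"

lemma squeeze_unsqueeze: "squeeze k (unsqueeze k y) = y" "unsqueeze k (squeeze k y) = y"
  by (auto simp: squeeze_def unsqueeze_def min_def max_def field_simps)

lemma isotopic_squeeze: "isotopic A {(x, y, z). (x, unsqueeze k y, z) \<in> A}"
proof -
  have "isotopic A ((\<lambda>(x, y, z). (x, y + (\<lambda>(x :: real, y, z :: real). - min 1 (max 0 ((y - k) / 2))) (x, y, z), z)) ` A)"
  proof (rule isotopic_fibre_monotone[where M = 1])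
    have "continuous_on UNIV (\<lambda>P :: R3. - min 1 (max 0 ((fst (snd P) - k) / 2)))"
      by (intro continuous_intros) auto
    then show "continuous_on UNIV (\<lambda>(x :: real, y, z :: real). - min 1 (max 0 ((y - k) / 2)) :: real)"
      by (simp add: case_prod_beta)
  qed (auto simp: min_def max_def field_simps)
  also have "(\<lambda>(x, y, z). (x, y + (\<lambda>(x :: real, y, z :: real). - min 1 (max 0 ((y - k) / 2))) (x, y, z), z)) =
      (\<lambda>(x, y, z). (x, squeeze k y, z))"
    by (auto simp: squeeze_def)
  also have "(\<lambda>(x, y, z). (x, squeeze k y, z)) ` A = {(x, y, z). (x, unsqueeze k y, z) \<in> A}"
  proof (intro set_eqI iffI)
    fix P assume "P \<in> {(x, y, z). (x, unsqueeze k y, z) \<in> A}"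
    then obtain x y z where "P = (x, y, z)" "(x, unsqueeze k y, z) \<in> A" by blast
    then show "P \<in> (\<lambda>(x, y, z). (x, squeeze k y, z)) ` A"
      by (intro image_eqI[of _ _ "(x, unsqueeze k y, z)"]) (auto simp: squeeze_unsqueeze)
  qed (auto simp: squeeze_unsqueeze)
  finally show ?thesis .
qed

text \<open>Below the factor nothing moves and above it everything moves by 1. In between there are
  only vertical sides of arcs, which are insensitive to a change of scale in y.\<close>

lemma unsqueeze_word_rest:
  "(x, unsqueeze (real (length u)) y, z) \<in> word_rest s u 2 v \<longleftrightarrow> (x, y, z) \<in> word_rest s u 1 v"
proof -
  let ?k = "real (length u)"
  have 1: "(x, unsqueeze ?k y, z) \<in> slabs s 0 u \<longleftrightarrow> (x, y, z) \<in> slabs s 0 u"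
  proof (cases "y \<le> ?k")
    case True
    then show ?thesis by (simp add: unsqueeze_def)
  next
    case False
    then show ?thesis using slabs_bounds[of x _ z s 0 u] by (fastforce simp: unsqueeze_def)
  qed
  have 2: "(x, unsqueeze ?k y, z) \<in> slabs s (length u + 2) v \<longleftrightarrow> (x, y, z) \<in> slabs s (length u + 1) v"
  proof (cases "y \<ge> ?k + 1")
    case True
    then show ?thesis using slabs_shift[of x "y + 1" z s "Suc (length u)" v]
      by (simp add: unsqueeze_def)
  next
    case False
    then have "unsqueeze ?k y < ?k + 2" by (auto simp: unsqueeze_def min_def max_def)
    then show ?thesis using False slabs_bounds[of x _ z s "length u + 2" v]
        slabs_bounds[of x _ z s "length u + 1" v] by fastforce
  qed
  have 3: "(x, unsqueeze ?k y, z) \<in> closure_arc (length u + 2 + length v) p \<longleftrightarrow>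
      (x, y, z) \<in> closure_arc (length u + 1 + length v) p" for p
  proof -
    consider "y \<le> ?k" | "?k < y" "y \<le> ?k + 1" | "?k + 1 < y" by linarith
    then show ?thesis
    proof cases
      case 1
      then have "unsqueeze ?k y = y" by (simp add: unsqueeze_def)
      then show ?thesis using 1 by (auto simp: mem_closure_arc)
    next
      case 2
      then have "unsqueeze ?k y = y + (y - ?k)" by (simp add: unsqueeze_def)
      then show ?thesis using 2 by (auto simp: mem_closure_arc)
    next
      case 3
      then have "unsqueeze ?k y = y + 1" by (simp add: unsqueeze_def)
      then show ?thesis using 3 by (auto simp: mem_closure_arc)
    qed
  qed
  show ?thesis unfolding word_rest_def arcs_def using 1 2 3 by auto
qed

text \<open>Between the two letters all strings return to height 0. The hypothesis on l' says that
  each string dives to its old depth again, so instead it may stay down and go straight to its final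
  position, over two slabs. In the straight-line homotopy from the two-letter motion
  \<open>f\<close> to this motion \<open>g\<close>, distinct depths exclude collisions wherever the
  interpolated profile is positive. Afterwards the two slabs are squeezed into one.\<close>

lemma word_equiv_comp:
  assumes \<pi>: "\<pi> permutes {..<s}" and \<rho>: "\<rho> permutes {..<s}"
    and inj: "inj_on l {..<s}" and l': "\<And>p. p < s \<Longrightarrow> l' (\<pi> p) = l p"
  shows "word_equiv s [(\<pi>, l), (\<rho>, l')] [(\<rho> \<circ> \<pi>, l)]"
  unfolding word_equiv_def
proof (intro allI)
  fix u v :: "letter list"
  let ?k = "real (length u)"
  \<comment> \<open>The strings of the second letter are indexed by their starting positions in the
    first, so that one motion covers both slabs.\<close>
  define f where "f p r = (if r \<le> 1 then strand (\<pi>, l) p r else strand (\<rho>, \<lambda>_. l p) (\<pi> p) (r - 1))" for p r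
  define g where "g p r = strand (\<rho> \<circ> \<pi>, l) p (r / 2)" for p r
  have "slabs s (length u) [(\<pi>, l), (\<rho>, l')] = band s ?k (?k + 2) (\<lambda>p y. f p (y - ?k))"
  proof (intro set_eqI iffI)
    fix P assume P: "P \<in> slabs s (length u) [(\<pi>, l), (\<rho>, l')]"
    obtain x y z where xyz: "P = (x, y, z)" by (rule prod_cases3)
    from P consider "P \<in> slab s (length u) (\<pi>, l)" | "P \<in> slab s (Suc (length u)) (\<rho>, l')" by auto
    then show "P \<in> band s ?k (?k + 2) (\<lambda>p y. f p (y - ?k))"
    proof cases
      case 1
      then show ?thesis by (auto simp: xyz slab_def band_def f_def)
    next
      case 2
      then obtain q where q: "q < s" "?k + 1 \<le> y" "y \<le> ?k + 2" "strand (\<rho>, l') q (y - ?k - 1) = (x, z)"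
        by (auto simp: xyz slab_def band_def algebra_simps)
      obtain p where p: "p < s" "\<pi> p = q"
        using q(1) permutes_image[OF \<pi>] by (metis imageE lessThan_iff)
      have "f p (y - ?k) = (x, z)"
      proof (cases "y = ?k + 1")
        case True
        then show ?thesis using q p by (simp add: f_def strand_def tent_def)
      next
        case False
        then show ?thesis using q p l'[OF p(1)] by (simp add: f_def strand_def)
      qed
      then show ?thesis using p q by (auto simp: xyz band_def)
    qed
  next
    fix P assume "P \<in> band s ?k (?k + 2) (\<lambda>p y. f p (y - ?k))"
    then obtain x y z p where P: "P = (x, y, z)" "?k \<le> y" "y \<le> ?k + 2" "p < s" "f p (y - ?k) = (x, z)"
      by (auto simp: band_def)
    show "P \<in> slabs s (length u) [(\<pi>, l), (\<rho>, l')]"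
    proof (cases "y \<le> ?k + 1")
      case True
      then have "P \<in> slab s (length u) (\<pi>, l)" using P by (auto simp: slab_def band_def f_def)
      then show ?thesis by simp
    next
      case False
      have "\<pi> p < s" using P(4) \<pi> permutes_in_image by fastforce
      then have "P \<in> slab s (Suc (length u)) (\<rho>, l')"
        using P False l'[OF P(4)] unfolding slab_def band_def f_def
        by (auto simp: strand_def algebra_simps intro!: exI[of _ "\<pi> p"])
      then show ?thesis by simp
    qed
  qed
  moreover have "isotopic (band s ?k (?k + 2) (\<lambda>p y. f p (y - ?k)) \<union> word_rest s u 2 v)
                 (band s ?k (?k + 2) (\<lambda>p y. g p (y - ?k)) \<union> word_rest s u 2 v)"
  proof (rule band_isotopic_linear)
    fix p assume p: "p < s"
    have "continuous_on ({..1} \<union> {1..}) (\<lambda>r. if r \<le> 1 then strand (\<pi>, l) p r else strand (\<rho>, \<lambda>_. l p) (\<pi> p) (r - 1))"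
    proof (rule continuous_on_If)
      show "continuous_on {1..} (\<lambda>r. strand (\<rho>, \<lambda>_. l p) (\<pi> p) (r - 1))"
        by (rule continuous_on_compose2[OF continuous_strand[of UNIV]]) (auto intro!: continuous_intros)
    qed (auto simp: continuous_strand, auto simp: strand_def tent_def)
    moreover have "{..1} \<union> {1..} = (UNIV :: real set)" by auto
    ultimately have cf: "continuous_on UNIV (f p)"
      unfolding f_def[abs_def] by simp
    show "continuous_on {?k..?k + 2} (\<lambda>y. f p (y - ?k))"
      by (rule continuous_on_compose2[OF cf]) (auto intro!: continuous_intros)
    show "continuous_on {?k..?k + 2} (\<lambda>y. g p (y - ?k))"
      unfolding g_def
      by (rule continuous_on_compose2[OF continuous_strand[of UNIV]]) (auto intro!: continuous_intros)
    show "f p (?k - ?k) = g p (?k - ?k)" "f p (?k + 2 - ?k) = g p (?k + 2 - ?k)"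
      by (simp_all add: f_def g_def strand_def tent_def)
    fix y assume y: "?k \<le> y" "y \<le> ?k + 2"
    show "0 \<le> fst (f p (y - ?k))" "0 \<le> fst (g p (y - ?k))"
      using y by (auto simp: f_def g_def intro!: strand_right)
  next
    fix p q t y
    assume pq: "p < s" "q < s" "p < q" and y: "?k \<le> y" "y \<le> ?k + 2" and t: "0 \<le> t" "t \<le> (1 :: real)"
    define r where "r = y - ?k"
    have r: "0 \<le> r" "r \<le> 2" using y by (auto simp: r_def)
    \<comment> \<open>All strings of \<open>f\<close> have the common height profile T, scaled by
      their depth. Two strings of different depth can therefore collide only where the interpolated
      profile vanishes.\<close>
    define T where "T = (if r \<le> 1 then tent r else tent (r - 1))"
    have zf: "snd (f i r) = - l i * T" "snd (g i r) = - l i * tent (r / 2)" for i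
      by (simp_all add: f_def g_def T_def strand_def)
    have ne: "l p \<noteq> l q" using inj pq by (auto dest: inj_onD)
    have neq: "\<pi> p \<noteq> \<pi> q" "\<rho> (\<pi> p) \<noteq> \<rho> (\<pi> q)"
      using permutes_inj[OF \<pi>] permutes_inj[OF \<rho>] pq by (auto dest: injD)
    show "(1 - t) *\<^sub>R f p (y - ?k) + t *\<^sub>R g p (y - ?k) \<noteq> (1 - t) *\<^sub>R f q (y - ?k) + t *\<^sub>R g q (y - ?k)"
    proof
      assume eq: "(1 - t) *\<^sub>R f p (y - ?k) + t *\<^sub>R g p (y - ?k) = (1 - t) *\<^sub>R f q (y - ?k) + t *\<^sub>R g q (y - ?k)"
      have "(1 - t) * snd (f p r) + t * snd (g p r) = (1 - t) * snd (f q r) + t * snd (g q r)"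
        using arg_cong[OF eq, of snd] by (simp add: r_def)
      then have "(l p - l q) * ((1 - t) * T + t * tent (r / 2)) = 0"
        unfolding zf by (simp add: algebra_simps)
      then have z: "(1 - t) * T + t * tent (r / 2) = 0" using ne by simp
      have x: "(1 - t) * fst (f p r) + t * fst (g p r) = (1 - t) * fst (f q r) + t * fst (g q r)"
        using arg_cong[OF eq, of fst] by (simp add: r_def)
      have T: "T \<ge> 0" using r by (auto simp: T_def tent_def)
      consider "r = 0" | "r = 2" | "r = 1" | "0 < r" "r < 1" | "1 < r" "r < 2" using r by linarith
      then show False
      proof cases
        case 1
        then show False using x pq by (simp add: f_def g_def strand_def algebra_simps)
      next
        case 2
        then show False using x neq by (simp add: f_def g_def strand_def algebra_simps)
      next
        case 3
        \<comment> \<open>In the middle the profile of \<open>g\<close> is 1, so it vanishes only at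
          the start of the homotopy, where the strings are separated by their x-coordinates.\<close>
        then have "t = 0" using z by (simp add: T_def tent_def)
        then show False using 3 x neq by (simp add: f_def strand_def)
      next
        case 4
        then have "T > 0" "tent (r / 2) > 0" by (auto simp: T_def intro!: tent_pos)
        then have "(1 - t) * T + t * tent (r / 2) > 0"
          using t by (cases "t = 1") (auto intro!: add_pos_nonneg mult_pos_pos mult_nonneg_nonneg)
        then show False using z by simp
      next
        case 5
        then have "T > 0" "tent (r / 2) > 0" by (auto simp: T_def intro!: tent_pos)
        then have "(1 - t) * T + t * tent (r / 2) > 0"
          using t by (cases "t = 1") (auto intro!: add_pos_nonneg mult_pos_pos mult_nonneg_nonneg)
        then show False using z by simp
      qed
    qed
  next
    fix x y z assume "(x, y, z) \<in> word_rest s u 2 v" "?k < y" "y < ?k + 2"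
    then show "x \<le> -1" using word_rest_left[of x y z s u 2 v] by simp
  qed simp
  moreover have "isotopic (band s ?k (?k + 2) (\<lambda>p y. g p (y - ?k)) \<union> word_rest s u 2 v)
      (slab s (length u) (\<rho> \<circ> \<pi>, l) \<union> word_rest s u 1 v)"
  proof -
    have "(x, unsqueeze ?k y, z) \<in> band s ?k (?k + 2) (\<lambda>p y. g p (y - ?k)) \<longleftrightarrow>
       (x, y, z) \<in> slab s (length u) (\<rho> \<circ> \<pi>, l)" for x y z
    proof (cases "?k \<le> y \<and> y \<le> ?k + 1")
      case True
      then have us: "(unsqueeze ?k y - ?k) / 2 = y - ?k" "?k \<le> unsqueeze ?k y" "unsqueeze ?k y \<le> ?k + 2"
        by (auto simp: unsqueeze_def)
      show ?thesis
        unfolding band_def slab_def g_def mem_Collect_eq prod.case us(1) using True us(2,3) by blast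
    next
      case False
      then have "unsqueeze ?k y < ?k \<or> ?k + 2 < unsqueeze ?k y"
        by (auto simp: unsqueeze_def min_def max_def)
      then show ?thesis using False by (auto simp: band_def slab_def)
    qed
    then have "{(x, y, z). (x, unsqueeze ?k y, z) \<in> band s ?k (?k + 2) (\<lambda>p y. g p (y - ?k)) \<union> word_rest s u 2 v}
       = slab s (length u) (\<rho> \<circ> \<pi>, l) \<union> word_rest s u 1 v"
      using unsqueeze_word_rest by auto
    then show ?thesis using isotopic_squeeze by metis
  qed
  ultimately show "isotopic (word_closure s (u @ [(\<pi>, l), (\<rho>, l')] @ v)) (word_closure s (u @ [(\<rho> \<circ> \<pi>, l)] @ v))"
    using isotopic_trans word_closure_context[of s u "[(\<pi>, l), (\<rho>, l')]" v]
      word_closure_context[of s u "[(\<rho> \<circ> \<pi>, l)]" v]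
    by (simp add: numeral_2_eq_2)
qed

section \<open>Crossings as letters\<close>

definition crossing_letter :: "nat \<Rightarrow> ncrossing \<Rightarrow> letter" where
  "crossing_letter n cr = (window_rev (fst cr) n,
     \<lambda>p. if fst cr \<le> p \<and> p < fst cr + n then real (snd cr (p - fst cr)) else 0)"

text \<open>The centre of the crossing is the midpoint between p and its mirror image 2j + n - 1 -
  p. The two segments of a strand thus have a straight projection, and the bend in height is that of
  \<open>tent\<close>.\<close>

lemma crossing_set_eq_slab: "crossing_set s n k (j, lev) = slab s k (crossing_letter n (j, lev))"
proof -
  let ?a = "crossing_letter n (j, lev)"
  have eq: "(if j \<le> p \<and> p < j + n then
         (let c = (real j + (real n - 1) / 2, real k + 1/2, - real (lev (p - j)))
          in closed_segment (real p, real k, 0) c \<union>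
             closed_segment c (real (2 * j + n - 1 - p), real k + 1, 0))
       else closed_segment (real p, real k, 0) (real p, real k + 1, 0)) =
     {(x, y, z). real k \<le> y \<and> y \<le> real k + 1 \<and> strand ?a p (y - real k) = (x, z)}" for p
  proof (cases "j \<le> p \<and> p < j + n")
    case True
    then have \<pi>: "real (window_rev j n p) = 2 * real j + real n - 1 - real p"
      by (simp add: window_rev_def of_nat_diff)
    have w: "real (2 * j + n - 1 - p) = 2 * real j + real n - 1 - real p"
      using True by (simp add: of_nat_diff)
    define l where "l = real (lev (p - j))"
    define c where "c = real j + (real n - 1) / 2"
    have st: "strand ?a p r = (real p + r * (2 * (c - real p)), - l * tent r)" for r
      using True by (simp add: strand_def crossing_letter_def \<pi> l_def c_def)
    have half: "closed_segment (real p, real k, 0) (c, real k + 1 / 2, - l) =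
        {(x, y, z). real k \<le> y \<and> y \<le> real k + 1 / 2 \<and> strand ?a p (y - real k) = (x, z)}"
      "closed_segment (c, real k + 1 / 2, - l) (2 * real j + real n - 1 - real p, real k + 1, 0) =
        {(x, y, z). real k + 1 / 2 \<le> y \<and> y \<le> real k + 1 \<and> strand ?a p (y - real k) = (x, z)}"
    proof -
      have "strand ?a p (y - real k) = (real p + (y - real k) / (real k + 1 / 2 - real k) * (c - real p),
         0 + (y - real k) / (real k + 1 / 2 - real k) * (- l - 0))"
        if "y \<le> real k + 1 / 2" for y
        using that by (simp add: st tent_def algebra_simps)
      then show "closed_segment (real p, real k, 0) (c, real k + 1 / 2, - l) =
        {(x, y, z). real k \<le> y \<and> y \<le> real k + 1 / 2 \<and> strand ?a p (y - real k) = (x, z)}"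
        by (subst closed_segment_graph_y) (simp, force)
      have "strand ?a p (y - real k) =
         (c + (y - (real k + 1 / 2)) / (real k + 1 - (real k + 1 / 2)) * (2 * real j + real n - 1 - real p - c),
         - l + (y - (real k + 1 / 2)) / (real k + 1 - (real k + 1 / 2)) * (0 - - l))"
        if "real k + 1 / 2 \<le> y" for y
        using that by (simp add: st tent_def c_def field_simps)
      then show "closed_segment (c, real k + 1 / 2, - l) (2 * real j + real n - 1 - real p, real k + 1, 0) =
        {(x, y, z). real k + 1 / 2 \<le> y \<and> y \<le> real k + 1 \<and> strand ?a p (y - real k) = (x, z)}"
        by (subst closed_segment_graph_y) (simp, force)
    qed
    show ?thesis
      unfolding if_P[OF True] Let_def w l_def[symmetric] c_def[symmetric] half by force
  next
    case False
    then show ?thesis unfolding if_not_P[OF False]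
      by (subst closed_segment_graph_y) (auto simp: strand_def crossing_letter_def window_rev_def)
  qed
  show ?thesis
    unfolding crossing_set_def slab_def band_def prod.case eq by auto
qed

lemma braid_closure_eq_word_closure:
  "braid_closure s n bs = word_closure s (map (crossing_letter n) bs)"
proof -
  have "slabs s j w = (\<Union>k<length w. slab s (j + k) (w ! k))" for j w
  proof (induction w arbitrary: j)
    case (Cons a w)
    have "{..<length (a # w)} = insert 0 (Suc ` {..<length w})"
      by (simp add: lessThan_Suc_eq_insert_0)
    then show ?case by (simp add: Cons)
  qed simp
  moreover have "crossing_set s n k cr = slab s k (crossing_letter n cr)" for k cr
    using crossing_set_eq_slab by (cases cr) simp
  ultimately show ?thesis
    unfolding braid_closure_def word_closure_def arcs_def by simp
qed

section \<open>Triangle moves\<close>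

text \<open>The base of the triangle with vertices (-1, 0, 0), (1, 0, 0) and (0, 1, 0) is pushed in
  the y-direction across the triangle onto the other two sides. The push at x is the height
  \<open>h x\<close> of the triangle times a cutoff \<psi> whose support is so thin that it misses
  \<open>K\<close>.\<close>

lemma isotopic_standard_triangle:
  assumes K: "closed K" "\<And>x y. (x, y, 0) \<in> K \<Longrightarrow> 0 \<le> y \<Longrightarrow> y \<le> 1 - \<bar>x\<bar> \<Longrightarrow> x = -1 \<or> x = (1 :: real)"
  shows "isotopic (K \<union> (\<lambda>x. (x, 0, 0)) ` {-1..1}) (K \<union> (\<lambda>x. (x, 1 - \<bar>x\<bar>, 0)) ` {-1..1})"
proof -
  \<comment> \<open>Adding the two vertices, where \<open>K\<close> may touch the triangle, makes
    the set nonempty, so that \<open>infdist\<close> measures a genuine distance.\<close>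
  define K2 where "K2 = insert (-1, 0, 0) (insert (1, 0, 0) K)"
  have K2: "closed K2" "K2 \<noteq> {}" using K(1) by (auto simp: K2_def intro!: closed_insert)
  define h where "h x = max 0 (1 - \<bar>x\<bar>)" for x :: real
  define \<phi> where "\<phi> x r = infdist (x, r * h x, 0) K2" for x r
  \<comment> \<open>Half the distance from \<open>K2\<close> to the fibre of the triangle over x,
    which r parametrises. It is 1-Lipschitz, being half an infimum of 2-Lipschitz functions.\<close>
  define \<delta> where "\<delta> x = (INF r\<in>{0..1}. \<phi> x r) / 2" for x
  have bdd: "bdd_below (\<phi> x ` {0..1})" for x
    by (rule bdd_belowI[of _ 0]) (auto simp: \<phi>_def infdist_nonneg)
  have \<delta>_le: "2 * \<delta> x \<le> \<phi> x r" if "0 \<le> r" "r \<le> 1" for x r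
    using cINF_lower[OF bdd, of r x] that by (simp add: \<delta>_def)
  have \<phi>_lip: "\<phi> x r \<le> \<phi> x' r + 2 * \<bar>x - x'\<bar>" if "0 \<le> r" "r \<le> 1" for x x' r
  proof -
    have "dist (x, r * h x, 0 :: real) (x', r * h x', 0) \<le> \<bar>x - x'\<bar> + \<bar>r * h x - r * h x'\<bar>"
      unfolding dist_prod_def by (simp add: dist_real_def sqrt_sum_squares_le_sum_abs)
    also have "\<bar>r * h x - r * h x'\<bar> = r * \<bar>h x - h x'\<bar>"
      using that by (simp add: abs_mult flip: right_diff_distrib)
    also have "\<dots> \<le> 1 * \<bar>x - x'\<bar>" using that by (intro mult_mono) (auto simp: h_def)
    finally show ?thesis
      using infdist_triangle[of "(x, r * h x, 0)" K2 "(x', r * h x', 0)"] by (simp add: \<phi>_def)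
  qed
  have \<delta>_lip: "\<delta> x' - \<bar>x - x'\<bar> \<le> \<delta> x" for x x'
  proof -
    have "2 * \<delta> x' - 2 * \<bar>x - x'\<bar> \<le> (INF r\<in>{0..1}. \<phi> x r)"
    proof (rule cINF_greatest)
      fix r :: real assume "r \<in> {0..1}"
      then show "2 * \<delta> x' - 2 * \<bar>x - x'\<bar> \<le> \<phi> x r"
        using \<delta>_le[of r x'] \<phi>_lip[of r x' x] by (simp add: abs_minus_commute)
    qed simp
    then show ?thesis by (simp add: \<delta>_def)
  qed
  have "1-lipschitz_on UNIV \<delta>"
  proof (rule lipschitz_onI)
    fix x y show "dist (\<delta> x) (\<delta> y) \<le> 1 * dist x y"
      using \<delta>_lip[of x y] \<delta>_lip[of y x] by (simp add: dist_real_def abs_le_iff abs_minus_commute)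
  qed simp
  then have \<delta>_cont: "continuous_on UNIV \<delta>" by (rule lipschitz_on_continuous_on)
  have h_cont: "continuous_on UNIV h" unfolding h_def by (intro continuous_intros)
  have h_pos: "0 < h x" if "\<bar>x\<bar> < 1" for x using that by (simp add: h_def)
  have h_0: "h x = 0" if "\<not> \<bar>x\<bar> < 1" for x using that by (simp add: h_def)
  have h_ge: "0 \<le> h x" for x by (simp add: h_def)
  have \<delta>_pos: "0 < \<delta> x" if "\<bar>x\<bar> < 1" for x
  proof -
    have "continuous_on {0..1} (\<phi> x)"
      unfolding \<phi>_def by (intro continuous_intros)
    then obtain r0 where r0: "0 \<le> r0" "r0 \<le> 1" "\<And>r. 0 \<le> r \<Longrightarrow> r \<le> 1 \<Longrightarrow> \<phi> x r0 \<le> \<phi> x r"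
      using continuous_attains_inf[of "{0..1}" "\<phi> x"] by auto
    have "0 \<le> r0 * h x" "r0 * h x \<le> 1 * h x"
      using r0 h_ge[of x] mult_right_mono[of r0 1 "h x"] by auto
    then have "(x, r0 * h x, 0) \<notin> K2"
      using K(2)[of x "r0 * h x"] that by (auto simp: K2_def h_def)
    then have "0 < \<phi> x r0"
      unfolding \<phi>_def using K2 infdist_pos_not_in_closed by blast
    also have "\<phi> x r0 \<le> (INF r\<in>{0..1}. \<phi> x r)"
      using r0 by (intro cINF_greatest) auto
    finally show ?thesis by (simp add: \<delta>_def)
  qed
  \<comment> \<open>The cutoff is 1 on the base and 0 unless -\<delta> < y < h + \<delta> and |z| <
    \<delta>. Its descending slope 1 / (h + \<delta>) is smaller than 1 / h, so the push preserves
    the order on each line.\<close>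
  define \<psi> where "\<psi> x y z = max 0 (min (1 + y / \<delta> x) (1 - y / (h x + \<delta> x)) - \<bar>z\<bar> / \<delta> x)" for x y z
  define e :: "R3 \<Rightarrow> real" where "e P = h (fst P) * \<psi> (fst P) (fst (snd P)) (snd (snd P))" for P
  have \<psi>_bd: "0 \<le> \<psi> x y z \<and> \<psi> x y z \<le> 1" if "\<bar>x\<bar> < 1" for x y z
  proof -
    have "min (1 + y / \<delta> x) (1 - y / (h x + \<delta> x)) \<le> 1"
      using \<delta>_pos[OF that] h_ge[of x] by (cases "y \<le> 0") (auto simp: min_le_iff_disj divide_nonpos_pos)
    moreover have "0 \<le> \<bar>z\<bar> / \<delta> x" using \<delta>_pos[OF that] by simp
    ultimately show ?thesis unfolding \<psi>_def by linarith
  qed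
  have e_bd: "\<bar>e P\<bar> \<le> h (fst P)" for P
  proof (cases "\<bar>fst P\<bar> < 1")
    case True
    have "h (fst P) * \<psi> (fst P) (fst (snd P)) (snd (snd P)) \<le> h (fst P) * 1"
      by (rule mult_left_mono) (use \<psi>_bd[OF True] h_ge in auto)
    moreover have "0 \<le> h (fst P) * \<psi> (fst P) (fst (snd P)) (snd (snd P))"
      by (rule mult_nonneg_nonneg) (use \<psi>_bd[OF True] h_ge in auto)
    ultimately show ?thesis by (simp add: e_def)
  qed (simp add: e_def h_0)
  have e_cont: "continuous_on UNIV e"
  proof (rule continuous_at_imp_continuous_on, rule ballI)
    fix P :: R3
    show "isCont e P"
    proof (cases "\<bar>fst P\<bar> < 1")
      case True
      have o: "open {Q :: R3. \<bar>fst Q\<bar> < 1}"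
        by (intro open_Collect_less continuous_intros)
      have c: "continuous_on {Q. \<bar>fst Q\<bar> < 1} e"
        unfolding e_def \<psi>_def
        by (intro continuous_intros continuous_on_compose2[OF \<delta>_cont] continuous_on_compose2[OF h_cont])
          (use \<delta>_pos h_ge in \<open>auto simp: add_nonneg_eq_0_iff less_imp_le\<close>, fastforce+)
      show ?thesis by (rule continuous_on_interior[OF c]) (simp add: interior_open[OF o] True)
    next
      case False
      \<comment> \<open>The widths \<delta> may shrink to 0 at the vertices, but the displacement is
        bounded by \<open>h\<close>, which tends to 0 there.\<close>
      then have "h (fst P) = 0" by (rule h_0)
      have "isCont (\<lambda>Q :: R3. h (fst Q)) P"
      proof (rule continuous_on_interior)
        show "continuous_on UNIV (\<lambda>Q :: R3. h (fst Q))"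
          by (rule continuous_on_compose2[OF h_cont]) (auto intro!: continuous_intros)
      qed simp
      then have "(\<lambda>Q :: R3. h (fst Q)) \<midarrow>P\<rightarrow> 0"
        using \<open>h (fst P) = 0\<close> by (simp add: isCont_def)
      then have "e \<midarrow>P\<rightarrow> 0"
        by (rule Lim_null_comparison[rotated]) (simp add: e_bd)
      moreover have "e P = 0" using \<open>h (fst P) = 0\<close> by (simp add: e_def)
      ultimately show ?thesis by (simp add: isCont_def)
    qed
  qed
  have iso: "isotopic A ((\<lambda>(x, y, z). (x, y + e (x, y, z), z)) ` A)" for A
  proof (rule isotopic_fibre_monotone[OF e_cont])
    show "\<bar>e P\<bar> \<le> 1" for P using e_bd[of P] by (simp add: h_def split: if_splits)
    fix x y y' z :: real assume y: "y < y'"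
    show "y + e (x, y, z) < y' + e (x, y', z)"
    proof (cases "\<bar>x\<bar> < 1")
      case True
      define D where "D = (y' - y) / (h x + \<delta> x)"
      have pos: "0 < h x" "0 < \<delta> x" using h_pos \<delta>_pos True by auto
      then have "0 \<le> D" using y by (simp add: D_def)
      have "1 + y / \<delta> x \<le> 1 + y' / \<delta> x" using y pos by (simp add: divide_right_mono)
      moreover have "1 - y' / (h x + \<delta> x) = 1 - y / (h x + \<delta> x) - D"
        by (simp add: D_def diff_divide_distrib)
      ultimately have "\<psi> x y z - D \<le> \<psi> x y' z" using \<open>0 \<le> D\<close> unfolding \<psi>_def by linarith
      then have "h x * (\<psi> x y z - D) \<le> h x * \<psi> x y' z" using pos by (intro mult_left_mono) auto
      \<comment> \<open>The loss of \<psi> is at most D, and h / (h + \<delta>) < 1.\<close>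
      moreover have "h x * D < y' - y"
        using y pos by (simp add: D_def pos_divide_less_eq mult.commute mult_strict_left_mono)
      ultimately show ?thesis by (simp add: e_def algebra_simps)
    qed (use y in \<open>simp add: e_def h_0\<close>)
  qed
  have img: "(\<lambda>(x, y, z). (x, y + e (x, y, z), z)) ` (K \<union> (\<lambda>x. (x, 0, 0)) ` {-1..1})
      = K \<union> (\<lambda>x. (x, 1 - \<bar>x\<bar>, 0)) ` {-1..1}"
  proof -
    have eK: "e (x, y, z) = 0" if "(x, y, z) \<in> K" for x y z
    proof (rule ccontr)
      assume ne: "e (x, y, z) \<noteq> 0"
      then have x: "\<bar>x\<bar> < 1" using h_0[of x] by (auto simp: e_def)
      have pos: "0 < h x" "0 < \<delta> x" using h_pos \<delta>_pos x by auto
      have "\<psi> x y z \<noteq> 0" using ne by (auto simp: e_def)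
      then have g: "0 < min (1 + y / \<delta> x) (1 - y / (h x + \<delta> x)) - \<bar>z\<bar> / \<delta> x"
        unfolding \<psi>_def by linarith
      have m1: "min (1 + y / \<delta> x) (1 - y / (h x + \<delta> x)) \<le> 1"
        using pos by (cases "y \<le> 0") (auto simp: min_le_iff_disj divide_nonpos_pos)
      have "\<bar>z\<bar> / \<delta> x < 1" using g m1 by linarith
      then have z: "\<bar>z\<bar> < \<delta> x" using pos by simp
      have "0 \<le> \<bar>z\<bar> / \<delta> x" using pos by simp
      then have "0 < 1 + y / \<delta> x" "0 < 1 - y / (h x + \<delta> x)" using g by linarith+
      then have y: "- \<delta> x < y" "y < h x + \<delta> x" using pos by (auto simp: field_simps)
      \<comment> \<open>The point of the fibre closest to y. A displaced point lies within 2
        \<delta> of it, closer than \<open>K\<close> can be.\<close>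
      define y0 where "y0 = max 0 (min y (h x))"
      have r: "0 \<le> y0 / h x" "y0 / h x \<le> 1" "y0 / h x * h x = y0"
        using pos by (auto simp: y0_def)
      have "dist (x, y0, 0) (x, y, z) \<le> \<bar>y0 - y\<bar> + \<bar>z\<bar>"
        unfolding dist_prod_def by (simp add: dist_real_def sqrt_sum_squares_le_sum_abs[of "y0 - y" z, simplified])
      also have "\<dots> < 2 * \<delta> x" using y z by (auto simp: y0_def)
      also have "\<dots> \<le> \<phi> x (y0 / h x)" by (rule \<delta>_le[OF r(1,2)])
      also have "\<dots> = infdist (x, y0, 0) K2" by (simp only: \<phi>_def r(3))
      also have "\<dots> \<le> dist (x, y0, 0) (x, y, z)" using that by (intro infdist_le) (simp add: K2_def)
      finally show False by simp
    qed
    have eA: "e (x, 0, 0) = 1 - \<bar>x\<bar>" if "-1 \<le> x" "x \<le> 1" for x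
      using that by (simp add: e_def \<psi>_def h_def)
    have "(\<lambda>(x, y, z). (x, y + e (x, y, z), z)) ` K = K"
      using eK by (force simp: image_iff)
    moreover have "(\<lambda>(x, y, z). (x, y + e (x, y, z), z)) ` (\<lambda>x. (x, 0, 0)) ` {-1..1} = (\<lambda>x. (x, 1 - \<bar>x\<bar>, 0)) ` {-1..1}"
      using eA by (simp add: image_image cong: image_cong_simp)
    ultimately show ?thesis by (simp add: image_Un)
  qed
  show ?thesis using iso[of "K \<union> (\<lambda>x. (x, 0, 0)) ` {-1..1}"] unfolding img .
qed

text \<open>An affine bijection carries the standard triangle to a, b, c: its origin is the midpoint
  of a and b, and any vector outside the plane of the triangle completes the basis.\<close>

lemma triangle_move:
  fixes a b c :: R3
  assumes K: "closed K" "K \<inter> convex hull {a, b, c} \<subseteq> {a, b}"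
    and ind: "\<And>x y. x *\<^sub>R (b - a) + y *\<^sub>R (c - a) = 0 \<Longrightarrow> x = 0 \<and> y = 0"
  shows "isotopic (K \<union> closed_segment a b) (K \<union> (closed_segment a c \<union> closed_segment c b))"
proof -
  define m where "m = (1/2) *\<^sub>R (a + b)"
  define e1 where "e1 = (1/2) *\<^sub>R (b - a)"
  define e2 where "e2 = c - m"
  have ind': "x = 0 \<and> y = 0" if "x *\<^sub>R e1 + y *\<^sub>R e2 = 0" for x y
  proof -
    have "x *\<^sub>R e1 + y *\<^sub>R e2 = (x / 2 - y / 2) *\<^sub>R (b - a) + y *\<^sub>R (c - a)"
      unfolding e1_def e2_def m_def by (simp add: prod_eq_iff) (simp add: field_simps)
    then show ?thesis using ind[of "x / 2 - y / 2" y] that by simp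
  qed
  have "dim (span {e1, e2}) \<le> card {e1, e2}" using dim_le_card'[of "{e1, e2}"] by simp
  also have "card {e1, e2} \<le> 2" by (simp add: card_insert_if)
  finally have le: "dim (span {e1, e2}) \<le> 2" by simp
  have "span {e1, e2} \<noteq> UNIV"
  proof
    assume "span {e1, e2} = UNIV"
    then have "dim (UNIV :: R3 set) \<le> 2" using le by metis
    then show False by simp
  qed
  then obtain e3 where e3: "e3 \<notin> span {e1, e2}" by blast
  define g where "g = (\<lambda>P :: R3. fst P *\<^sub>R e1 + fst (snd P) *\<^sub>R e2 + snd (snd P) *\<^sub>R e3)"
  have lin: "linear g" unfolding g_def by (intro linearI) (simp_all add: algebra_simps)
  have "P = 0" if "g P = 0" for P
  proof -
    obtain x y z where P: "P = (x, y, z)" by (rule prod_cases3)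
    have eq: "x *\<^sub>R e1 + y *\<^sub>R e2 + z *\<^sub>R e3 = 0" using that by (simp add: g_def P)
    have "z = 0"
    proof (rule ccontr)
      assume z: "z \<noteq> 0"
      have "z *\<^sub>R e3 = - (x *\<^sub>R e1 + y *\<^sub>R e2)" using eq by (simp only: add_eq_0_iff)
      moreover have "e3 = (1 / z) *\<^sub>R (z *\<^sub>R e3)" using z by simp
      ultimately have "e3 = (1 / z) *\<^sub>R (- (x *\<^sub>R e1 + y *\<^sub>R e2))" by (simp only:)
      moreover have "(1 / z) *\<^sub>R (- (x *\<^sub>R e1 + y *\<^sub>R e2)) \<in> span {e1, e2}"
        by (intro span_scale span_neg span_add span_base) auto
      ultimately show False using e3 by simp
    qed
    then show ?thesis using ind'[of x y] eq by (simp add: P zero_prod_def)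
  qed
  then have inj: "inj g" using lin linear_injective_0 by blast
  have surj: "surj g" using linear_injective_imp_surjective[OF lin inj] by simp
  define f where "f P = m + g P" for P
  have bij: "bij f"
  proof (rule bijI)
    show "inj f" using inj by (auto simp: inj_def f_def)
    show "surj f" unfolding surj_def
    proof
      fix Q
      obtain P where "Q - m = g P" using surj by (rule surjE)
      then show "\<exists>P. Q = f P" by (intro exI[of _ P]) (simp add: f_def algebra_simps)
    qed
  qed
  have cont: "continuous_on S f" for S
    unfolding f_def using linear_continuous_on[of g] lin by (intro continuous_intros) (simp add: linear_conv_bounded_linear)
  obtain f' where f': "homeomorphism UNIV UNIV f f'"
    using invariance_of_domain_homeomorphism[of UNIV f] cont bij by (auto simp: bij_def)
  \<comment> \<open>The coefficients are the barycentric coordinates of (x, y, 0) in the standard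
    triangle, so the two triangles correspond.\<close>
  have f_eq: "f (x, y, 0) = ((1 - y - x) / 2) *\<^sub>R a + ((1 - y + x) / 2) *\<^sub>R b + y *\<^sub>R c" for x y
    unfolding f_def g_def e1_def e2_def m_def
    by (simp add: prod_eq_iff) (simp add: field_simps)
  define K0 where "K0 = f -` K"
  have fK0: "f ` K0 = K" using bij by (simp add: K0_def bij_def surj_image_vimage_eq)
  have "closed K0" unfolding K0_def by (rule closed_vimage[OF K(1) cont])
  moreover have "x = -1 \<or> x = 1" if "(x, y, 0) \<in> K0" "0 \<le> y" "y \<le> 1 - \<bar>x\<bar>" for x y
  proof -
    have "f (x, y, 0) \<in> convex hull {a, b, c}"
      unfolding convex_hull_3 f_eq using that
      by (intro CollectI exI[of _ "(1 - y - x) / 2"] exI[of _ "(1 - y + x) / 2"] exI[of _ y]) (auto simp: field_simps)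
    then have "f (x, y, 0) \<in> {a, b}" using K(2) that by (auto simp: K0_def)
    moreover have "a = f (-1, 0, 0)" "b = f (1, 0, 0)" by (simp_all add: f_eq)
    ultimately show ?thesis using bij by (auto simp: bij_def inj_eq)
  qed
  ultimately have "isotopic (K0 \<union> (\<lambda>x. (x, 0, 0)) ` {-1..1}) (K0 \<union> (\<lambda>x. (x, 1 - \<bar>x\<bar>, 0)) ` {-1..1})"
    by (rule isotopic_standard_triangle)
  then have "isotopic (f ` (K0 \<union> (\<lambda>x. (x, 0, 0)) ` {-1..1})) (f ` (K0 \<union> (\<lambda>x. (x, 1 - \<bar>x\<bar>, 0)) ` {-1..1}))"
    using f' by (rule isotopic_conjugate)
  moreover have "f ` (\<lambda>x. (x, 0, 0)) ` {-1..1} = closed_segment a b"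
  proof -
    have "f ` (\<lambda>x. (x, 0, 0)) ` {-1..1} = (\<lambda>u. (1 - u) *\<^sub>R a + u *\<^sub>R b) ` (\<lambda>x. (1 + x) / 2) ` {-1..1}"
      unfolding image_image f_eq by (intro image_cong) (simp_all add: field_simps)
    also have "(\<lambda>x :: real. (1 + x) / 2) ` {-1..1} = {0..1}"
    proof (intro set_eqI iffI)
      fix u :: real assume "u \<in> {0..1}"
      then show "u \<in> (\<lambda>x. (1 + x) / 2) ` {-1..1}" by (intro image_eqI[of _ _ "2 * u - 1"]) auto
    qed auto
    finally show ?thesis by (simp add: closed_segment_image_interval)
  qed
  moreover have "f ` (\<lambda>x. (x, 1 - \<bar>x\<bar>, 0)) ` {-1..1} = closed_segment a c \<union> closed_segment c b"
  proof -
    have dec: "{-1..1} = (\<lambda>u. u - 1) ` {0..1 :: real} \<union> {0..1}"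
    proof (intro set_eqI iffI)
      fix x :: real assume "x \<in> {-1..1}"
      then show "x \<in> (\<lambda>u. u - 1) ` {0..1} \<union> {0..1}"
        by (cases "x \<le> 0") (auto intro: image_eqI[of _ _ "x + 1"])
    qed auto
    have e1: "f (u - 1, 1 - \<bar>u - 1\<bar>, 0) = (1 - u) *\<^sub>R a + u *\<^sub>R c" if "0 \<le> u" "u \<le> 1" for u
    proof -
      have "1 - \<bar>u - 1\<bar> = u" "(1 - u - (u - 1)) / 2 = 1 - u" "(1 - u + (u - 1)) / 2 = 0"
        using that by (auto simp: field_simps)
      then show ?thesis by (simp only: f_eq scaleR_zero_left add_0_right)
    qed
    have e2: "f (u, 1 - \<bar>u\<bar>, 0) = (1 - u) *\<^sub>R c + u *\<^sub>R b" if "0 \<le> u" "u \<le> 1" for u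
    proof -
      have "1 - \<bar>u\<bar> = 1 - u" "(1 - (1 - u) - u) / 2 = 0" "(1 - (1 - u) + u) / 2 = u"
        using that by (auto simp: field_simps)
      then show ?thesis by (simp only: f_eq scaleR_zero_left add_0_left add.commute)
    qed
    have "f ` (\<lambda>x. (x, 1 - \<bar>x\<bar>, 0)) ` {-1..1} =
       (\<lambda>u. f (u - 1, 1 - \<bar>u - 1\<bar>, 0)) ` {0..1} \<union> (\<lambda>u. f (u, 1 - \<bar>u\<bar>, 0)) ` {0..1}"
      by (simp only: dec image_Un image_image)
    also have "(\<lambda>u. f (u - 1, 1 - \<bar>u - 1\<bar>, 0)) ` {0..1} = (\<lambda>u. (1 - u) *\<^sub>R a + u *\<^sub>R c) ` {0..1}"
      using e1 by (intro image_cong) auto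
    also have "(\<lambda>u. f (u, 1 - \<bar>u\<bar>, 0)) ` {0..1} = (\<lambda>u. (1 - u) *\<^sub>R c + u *\<^sub>R b) ` {0..1}"
      using e2 by (intro image_cong) auto
    finally show ?thesis by (simp add: closed_segment_image_interval)
  qed
  ultimately show ?thesis by (simp only: image_Un fK0)
qed


section \<open>Collapsing a planar polyline from above\<close>

abbreviation height :: "R3 \<Rightarrow> real" where "height P \<equiv> snd (snd P)"

fun polyline :: "R3 list \<Rightarrow> R3 set" where
  "polyline (p # q # ps) = closed_segment p q \<union> polyline (q # ps)"
| "polyline _ = {}"

lemma closed_polyline: "closed (polyline ps)"
  by (induction ps rule: polyline.induct) (auto intro: closed_Un)

lemma polyline_height:
  assumes "P \<in> polyline ps" "\<And>q. q \<in> set ps \<Longrightarrow> height q = 0"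
  shows "height P = 0"
  using assms
proof (induction ps rule: polyline.induct)
  case (1 p q ps)
  show ?case
  proof (cases "P \<in> closed_segment p q")
    case True
    then obtain u where "P = (1 - u) *\<^sub>R p + u *\<^sub>R q" unfolding closed_segment_def by blast
    then show ?thesis using 1(3)[of p] 1(3)[of q] by simp
  next
    case False
    then show ?thesis using 1 by simp
  qed
qed simp_all

lemma triangle_base:
  assumes "P \<in> convex hull {p, q, V}" "height P \<le> 0" "height p = 0" "height q = 0" "height V > 0"
  shows "P \<in> closed_segment p q"
proof -
  obtain u v w where uvw: "0 \<le> u" "0 \<le> v" "0 \<le> w" "u + v + w = 1" "P = u *\<^sub>R p + v *\<^sub>R q + w *\<^sub>R V"
    using assms(1) unfolding convex_hull_3 by blast
  then have "w * height V \<le> 0" using assms by simp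
  then have "w = 0" using assms(5) uvw(3) by (simp add: mult_le_0_iff)
  then show ?thesis unfolding closed_segment_def using uvw by (intro CollectI exI[of _ v]) auto
qed

text \<open>The conditions under which edges can be removed from the front one at a time: an edge
  meets \<open>K\<close> and the later edges at most in its far end, and it misses the fixed
  starting point \<open>p0\<close>.\<close>

fun polyline_ok :: "R3 set \<Rightarrow> R3 \<Rightarrow> R3 list \<Rightarrow> bool" where
  "polyline_ok K p0 (p # q # ps) \<longleftrightarrow> p \<noteq> q \<and> p0 \<notin> closed_segment p q \<and> K \<inter> closed_segment p q \<subseteq> {q} \<and>
     polyline (q # ps) \<inter> closed_segment p q \<subseteq> {q} \<and> polyline_ok K p0 (q # ps)"
| "polyline_ok K p0 _ \<longleftrightarrow> True"

text \<open>The spoke from V slides along the polyline and consumes an edge pq by a move across the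
  triangle V, p, q. Everything else lies at height at most 0 and meets this triangle in its base
  only, except for the spoke from \<open>p0\<close> to V.\<close>

lemma isotopic_cone_tail:
  assumes "closed K" "\<And>P. P \<in> K \<Longrightarrow> height P \<le> 0" "height p0 = 0" "height V > 0"
    and "ps \<noteq> []" "\<And>q. q \<in> set ps \<Longrightarrow> height q = 0" "polyline_ok K p0 ps"
  shows "isotopic (K \<union> (closed_segment p0 V \<union> closed_segment V (hd ps)) \<union> polyline ps)
    (K \<union> (closed_segment p0 V \<union> closed_segment V (last ps)))"
  using assms(5-)
proof (induction ps rule: polyline.induct)
  case (1 p q ps)
  have ok: "p \<noteq> q" "p0 \<notin> closed_segment p q" "K \<inter> closed_segment p q \<subseteq> {q}"
    "polyline (q # ps) \<inter> closed_segment p q \<subseteq> {q}" "polyline_ok K p0 (q # ps)"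
    using 1(4) by auto
  have ht: "height p = 0" "height q = 0" "\<And>r. r \<in> set (q # ps) \<Longrightarrow> height r = 0"
    using 1(3) by auto
  let ?K = "K \<union> closed_segment p0 V \<union> polyline (q # ps)"
  have "isotopic (?K \<union> closed_segment V q) (?K \<union> (closed_segment V p \<union> closed_segment p q))"
  proof (rule triangle_move)
    show "closed ?K" using assms(1) by (intro closed_Un closed_polyline) auto
    have hull: "convex hull {V, q, p} = convex hull {p, q, V}" by (simp add: insert_commute)
    show "?K \<inter> convex hull {V, q, p} \<subseteq> {V, q}"
    proof
      fix P assume P: "P \<in> ?K \<inter> convex hull {V, q, p}"
      show "P \<in> {V, q}"
      proof (cases "height P \<le> 0")
        case True
        then have Ppq: "P \<in> closed_segment p q"
          using P triangle_base ht assms(4) unfolding hull by blast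
        consider "P \<in> K" | "P \<in> closed_segment p0 V" | "P \<in> polyline (q # ps)" using P by blast
        then show ?thesis
        proof cases
          case 2
          then obtain t where t: "0 \<le> t" "t \<le> 1" "P = (1 - t) *\<^sub>R p0 + t *\<^sub>R V"
            unfolding closed_segment_def by blast
          then have "t * height V \<le> 0" using True assms(3) by simp
          then have "t = 0" using assms(4) t(1) by (simp add: mult_le_0_iff)
          then show ?thesis using t ok Ppq by simp
        qed (use ok Ppq in blast)+
      next
        case False
        have hullP: "P \<in> convex hull {p, q, V}" using P by (simp only: hull Int_iff)
        have "P \<in> closed_segment p0 V"
          using False P assms(2) polyline_height[of P "q # ps"] ht(3) by fastforce
        then obtain t where t: "0 \<le> t" "t \<le> 1" "P = (1 - t) *\<^sub>R p0 + t *\<^sub>R V"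
          unfolding closed_segment_def by blast
        obtain u v w where uvw: "0 \<le> u" "0 \<le> v" "0 \<le> w" "u + v + w = 1" "P = u *\<^sub>R p + v *\<^sub>R q + w *\<^sub>R V"
          using hullP unfolding convex_hull_3 by blast
        have "height P = t * height V" using t(3) assms(3) by simp
        moreover have "height P = w * height V" using uvw(5) ht(1,2) by simp
        \<comment> \<open>A common point has equal weight at V in both descriptions, as heights
          show. Projecting from V, unless the point is V itself, puts \<open>p0\<close> on the edge,
          which is excluded.\<close>
        ultimately have wt: "w = t" using assms(4) by simp
        show ?thesis
        proof (cases "t = 1")
          case False
          then have pos: "1 - t > 0" using t by simp
          have "(1 - t) *\<^sub>R p0 = u *\<^sub>R p + v *\<^sub>R q" using t(3) uvw(5) wt by simp
          moreover have "p0 = (1 / (1 - t)) *\<^sub>R ((1 - t) *\<^sub>R p0)" using pos by simp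
          ultimately have "p0 = (1 / (1 - t)) *\<^sub>R (u *\<^sub>R p + v *\<^sub>R q)" by (simp only:)
          then have "p0 = (u / (1 - t)) *\<^sub>R p + (v / (1 - t)) *\<^sub>R q"
            by (simp add: scaleR_add_right)
          moreover have "u / (1 - t) = 1 - v / (1 - t)" "0 \<le> v / (1 - t)" "v / (1 - t) \<le> 1"
            using pos uvw wt by (auto simp: field_simps)
          ultimately have "p0 \<in> closed_segment p q" unfolding closed_segment_def
            by (intro CollectI exI[of _ "v / (1 - t)"]) auto
          then show ?thesis using ok by simp
        qed (use t in simp)
      qed
    qed
    fix x y assume eq: "x *\<^sub>R (q - V) + y *\<^sub>R (p - V) = 0"
    have "(x + y) * height V = 0" using arg_cong[OF eq, of height] ht(1,2) by (simp add: algebra_simps)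
    then have y: "y = - x" using assms(4) by simp
    then have "x *\<^sub>R (q - p) = 0" using eq by (simp add: algebra_simps)
    then show "x = 0 \<and> y = 0" using ok(1) y by simp
  qed
  then have step: "isotopic (K \<union> (closed_segment p0 V \<union> closed_segment V p) \<union> polyline (p # q # ps))
     (K \<union> (closed_segment p0 V \<union> closed_segment V q) \<union> polyline (q # ps))"
    by (intro isotopic_sym[of "K \<union> (closed_segment p0 V \<union> closed_segment V q) \<union> polyline (q # ps)"])
      (simp add: Un_ac)
  have "isotopic (K \<union> (closed_segment p0 V \<union> closed_segment V q) \<union> polyline (q # ps))
     (K \<union> (closed_segment p0 V \<union> closed_segment V (last (q # ps))))"
    using 1(1)[OF _ ht(3) ok(5)] unfolding list.sel by blast
  with step have "isotopic (K \<union> (closed_segment p0 V \<union> closed_segment V p) \<union> polyline (p # q # ps))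
     (K \<union> (closed_segment p0 V \<union> closed_segment V (last (q # ps))))"
    by (rule isotopic_trans)
  then show ?case by (simp only: list.sel last.simps list.distinct if_False)
qed (simp_all add: isotopic_refl Un_ac)

text \<open>The first edge is lifted to a roof over a point V above the plane, the far side of the
  roof consumes the remaining edges, and the roof is lowered onto the direct segment.\<close>

lemma isotopic_polyline_collapse:
  assumes K: "closed K" "\<And>P. P \<in> K \<Longrightarrow> height P \<le> 0"
    and ht: "\<And>r. r \<in> set (p # q # ps) \<Longrightarrow> height r = 0"
    and pq: "p \<noteq> q" "K \<inter> closed_segment p q \<subseteq> {p, q}" "polyline (q # ps) \<inter> closed_segment p q \<subseteq> {p, q}"
    and ok: "polyline_ok K p (q # ps)"
    and e: "p \<noteq> last (q # ps)" "K \<inter> closed_segment p (last (q # ps)) \<subseteq> {p, last (q # ps)}"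
  shows "isotopic (K \<union> polyline (p # q # ps)) (K \<union> closed_segment p (last (q # ps)))"
proof -
  define V :: R3 where "V = (0, 0, 1)"
  have V: "height V > 0" by (simp add: V_def)
  let ?K = "K \<union> polyline (q # ps)"
  have base: "isotopic (K' \<union> closed_segment a b) (K' \<union> (closed_segment a V \<union> closed_segment V b))"
    if "closed K'" "\<And>P. P \<in> K' \<Longrightarrow> height P \<le> 0" "height a = 0" "height b = 0" "a \<noteq> b"
      "K' \<inter> closed_segment a b \<subseteq> {a, b}" for K' a b
  proof (rule triangle_move[OF that(1)])
    show "K' \<inter> convex hull {a, b, V} \<subseteq> {a, b}"
      using triangle_base[of _ a b V] that V by blast
    fix x y assume eq: "x *\<^sub>R (b - a) + y *\<^sub>R (V - a) = 0"
    have "y * height V = 0" using arg_cong[OF eq, of height] that by (simp add: algebra_simps)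
    then have "y = 0" using V by simp
    then show "x = 0 \<and> y = 0" using eq that(5) by simp
  qed
  have "isotopic (?K \<union> closed_segment p q) (?K \<union> (closed_segment p V \<union> closed_segment V q))"
  proof (rule base)
    show "closed ?K" using K(1) by (intro closed_Un closed_polyline)
    show "height P \<le> 0" if "P \<in> ?K" for P
      using that K(2) polyline_height[of P "q # ps"] ht by fastforce
  qed (use ht pq in auto)
  also have "?K \<union> (closed_segment p V \<union> closed_segment V q) =
      K \<union> (closed_segment p V \<union> closed_segment V (hd (q # ps))) \<union> polyline (q # ps)" by auto
  also have "isotopic \<dots>
    (K \<union> (closed_segment p V \<union> closed_segment V (last (q # ps))))"
    using K ht V ok by (intro isotopic_cone_tail) auto
  also have "isotopic \<dots> (K \<union> closed_segment p (last (q # ps)))"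
    using K ht e by (intro isotopic_sym[OF base]) auto
  finally show ?thesis by (simp add: Un_ac)
qed

section \<open>Realising letters by crossings\<close>

definition realizable :: "nat \<Rightarrow> nat \<Rightarrow> letter list \<Rightarrow> bool" where
  "realizable s n w \<longleftrightarrow> (\<exists>bs. is_ncrossing_braid s n bs \<and> word_equiv s w (map (crossing_letter n) bs))"

lemma realizable_equiv: "word_equiv s w w' \<Longrightarrow> realizable s n w' \<Longrightarrow> realizable s n w"
  unfolding realizable_def using word_equiv_trans by blast

lemma realizable_Nil: "realizable s n []"
  unfolding realizable_def is_ncrossing_braid_def
  by (intro exI[of _ "[]"]) (simp add: word_equiv_refl)

lemma realizable_append:
  assumes "realizable s n u" "realizable s n v"
  shows "realizable s n (u @ v)"
proof -
  obtain bs cs where "is_ncrossing_braid s n bs" "word_equiv s u (map (crossing_letter n) bs)"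
      "is_ncrossing_braid s n cs" "word_equiv s v (map (crossing_letter n) cs)"
    using assms unfolding realizable_def by blast
  then show ?thesis
    unfolding realizable_def is_ncrossing_braid_def
    by (intro exI[of _ "bs @ cs"]) (auto intro: word_equiv_append)
qed

lemma realizable_index:
  assumes "realizable s n w" "isotopic (word_closure s w) L"
  shows "crossing_braid_index n L \<le> enat s"
proof -
  obtain bs where bs: "is_ncrossing_braid s n bs" "word_equiv s w (map (crossing_letter n) bs)"
    using assms(1) unfolding realizable_def by blast
  have "isotopic (braid_closure s n bs) L"
    unfolding braid_closure_eq_word_closure
    using isotopic_trans[OF isotopic_sym[OF word_equiv_isotopic[OF bs(2)]] assms(2)] .
  then show ?thesis unfolding crossing_braid_index_def using bs(1)
    by (intro INF_lower) blast
qed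

lemma window_rev_inverted:
  assumes "p < q" "window_rev j n q < window_rev j n p"
  shows "j \<le> p" "q < j + n"
  using assms by (auto simp: window_rev_def split: if_splits)

text \<open>Ranks within the window turn arbitrary distinct heights into levels 1, ..., n without
  changing their order; all inverted pairs lie in the window, so \<open>word_equiv_levels\<close>
  applies.\<close>

lemma crossing_letter_ranked:
  assumes l: "inj_on l {..<s}" and jn: "j + n \<le> s"
  shows "\<exists>lev. valid_ncrossing s n (j, lev) \<and> word_equiv s [(window_rev j n, l)] [crossing_letter n (j, lev)]"
proof -
  define lev where "lev i = card {i'. i' < n \<and> l (j + i') \<le> l (j + i)}" for i
  have mono: "lev i < lev i'" if "i < n" "i' < n" "l (j + i) < l (j + i')" for i i'
    unfolding lev_def
  proof (rule psubset_card_mono)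
    have "{k. k < n \<and> l (j + k) \<le> l (j + i)} \<subseteq> {k. k < n \<and> l (j + k) \<le> l (j + i')}"
      using that(3) by (intro Collect_mono) linarith
    moreover have "i' \<in> {k. k < n \<and> l (j + k) \<le> l (j + i')}"
      "i' \<notin> {k. k < n \<and> l (j + k) \<le> l (j + i)}" using that by simp_all
    ultimately show "{k. k < n \<and> l (j + k) \<le> l (j + i)} \<subset> {k. k < n \<and> l (j + k) \<le> l (j + i')}"
      by blast
  qed simp
  have ne: "l (j + i) \<noteq> l (j + i')" if "i < n" "i' < n" "i \<noteq> i'" for i i'
    using l that jn by (auto dest!: inj_onD)
  have inj: "inj_on lev {0..<n}"
  proof (rule inj_onI, rule ccontr)
    fix i i' assume i: "i \<in> {0..<n}" "i' \<in> {0..<n}" "lev i = lev i'" "i \<noteq> i'"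
    then show False using ne[of i i'] mono[of i i'] mono[of i' i] by force
  qed
  have "lev ` {0..<n} \<subseteq> {1..n}"
  proof
    fix v assume "v \<in> lev ` {0..<n}"
    then obtain i where i: "i < n" "v = lev i" by auto
    have "lev i \<le> card {..<n}" unfolding lev_def by (intro card_mono) auto
    moreover have "0 < lev i" unfolding lev_def using i by (subst card_gt_0_iff) auto
    ultimately show "v \<in> {1..n}" using i by simp
  qed
  moreover have "card (lev ` {0..<n}) = card {1..n}" using card_image[OF inj] by simp
  ultimately have "lev ` {0..<n} = {1..n}" by (intro card_subset_eq) auto
  then have "bij_betw lev {0..<n} {1..n}" using inj by (simp add: bij_betw_def)
  then have "valid_ncrossing s n (j, lev)" using jn by (simp add: valid_ncrossing_def)
  moreover have "word_equiv s [(window_rev j n, l)] [crossing_letter n (j, lev)]"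
    unfolding crossing_letter_def fst_conv snd_conv
  proof (rule word_equiv_levels[OF window_rev_permutes[OF jn]])
    fix p q assume pq: "p < q" "q < s" "window_rev j n q < window_rev j n p"
    have w: "j \<le> p" "q < j + n" using window_rev_inverted[OF pq(1,3)] .
    have i: "p - j < n" "q - j < n" "j + (p - j) = p" "j + (q - j) = q" using w pq by auto
    have "l p \<noteq> l q" using ne[of "p - j" "q - j"] i w pq by auto
    then have "l p < l q \<and> lev (p - j) < lev (q - j) \<or> l q < l p \<and> lev (q - j) < lev (p - j)"
      using mono[OF i(1,2)] mono[OF i(2,1)] i(3,4) by (metis linorder_neqE_linordered_idom)
    then show "l p < l q \<and>
          (if j \<le> p \<and> p < j + n then real (lev (p - j)) else 0) < (if j \<le> q \<and> q < j + n then real (lev (q - j)) else 0) \<or>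
          l q < l p \<and>
          (if j \<le> q \<and> q < j + n then real (lev (q - j)) else 0) < (if j \<le> p \<and> p < j + n then real (lev (p - j)) else 0)"
      using w pq by simp
  qed
  ultimately show ?thesis by blast
qed

lemma crossing_letter_injective:
  assumes "valid_ncrossing s m (j, lev)"
  shows "\<exists>l. inj_on l {..<s} \<and> word_equiv s [crossing_letter m (j, lev)] [(window_rev j m, l)]"
proof -
  have jm: "j + m \<le> s" and bij: "bij_betw lev {0..<m} {1..m}"
    using assms by (auto simp: valid_ncrossing_def)
  \<comment> \<open>Strings outside the window are in no inversion, so their heights are free. The
    values m + 1 + p are distinct from each other and from all levels, which gives the injectivity
    that \<open>word_equiv_comp\<close> asks for.\<close>
  define l where "l p = (if j \<le> p \<and> p < j + m then real (lev (p - j)) else real (m + 1 + p))" for p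
  have lev: "lev i \<in> {1..m}" if "i < m" for i using bij that by (auto simp: bij_betw_def)
  have lev_inj: "lev i \<noteq> lev i'" if "i < m" "i' < m" "i \<noteq> i'" for i i'
    using bij that by (auto simp: bij_betw_def inj_on_def)
  have "inj_on l {..<s}"
  proof (rule inj_onI)
    fix p q assume eq: "l p = l q"
    have inw: "p - j < m" "l p = real (lev (p - j))" "lev (p - j) \<le> m" if "j \<le> p \<and> p < j + m" for p
    proof -
      show "p - j < m" using that by arith
      then show "lev (p - j) \<le> m" using lev by simp
    qed (use that in \<open>simp add: l_def\<close>)
    have outw: "l p = real (m + 1 + p)" if "\<not> (j \<le> p \<and> p < j + m)" for p
      using that unfolding l_def by (rule if_not_P)
    show "p = q"
    proof (cases "j \<le> p \<and> p < j + m"; cases "j \<le> q \<and> q < j + m")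
      assume w: "j \<le> p \<and> p < j + m" "j \<le> q \<and> q < j + m"
      then have "lev (p - j) = lev (q - j)" using inw(2)[OF w(1)] inw(2)[OF w(2)] eq by simp
      then have "p - j = q - j" using lev_inj inw(1)[OF w(1)] inw(1)[OF w(2)] by blast
      then show ?thesis using w by arith
    next
      assume w: "j \<le> p \<and> p < j + m" "\<not> (j \<le> q \<and> q < j + m)"
      then show ?thesis using inw(2,3)[OF w(1)] outw[OF w(2)] eq by linarith
    next
      assume w: "\<not> (j \<le> p \<and> p < j + m)" "j \<le> q \<and> q < j + m"
      then show ?thesis using inw(2,3)[OF w(2)] outw[OF w(1)] eq by linarith
    next
      assume w: "\<not> (j \<le> p \<and> p < j + m)" "\<not> (j \<le> q \<and> q < j + m)"
      then show ?thesis using outw[OF w(1)] outw[OF w(2)] eq by linarith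
    qed
  qed
  moreover have "word_equiv s [crossing_letter m (j, lev)] [(window_rev j m, l)]"
    unfolding crossing_letter_def fst_conv snd_conv
  proof (rule word_equiv_levels[OF window_rev_permutes[OF jm]])
    fix p q assume pq: "p < q" "q < s" "window_rev j m q < window_rev j m p"
    have w: "j \<le> p" "q < j + m" using window_rev_inverted[OF pq(1,3)] .
    then have "lev (p - j) \<noteq> lev (q - j)" using pq by (intro lev_inj) auto
    then show "(if j \<le> p \<and> p < j + m then real (lev (p - j)) else 0) < (if j \<le> q \<and> q < j + m then real (lev (q - j)) else 0) \<and> l p < l q \<or>
          (if j \<le> q \<and> q < j + m then real (lev (q - j)) else 0) < (if j \<le> p \<and> p < j + m then real (lev (p - j)) else 0) \<and> l q < l p"
      using w pq by (auto simp: l_def)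
  qed
  ultimately show ?thesis by blast
qed

lemma inj_on_permutes_comp:
  assumes "inj_on l S" "\<pi> permutes S"
  shows "inj_on (l \<circ> \<pi>) S"
  by (intro comp_inj_on) (simp_all add: assms(1) permutes_image[OF assms(2)] permutes_inj_on[OF assms(2)])

text \<open>The factors of \<pi> are split off one reversal at a time, the heights travelling with
  the strings. In h \<circ> r the reversal acts first, so its letter precedes the letter of h, which
  has heights l \<circ> r.\<close>

lemma realizable_rev_group:
  assumes "\<pi> \<in> rev_group s n" "n \<le> s" "inj_on l {..<s}"
  shows "realizable s n [(\<pi>, l)]"
  using assms(1,3)
proof (induction arbitrary: l)
  case id
  let ?r = "window_rev 0 n"
  have r: "?r permutes {..<s}" using assms(2) by (intro window_rev_permutes) simp
  have single: "realizable s n [(?r, l')]" if l': "inj_on l' {..<s}" for l'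
  proof -
    obtain lev where "valid_ncrossing s n (0, lev)" "word_equiv s [(?r, l')] [crossing_letter n (0, lev)]"
      using crossing_letter_ranked[OF l', of 0 n] assms(2) by auto
    then show ?thesis unfolding realizable_def is_ncrossing_braid_def
      by (intro exI[of _ "[(0, lev)]"]) simp
  qed
  \<comment> \<open>The identity letter fills a slab and is not the empty word; it is realised by a
    reversal followed by the same reversal.\<close>
  have "?r \<circ> ?r = id" by (simp add: fun_eq_iff window_rev_involution)
  then have "word_equiv s [(id, l)] [(?r, l), (?r, l \<circ> ?r)]"
    using word_equiv_comp[OF r r id, of "l \<circ> ?r"] by (simp add: window_rev_involution word_equiv_sym)
  moreover have "realizable s n ([(?r, l)] @ [(?r, l \<circ> ?r)])"
    by (intro realizable_append single id inj_on_permutes_comp[OF id r])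
  ultimately show ?case unfolding append.simps by (rule realizable_equiv)
next
  case (step h j)
  let ?r = "window_rev j n"
  have r: "?r permutes {..<s}" using step by (intro window_rev_permutes) simp
  obtain lev where lev: "valid_ncrossing s n (j, lev)" "word_equiv s [(?r, l)] [crossing_letter n (j, lev)]"
    using crossing_letter_ranked[OF step(4) step(2)] by auto
  then have "realizable s n [(?r, l)]" unfolding realizable_def is_ncrossing_braid_def
    by (intro exI[of _ "[(j, lev)]"]) simp
  moreover have "realizable s n [(h, l \<circ> ?r)]"
    by (intro step(3) inj_on_permutes_comp[OF step(4) r])
  ultimately have "realizable s n ([(?r, l)] @ [(h, l \<circ> ?r)])" by (rule realizable_append)
  moreover have "word_equiv s [(h \<circ> ?r, l)] [(?r, l), (h, l \<circ> ?r)]"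
    using rev_group_permutes[OF step(1)] step(4) r
    by (intro word_equiv_sym[OF word_equiv_comp]) (simp_all add: window_rev_involution)
  ultimately show ?case unfolding append.simps by (rule realizable_equiv[rotated])
qed

lemma word_equiv_adjacent_transpose:
  assumes "Suc i < s" "l i < l (Suc i) \<and> l' i < l' (Suc i) \<or> l (Suc i) < l i \<and> l' (Suc i) < l' i"
  shows "word_equiv s [(Transposition.transpose i (Suc i), l)] [(Transposition.transpose i (Suc i), l')]"
proof (rule word_equiv_levels)
  show "Transposition.transpose i (Suc i) permutes {..<s}"
    using assms(1) by (intro permutes_swap_id) auto
  fix p q assume "p < q" "Transposition.transpose i (Suc i) q < Transposition.transpose i (Suc i) p"
  then have "p = i" "q = Suc i" by (auto simp: Transposition.transpose_def split: if_splits)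
  then show "l p < l q \<and> l' p < l' q \<or> l q < l p \<and> l' q < l' p" using assms(2) by simp
qed

text \<open>Both letters are factored through the transposition \<open>\<tau>\<close> of the first two strings; the factors
  \<open>\<tau>\<close> that meet in the middle become even once the transposition \<open>\<tau>'\<close> of the next two strings
  is inserted and removed again.\<close>
lemma realizable_odd_pair:
  assumes n: "even n" "n \<ge> 2" "n + 2 \<le> s"
    and \<pi>: "\<pi>1 permutes {..<s}" "\<pi>2 permutes {..<s}" "\<not> evenperm \<pi>1" "\<not> evenperm \<pi>2"
    and l: "inj_on l1 {..<s}" "inj_on l2 {..<s}"
  shows "realizable s n [(\<pi>1, l1), (\<pi>2, l2)]"
proof -
  define \<tau> where "\<tau> = Transposition.transpose (0 :: nat) (Suc 0)"
  \<comment> \<open>Positions 2 and 3 exist because s \<ge> n + 2 \<ge> 4. Being disjoint, the two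
    transpositions commute.\<close>
  define \<tau>' where "\<tau>' = Transposition.transpose (2 :: nat) (Suc 2)"
  have p: "\<tau> permutes {..<s}" "\<tau>' permutes {..<s}"
    using n unfolding \<tau>_def \<tau>'_def by (auto intro!: permutes_swap_id)
  have inv [simp]: "\<tau> (\<tau> x) = x" "\<tau>' (\<tau>' x) = x" for x by (simp_all add: \<tau>_def \<tau>'_def)
  have comm: "\<tau> (\<tau>' x) = \<tau>' (\<tau> x)" for x by (auto simp: \<tau>_def \<tau>'_def Transposition.transpose_def)
  have perm: "permutation \<pi>" if "\<pi> permutes {..<s}" for \<pi> using that permutation_permutes by blast
  have odd: "\<not> evenperm \<tau>" "\<not> evenperm \<tau>'" by (simp_all add: \<tau>_def \<tau>'_def evenperm_swap)
  have even_real: "realizable s n [(\<pi>, l)]" if "\<pi> permutes {..<s}" "evenperm \<pi>" "inj_on l {..<s}" for \<pi> l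
    using even_mem_rev_group[OF n(1,2,3) that(1,2)] that(3) n(3) by (intro realizable_rev_group) auto
  have even_comp: "evenperm (\<pi> \<circ> \<rho>)" if "\<pi> permutes {..<s}" "\<rho> permutes {..<s}" "\<not> evenperm \<pi>" "\<not> evenperm \<rho>" for \<pi> \<rho>
    using that perm by (simp add: evenperm_comp)
  \<comment> \<open>The heights of \<open>l1\<close>, carried by the strings to their positions
    after \<tau> \<circ> \<pi>1.\<close>
  define \<alpha> where "\<alpha> = l1 \<circ> inv (\<tau> \<circ> \<pi>1)"
  have p1: "\<tau> \<circ> \<pi>1 permutes {..<s}" using p \<pi> permutes_compose by blast
  have \<alpha>: "inj_on \<alpha> {..<s}" unfolding \<alpha>_def by (intro inj_on_permutes_comp l permutes_inv p1)
  have A: "word_equiv s [(\<pi>1, l1)] [(\<tau> \<circ> \<pi>1, l1), (\<tau>, \<alpha>)]"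
  proof -
    have "word_equiv s [(\<tau> \<circ> \<pi>1, l1), (\<tau>, \<alpha>)] [(\<tau> \<circ> (\<tau> \<circ> \<pi>1), l1)]"
    proof (rule word_equiv_comp[OF p1 p(1) l(1)])
      fix x
      have "inv (\<tau> \<circ> \<pi>1) ((\<tau> \<circ> \<pi>1) x) = x" using permutes_inverses(2)[OF p1] .
      then show "\<alpha> ((\<tau> \<circ> \<pi>1) x) = l1 x" by (simp only: \<alpha>_def comp_apply)
    qed
    moreover have "\<tau> \<circ> (\<tau> \<circ> \<pi>1) = \<pi>1" by (simp add: fun_eq_iff)
    ultimately show ?thesis using word_equiv_sym by simp
  qed
  have p2: "\<pi>2 \<circ> \<tau> permutes {..<s}" using p \<pi> permutes_compose by blast
  have B: "word_equiv s [(\<pi>2, l2)] [(\<tau>, l2), (\<pi>2 \<circ> \<tau>, l2 \<circ> \<tau>)]"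
  proof -
    have "word_equiv s [(\<tau>, l2), (\<pi>2 \<circ> \<tau>, l2 \<circ> \<tau>)] [((\<pi>2 \<circ> \<tau>) \<circ> \<tau>, l2)]"
      by (rule word_equiv_comp[OF p(1) p2 l(2)]) simp
    moreover have "(\<pi>2 \<circ> \<tau>) \<circ> \<tau> = \<pi>2" by (simp add: fun_eq_iff)
    ultimately show ?thesis using word_equiv_sym by simp
  qed
  have C: "realizable s n [(\<tau>, \<alpha>), (\<tau>, l2)]"
  proof -
    let ?\<pi> = "\<tau> \<circ> \<tau>'"
    have pp: "?\<pi> permutes {..<s}" using p permutes_compose by blast
    have pe: "evenperm ?\<pi>" by (rule even_comp[OF p odd])
    define \<alpha>1 where "\<alpha>1 = \<alpha> \<circ> ?\<pi>"
    have \<alpha>1: "inj_on \<alpha>1 {..<s}" unfolding \<alpha>1_def by (rule inj_on_permutes_comp[OF \<alpha> pp])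
    \<comment> \<open>A letter for \<tau>' depends only on the order of the heights at 2 and 3. The
      values at 0 and 1 may thus be exchanged there, to obtain the order that \<open>l2\<close>
      prescribes; then the second \<tau> can be given matching heights and merged with
      \<tau>'.\<close>
    define \<alpha>2 where "\<alpha>2 = (if (\<alpha>1 0 < \<alpha>1 1) = (l2 0 < l2 1) then \<alpha>1 else \<alpha>1 \<circ> \<tau>)"
    have \<alpha>2: "inj_on \<alpha>2 {..<s}"
      unfolding \<alpha>2_def using \<alpha>1 inj_on_permutes_comp[OF \<alpha>1 p(1)] by simp
    have s4: "4 \<le> s" using n by simp
    have ne: "\<alpha>1 0 \<noteq> \<alpha>1 1" "l2 0 \<noteq> l2 1" "\<alpha>1 2 \<noteq> \<alpha>1 3"
      using inj_onD[OF \<alpha>1, of 0 1] inj_onD[OF l(2), of 0 1] inj_onD[OF \<alpha>1, of 2 3] s4 by auto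
    have \<tau>v: "\<tau> 0 = 1" "\<tau> 1 = 0" "\<tau> 2 = 2" "\<tau> 3 = 3" "\<tau>' 0 = 0" "\<tau>' 1 = 1"
      by (simp_all add: \<tau>_def \<tau>'_def Transposition.transpose_def)
    have o23: "\<alpha>2 2 = \<alpha>1 2" "\<alpha>2 3 = \<alpha>1 3" by (simp_all add: \<alpha>2_def \<tau>v)
    have o01: "\<alpha>2 0 < \<alpha>2 1 \<and> l2 0 < l2 1 \<or> \<alpha>2 1 < \<alpha>2 0 \<and> l2 1 < l2 0"
    proof (cases "(\<alpha>1 0 < \<alpha>1 1) = (l2 0 < l2 1)")
      case True
      then have "\<alpha>2 = \<alpha>1" by (simp add: \<alpha>2_def)
      then show ?thesis using True ne
          linorder_less_linear[of "\<alpha>1 0" "\<alpha>1 1"] linorder_less_linear[of "l2 0" "l2 1"] by auto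
    next
      case False
      then have "\<alpha>2 0 = \<alpha>1 1" "\<alpha>2 1 = \<alpha>1 0" by (simp_all add: \<alpha>2_def \<tau>v del: One_nat_def)
      then show ?thesis using False ne
          linorder_less_linear[of "\<alpha>1 0" "\<alpha>1 1"] linorder_less_linear[of "l2 0" "l2 1"] by auto
    qed
    have "word_equiv s [(?\<pi>, \<alpha>), (\<tau>', \<alpha>1)] [(\<tau>' \<circ> ?\<pi>, \<alpha>)]"
      by (rule word_equiv_comp[OF pp p(2) \<alpha>]) (simp add: \<alpha>1_def comm)
    moreover have "\<tau>' \<circ> ?\<pi> = \<tau>" by (simp add: fun_eq_iff comm)
    ultimately have 1: "word_equiv s [(\<tau>, \<alpha>)] [(?\<pi>, \<alpha>), (\<tau>', \<alpha>1)]" using word_equiv_sym by simp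
    have 2: "word_equiv s [(\<tau>', \<alpha>1)] [(\<tau>', \<alpha>2)]"
      unfolding \<tau>'_def using s4 o23 ne
      by (intro word_equiv_adjacent_transpose) (auto simp: numeral_3_eq_3 numeral_2_eq_2)
    have 3: "word_equiv s [(\<tau>, l2)] [(\<tau>, \<alpha>2 \<circ> \<tau>')]"
      unfolding \<tau>_def using s4 o01 \<tau>v by (intro word_equiv_adjacent_transpose) auto
    have 4: "word_equiv s [(\<tau>', \<alpha>2), (\<tau>, \<alpha>2 \<circ> \<tau>')] [(?\<pi>, \<alpha>2)]"
      by (rule word_equiv_comp[OF p(2) p(1) \<alpha>2]) simp
    have "word_equiv s ([(\<tau>, \<alpha>)] @ [(\<tau>, l2)]) (([(?\<pi>, \<alpha>)] @ [(\<tau>', \<alpha>1)]) @ [(\<tau>, l2)])"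
      using word_equiv_append[OF 1 word_equiv_refl] unfolding append.simps .
    also have "word_equiv s (([(?\<pi>, \<alpha>)] @ [(\<tau>', \<alpha>1)]) @ [(\<tau>, l2)]) (([(?\<pi>, \<alpha>)] @ [(\<tau>', \<alpha>2)]) @ [(\<tau>, \<alpha>2 \<circ> \<tau>')])"
      by (intro word_equiv_append 2 3 word_equiv_refl)
    also have "word_equiv s (([(?\<pi>, \<alpha>)] @ [(\<tau>', \<alpha>2)]) @ [(\<tau>, \<alpha>2 \<circ> \<tau>')]) ([(?\<pi>, \<alpha>)] @ [(?\<pi>, \<alpha>2)])"
      using word_equiv_append[OF word_equiv_refl[of s "[(?\<pi>, \<alpha>)]"] 4] unfolding append.simps .
    finally show ?thesis
      using realizable_equiv[OF _ realizable_append[OF even_real[OF pp pe \<alpha>] even_real[OF pp pe \<alpha>2]]]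
      unfolding append.simps by blast
  qed
  have "word_equiv s ([(\<pi>1, l1)] @ [(\<pi>2, l2)]) ([(\<tau> \<circ> \<pi>1, l1), (\<tau>, \<alpha>)] @ [(\<tau>, l2), (\<pi>2 \<circ> \<tau>, l2 \<circ> \<tau>)])"
    by (rule word_equiv_append[OF A B])
  moreover have "realizable s n ([(\<tau> \<circ> \<pi>1, l1)] @ ([(\<tau>, \<alpha>), (\<tau>, l2)] @ [(\<pi>2 \<circ> \<tau>, l2 \<circ> \<tau>)]))"
    by (intro realizable_append even_real C p1 p2 l even_comp p \<pi> odd inj_on_permutes_comp[OF l(2) p(1)])
  ultimately show ?thesis unfolding append.simps by (rule realizable_equiv)
qed

lemma realizable_even_length:
  assumes n: "even n" "n \<ge> 2" "n + 2 \<le> s"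
    and "\<And>a. a \<in> set w \<Longrightarrow> fst a permutes {..<s} \<and> \<not> evenperm (fst a) \<and> inj_on (snd a) {..<s}"
    and "even (length w)"
  shows "realizable s n w"
  using assms(4,5)
proof (induction w rule: induct_list012)
  case (3 a b w)
  have "realizable s n [(fst a, snd a), (fst b, snd b)]"
    using 3(3)[of a] 3(3)[of b] by (intro realizable_odd_pair n) auto
  moreover have "realizable s n w" using 3 by simp
  ultimately show ?case using realizable_append[of s n "[a, b]" w] by simp
qed (simp_all add: realizable_Nil)

lemma crossing_word_injective:
  assumes "is_ncrossing_braid s m bs"
  shows "\<exists>w. word_equiv s (map (crossing_letter m) bs) w \<and> length w = length bs \<and>
    (\<forall>a\<in>set w. \<exists>j. j + m \<le> s \<and> fst a = window_rev j m \<and> inj_on (snd a) {..<s})"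
  using assms
proof (induction bs)
  case Nil
  then show ?case by (intro exI[of _ "[]"]) (simp add: word_equiv_refl)
next
  case (Cons b bs)
  obtain j lev where b: "b = (j, lev)" by (rule prod.exhaust)
  have v: "valid_ncrossing s m (j, lev)" and bs: "is_ncrossing_braid s m bs"
    using Cons.prems b by (simp_all add: is_ncrossing_braid_def)
  obtain w where w: "word_equiv s (map (crossing_letter m) bs) w" "length w = length bs"
    "\<forall>a\<in>set w. \<exists>j. j + m \<le> s \<and> fst a = window_rev j m \<and> inj_on (snd a) {..<s}"
    using Cons.IH[OF bs] by blast
  obtain l where l: "inj_on l {..<s}" "word_equiv s [crossing_letter m (j, lev)] [(window_rev j m, l)]"
    using crossing_letter_injective[OF v] by blast
  have "word_equiv s (map (crossing_letter m) (b # bs)) ((window_rev j m, l) # w)"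
    using word_equiv_append[OF l(2) w(1)] by (simp add: b)
  moreover have "j + m \<le> s" using v by (simp add: valid_ncrossing_def)
  ultimately show ?case using w l(1) by (intro exI[of _ "(window_rev j m, l) # w"]) auto
qed

section \<open>Stabilisation\<close>

lemma closed_slab: "closed (slab s k a)"
proof -
  have "slab s k a = (\<Union>p<s. {P. real k \<le> fst (snd P) \<and> fst (snd P) \<le> real k + 1 \<and>
      strand a p (fst (snd P) - real k) = (fst P, snd (snd P))})"
    by (auto simp: slab_def band_def)
  moreover have "closed {P :: R3. real k \<le> fst (snd P) \<and> fst (snd P) \<le> real k + 1 \<and>
      strand a p (fst (snd P) - real k) = (fst P, snd (snd P))}" for p
    by (intro closed_Collect_conj closed_Collect_le closed_Collect_eq continuous_intros
        continuous_on_compose2[OF continuous_strand[of UNIV]]) auto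
  ultimately show ?thesis by (simp only:) (intro closed_UN, auto)
qed

lemma closed_slabs: "closed (slabs s k w)"
  by (induction w arbitrary: k) (auto intro: closed_Un closed_slab)

lemma closed_arcs: "closed (arcs s N)"
  unfolding arcs_def closure_arc_def Let_def by (intro closed_UN ballI closed_Un closed_segment) auto

lemma slab_range:
  assumes "fst a permutes {..<s}" "\<And>p. 0 \<le> snd a p" "(x, y, z) \<in> slab s k a"
  shows "0 \<le> x" "x \<le> real s - 1" "z \<le> 0" "y = real k + 1 \<Longrightarrow> z = 0"
proof -
  obtain p where p: "p < s" "real k \<le> y" "y \<le> real k + 1" "strand a p (y - real k) = (x, z)"
    using assms(3) by (auto simp: slab_def band_def)
  define t where "t = y - real k"
  have t: "0 \<le> t" "t \<le> 1" using p by (auto simp: t_def)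
  have xz: "x = (1 - t) * real p + t * real (fst a p)" "z = - snd a p * tent t"
    using p(4) by (auto simp: strand_def t_def algebra_simps)
  have "fst a p < s" using assms(1) p(1) permutes_in_image by fastforce
  then have b: "real p \<le> real s - 1" "real (fst a p) \<le> real s - 1" using p(1) by linarith+
  show "0 \<le> x" using xz t by simp
  have "x \<le> (1 - t) * (real s - 1) + t * (real s - 1)"
    unfolding xz using b t by (intro add_mono mult_left_mono) auto
  then show "x \<le> real s - 1" by (simp add: algebra_simps)
  have "0 \<le> tent t" using t by (simp add: tent_def)
  then show "z \<le> 0" using xz assms(2)[of p] by simp
  show "z = 0" if "y = real k + 1" using xz(2) that by (simp add: t_def tent_def)
qed

lemma slabs_range:
  assumes "\<And>a. a \<in> set w \<Longrightarrow> fst a permutes {..<s}" "\<And>a p. a \<in> set w \<Longrightarrow> 0 \<le> snd a p"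
    and "(x, y, z) \<in> slabs s k w"
  shows "0 \<le> x \<and> x \<le> real s - 1 \<and> z \<le> 0 \<and> (y = real k + real (length w) \<longrightarrow> z = 0)"
  using assms
proof (induction w arbitrary: k)
  case (Cons a w)
  then consider "(x, y, z) \<in> slab s k a" | "(x, y, z) \<in> slabs s (Suc k) w" by auto
  then show ?case
  proof cases
    case 1
    have a: "fst a permutes {..<s}" "\<And>p. 0 \<le> snd a p" using Cons.prems by auto
    have "z = 0" if "y = real k + real (length (a # w))"
      using slab_range(4)[OF a 1] slab_bounds[OF 1] that by simp
    then show ?thesis using slab_range(1-3)[OF a 1] by blast
  next
    case 2
    have "0 \<le> x \<and> x \<le> real s - 1 \<and> z \<le> 0 \<and> (y = real (Suc k) + real (length w) \<longrightarrow> z = 0)"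
      using Cons.prems by (intro Cons.IH[OF _ _ 2]) auto
    then show ?thesis by simp
  qed
qed simp

lemma slab_Suc:
  assumes "fst a permutes {..<s}" "snd a s = 0"
  shows "slab (Suc s) k a = slab s k a \<union> {(x, y, z). x = real s \<and> z = 0 \<and> real k \<le> y \<and> y \<le> real k + 1}"
proof -
  have "fst a s = s" using assms(1) by (simp add: permutes_not_in)
  then have "strand a s t = (real s, 0)" for t using assms(2) by (simp add: strand_def)
  then show ?thesis by (auto simp: slab_def band_def less_Suc_eq)
qed

text \<open>The inserted point accounts for the empty word, for which the additional vertical string
  degenerates to a point.\<close>

lemma slabs_Suc:
  assumes "\<And>a. a \<in> set w \<Longrightarrow> fst a permutes {..<s} \<and> snd a s = 0"
  shows "insert (real s, real k, 0) (slabs (Suc s) k w) =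
    slabs s k w \<union> {(x, y, z). x = real s \<and> z = 0 \<and> real k \<le> y \<and> y \<le> real k + real (length w)}"
  using assms
proof (induction w arbitrary: k)
  case Nil
  then show ?case by auto
next
  case (Cons a w)
  have IH: "insert (real s, real (Suc k), 0) (slabs (Suc s) (Suc k) w) =
    slabs s (Suc k) w \<union> {(x, y, z). x = real s \<and> z = 0 \<and> real (Suc k) \<le> y \<and> y \<le> real (Suc k) + real (length w)}"
    using Cons.prems by (intro Cons.IH) auto
  have 1: "slab (Suc s) k a = slab s k a \<union> {(x, y, z). x = real s \<and> z = 0 \<and> real k \<le> y \<and> y \<le> real k + 1}"
    using Cons.prems by (intro slab_Suc) auto
  have "insert (real s, real k, 0) (slabs (Suc s) k (a # w)) =
     slab (Suc s) k a \<union> insert (real s, real (Suc k), 0) (slabs (Suc s) (Suc k) w)"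
    by (auto simp: 1)
  also have "\<dots> = slabs s k (a # w) \<union>
     ({(x, y, z). x = real s \<and> z = 0 \<and> real k \<le> y \<and> y \<le> real k + 1} \<union>
     {(x, y, z). x = real s \<and> z = 0 \<and> real (Suc k) \<le> y \<and> y \<le> real (Suc k) + real (length w)})"
    unfolding 1 IH by auto
  also have "({(x, y, z). x = real s \<and> z = 0 \<and> real k \<le> y \<and> y \<le> real k + 1} \<union>
     {(x, y, z). x = real s \<and> z = 0 \<and> real (Suc k) \<le> y \<and> y \<le> real (Suc k) + real (length w)}) =
     {(x, y, z). x = real s \<and> z = 0 \<and> real k \<le> y \<and> y \<le> real k + real (length (a # w))}"
    by auto
  finally show ?case .
qed

text \<open>The two strings of the added crossing run from \<open>P0\<close> via \<open>d\<close> to \<open>P\<close> and from \<open>S\<close> via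
  \<open>c\<close> to \<open>P1\<close>, and the outermost arc from \<open>P\<close> to \<open>S\<close> bounds a disc in front of everything else.\<close>
lemma isotopic_stabilisation:
  fixes K :: "R3 set" and X Y D :: real
  assumes K: "closed K"
    and box: "\<And>x y z. (x, y, z) \<in> K \<Longrightarrow> z \<le> 0 \<and> - D < x \<and> x < X \<and> - D < y \<and> y < Y + 1 + D"
    and corner: "\<And>x y z. (x, y, z) \<in> K \<Longrightarrow> X - 1 \<le> x \<Longrightarrow> Y \<le> y \<Longrightarrow> y \<le> Y + 1 \<Longrightarrow>
        x = X - 1 \<and> z = 0 \<and> (y = Y \<or> y = Y + 1)"
    and pos: "0 \<le> Y" "1 \<le> X" "1 < D"
  defines "P0 \<equiv> (X - 1, Y, 0)" and "P1 \<equiv> (X - 1, Y + 1, 0)" and "S \<equiv> (X, Y, 0)" and "P \<equiv> (X, Y + 1, 0)"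
    and "d \<equiv> (X - 1/2, Y + 1/2, -1)" and "c \<equiv> (X - 1/2, Y + 1/2, -2)"
  shows "isotopic (K \<union> closed_segment P0 d \<union> closed_segment d P \<union> closed_segment S c \<union> closed_segment c P1 \<union>
      polyline [P, (X, Y + 1 + D, 0), (- D, Y + 1 + D, 0), (- D, - D, 0), (X, - D, 0), S])
    (K \<union> closed_segment P0 P1)"
proof -
  have segs: "closed_segment P0 d = {(x, y, z). Y \<le> y \<and> y \<le> Y + 1/2 \<and> x = X - 1 + (y - Y) \<and> z = - 2 * (y - Y)}"
    "closed_segment d P = {(x, y, z). Y + 1/2 \<le> y \<and> y \<le> Y + 1 \<and> x = X - 1 + (y - Y) \<and> z = 2 * (y - Y) - 2}"
    "closed_segment S c = {(x, y, z). Y \<le> y \<and> y \<le> Y + 1/2 \<and> x = X - (y - Y) \<and> z = - 4 * (y - Y)}"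
    "closed_segment c P1 = {(x, y, z). Y + 1/2 \<le> y \<and> y \<le> Y + 1 \<and> x = X - (y - Y) \<and> z = 4 * (y - Y) - 4}"
    unfolding P0_def d_def P_def S_def c_def P1_def
    by (subst closed_segment_graph_y, simp, (auto simp: field_simps)[1])+
  have seg_P0d: "Y \<le> y" "y \<le> Y + 1/2" "x = X - 1 + (y - Y)" "z = - 2 * (y - Y)"
    if "(x, y, z) \<in> closed_segment P0 d" for x y z using that unfolding segs by simp_all
  have seg_Sc: "Y \<le> y" "y \<le> Y + 1/2" "x = X - (y - Y)" "z = - 4 * (y - Y)"
    if "(x, y, z) \<in> closed_segment S c" for x y z using that unfolding segs by simp_all
  have seg_cP1: "Y + 1/2 \<le> y" "y \<le> Y + 1" "x = X - (y - Y)" "z = 4 * (y - Y) - 4"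
    if "(x, y, z) \<in> closed_segment c P1" for x y z using that unfolding segs by simp_all
  define A B C E :: R3 where "A = (X, Y + 1 + D, 0)" and "B = (- D, Y + 1 + D, 0)"
    and "C = (- D, - D, 0)" and "E = (X, - D, 0)"
  note pts = P_def S_def A_def B_def C_def E_def
  have edges: "closed_segment P A = {(x, y, z). x = X \<and> z = 0 \<and> Y + 1 \<le> y \<and> y \<le> Y + 1 + D}"
    "closed_segment A B = {(x, y, z). - D \<le> x \<and> x \<le> X \<and> y = Y + 1 + D \<and> z = 0}"
    "closed_segment B C = {(x, y, z). x = - D \<and> z = 0 \<and> - D \<le> y \<and> y \<le> Y + 1 + D}"
    "closed_segment C E = {(x, y, z). - D \<le> x \<and> x \<le> X \<and> y = - D \<and> z = 0}"
    "closed_segment E S = {(x, y, z). x = X \<and> z = 0 \<and> - D \<le> y \<and> y \<le> Y}"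
    "closed_segment P S = {(x, y, z). x = X \<and> z = 0 \<and> Y \<le> y \<and> y \<le> Y + 1}"
    using pos unfolding pts closed_segment_commute[of "(X, Y + 1 + D, 0)" "(- D, Y + 1 + D, 0)"]
      closed_segment_commute[of "(- D, Y + 1 + D, 0)" "(- D, - D, 0)"]
      closed_segment_commute[of "(X, Y + 1, 0)" "(X, Y, 0)"]
    by (auto simp: closed_segment_graph_x closed_segment_graph_y)
  let ?K1 = "K \<union> closed_segment P0 d \<union> closed_segment d P \<union> closed_segment S c \<union> closed_segment c P1"
  have K1: "z \<le> 0 \<and> (- D < x \<and> x < X \<and> - D < y \<and> y < Y + 1 + D \<or> (x, y, z) = P \<or> (x, y, z) = S)"
    if "(x, y, z) \<in> ?K1" for x y z
  proof -
    from that consider "(x, y, z) \<in> K" | "(x, y, z) \<in> closed_segment P0 d" | "(x, y, z) \<in> closed_segment d P"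
      | "(x, y, z) \<in> closed_segment S c" | "(x, y, z) \<in> closed_segment c P1" by blast
    then show ?thesis
    proof cases
      case 1
      then show ?thesis using box by blast
    next
      case 2
      then show ?thesis using pos unfolding segs by auto
    next
      case 3
      then show ?thesis using pos unfolding segs by (auto simp: P_def)
    next
      case 4
      then show ?thesis using pos unfolding segs by (auto simp: S_def)
    next
      case 5
      then show ?thesis using pos unfolding segs by auto
    qed
  qed
  \<comment> \<open>Four planes that contain the outer rectangle; the rest of the link touches them
    only in P and S.\<close>
  define F where "F = {(x, y, z :: real). x = X \<or> x = - D \<or> y = - D \<or> y = Y + 1 + D}"
  have K1_out: "?K1 \<inter> G \<subseteq> {P, S}" if "G \<subseteq> F" for G
  proof
    fix Q assume Q: "Q \<in> ?K1 \<inter> G"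
    obtain x y z where xyz: "Q = (x, y, z)" by (rule prod_cases3)
    have "(x, y, z) \<in> ?K1" using Q xyz by (simp only: Int_iff)
    note K1[OF this]
    moreover have "(x, y, z) \<in> F" using Q that xyz by blast
    ultimately have "(x, y, z) = P \<or> (x, y, z) = S" unfolding F_def by auto
    then show "Q \<in> {P, S}" using xyz by blast
  qed
  have edges_F: "closed_segment P A \<subseteq> F" "closed_segment A B \<subseteq> F" "closed_segment B C \<subseteq> F"
    "closed_segment C E \<subseteq> F" "closed_segment E S \<subseteq> F" "closed_segment P S \<subseteq> F"
    unfolding edges F_def by auto
  have P_off: "P \<notin> closed_segment A B" "P \<notin> closed_segment B C" "P \<notin> closed_segment C E" "P \<notin> closed_segment E S"
    and S_off: "S \<notin> closed_segment P A" "S \<notin> closed_segment A B" "S \<notin> closed_segment B C" "S \<notin> closed_segment C E"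
    using pos unfolding edges by (auto simp: P_def S_def)
  have "isotopic (?K1 \<union> polyline (P # A # [B, C, E, S])) (?K1 \<union> closed_segment P (last (A # [B, C, E, S])))"
  proof (rule isotopic_polyline_collapse)
    show "closed ?K1" by (intro closed_Un K closed_segment)
    show "height Q \<le> 0" if "Q \<in> ?K1" for Q
      using K1[of "fst Q" "fst (snd Q)" "snd (snd Q)"] that by simp
    show "height q = 0" if "q \<in> set (P # A # [B, C, E, S])" for q
      using that by (auto simp: pts)
    show "P \<noteq> A" "P \<noteq> last (A # [B, C, E, S])" using pos by (auto simp: pts)
    show "?K1 \<inter> closed_segment P A \<subseteq> {P, A}" using K1_out[OF edges_F(1)] S_off(1) by blast
    show "?K1 \<inter> closed_segment P (last (A # [B, C, E, S])) \<subseteq> {P, last (A # [B, C, E, S])}"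
      using K1_out[OF edges_F(6)] by simp
    show "polyline (A # [B, C, E, S]) \<inter> closed_segment P A \<subseteq> {P, A}"
      using pos unfolding polyline.simps edges by (auto simp: pts)
    have off: "?K1 \<inter> closed_segment A B \<subseteq> {B}" "?K1 \<inter> closed_segment B C \<subseteq> {C}"
      "?K1 \<inter> closed_segment C E \<subseteq> {E}" "?K1 \<inter> closed_segment E S \<subseteq> {S}"
      using K1_out[OF edges_F(2)] K1_out[OF edges_F(3)] K1_out[OF edges_F(4)] K1_out[OF edges_F(5)] P_off S_off
      by blast+
    show "polyline_ok ?K1 P (A # [B, C, E, S])"
      unfolding polyline_ok.simps
    proof (intro conjI off P_off)
      show "A \<noteq> B" "B \<noteq> C" "C \<noteq> E" "E \<noteq> S" using pos by (auto simp: pts)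
      show "polyline [B, C, E, S] \<inter> closed_segment A B \<subseteq> {B}" "polyline [C, E, S] \<inter> closed_segment B C \<subseteq> {C}"
        "polyline [E, S] \<inter> closed_segment C E \<subseteq> {E}" "polyline [S] \<inter> closed_segment E S \<subseteq> {S}"
        using pos unfolding polyline.simps edges by (auto simp: pts)
    qed simp_all
  qed
  also have "?K1 \<union> closed_segment P (last (A # [B, C, E, S])) =
     (K \<union> closed_segment P0 d \<union> closed_segment S c \<union> closed_segment c P1) \<union> (closed_segment d P \<union> closed_segment P S)"
    by auto
  \<comment> \<open>What remains is the path P0, d, P, S, c, P1. Its inner vertices are removed in
    the order P, d, S, c. Each triangle projects into the cell where \<open>corner\<close> allows at
    most points of \<open>K\<close> above P0 and P1, and the different depths of d and c keep it
    away from the other segments of the path.\<close>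
  also have "isotopic \<dots> ((K \<union> closed_segment P0 d \<union> closed_segment S c \<union> closed_segment c P1) \<union> closed_segment d S)"
  proof (intro isotopic_sym[OF triangle_move])
    show "(K \<union> closed_segment P0 d \<union> closed_segment S c \<union> closed_segment c P1) \<inter> convex hull {d, S, P} \<subseteq> {d, S}"
    proof
      fix Q assume Q: "Q \<in> (K \<union> closed_segment P0 d \<union> closed_segment S c \<union> closed_segment c P1) \<inter> convex hull {d, S, P}"
      obtain x y z where xyz: "Q = (x, y, z)" by (rule prod_cases3)
      have "(x, y, z) \<in> convex hull {d, S, P}" using Q unfolding xyz Int_iff by (rule conjunct2)
      then obtain u v where uv0: "0 \<le> u" "0 \<le> v" "u + v \<le> 1"
        and Q_eq: "(x, y, z) = d + u *\<^sub>R (S - d) + v *\<^sub>R (P - d)"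
        unfolding convex_hull_3_alt by blast
      have uv1: "2 * x = 2 * X - 1 + u + v" "2 * y = 2 * Y + 1 + v - u" "z = -1 + u + v"
        using Q_eq unfolding d_def S_def P_def by (simp_all add: algebra_simps)
      note uv = uv0 uv1
      have cor: "X - 1 \<le> x" "Y \<le> y" "y \<le> Y + 1" using uv by linarith+
      have lt: "X - 1 < x" using uv by linarith
      have "(x, y, z) \<notin> K"
      proof
        assume "(x, y, z) \<in> K"
        then have "x = X - 1" using corner cor by blast
        then show False using lt by simp
      qed
      moreover have "(x, y, z) \<in> K \<or> (x, y, z) \<in> closed_segment P0 d \<or> (x, y, z) \<in> closed_segment S c \<or>
          (x, y, z) \<in> closed_segment c P1" using Q unfolding xyz Int_iff Un_iff by argo
      ultimately consider "(x, y, z) \<in> closed_segment P0 d" | "(x, y, z) \<in> closed_segment S c" | "(x, y, z) \<in> closed_segment c P1"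
        by argo
      then have "x = X - 1/2 \<and> y = Y + 1/2 \<and> z = -1 \<or> x = X \<and> y = Y \<and> z = 0"
      proof cases
        case 1
        have "x = X - 1/2" "y = Y + 1/2" "z = -1" using seg_P0d[OF 1] uv by linarith+
        then show ?thesis by blast
      next
        case 2
        have "2 * (y - Y) = 1 - u - v" using seg_Sc(3)[OF 2] uv(4) by simp
        moreover have "4 * (y - Y) = 1 - u - v" using seg_Sc(4)[OF 2] uv(6) by simp
        ultimately have "y = Y" by simp
        then show ?thesis using seg_Sc(3,4)[OF 2] by simp
      next
        case 3
        have "2 * (y - Y) = 1 - u - v" using seg_cP1(3)[OF 3] uv(4) by simp
        moreover have "4 * (y - Y) = 3 + u + v" using seg_cP1(4)[OF 3] uv(6) by simp
        ultimately have False using uv(1,2) by argo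
        then show ?thesis ..
      qed
      then show "Q \<in> {d, S}" unfolding xyz d_def S_def by blast
    qed
    fix x y :: real assume "x *\<^sub>R (S - d) + y *\<^sub>R (P - d) = 0"
    then show "x = 0 \<and> y = 0" by (auto simp: S_def P_def d_def zero_prod_def)
  qed (intro closed_Un K closed_segment)
  also have "(K \<union> closed_segment P0 d \<union> closed_segment S c \<union> closed_segment c P1) \<union> closed_segment d S =
     (K \<union> closed_segment S c \<union> closed_segment c P1) \<union> (closed_segment P0 d \<union> closed_segment d S)" by auto
  also have "isotopic \<dots> ((K \<union> closed_segment S c \<union> closed_segment c P1) \<union> closed_segment P0 S)"
  proof (intro isotopic_sym[OF triangle_move])
    show "(K \<union> closed_segment S c \<union> closed_segment c P1) \<inter> convex hull {P0, S, d} \<subseteq> {P0, S}"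
    proof
      fix Q assume Q: "Q \<in> (K \<union> closed_segment S c \<union> closed_segment c P1) \<inter> convex hull {P0, S, d}"
      obtain x y z where xyz: "Q = (x, y, z)" by (rule prod_cases3)
      have "(x, y, z) \<in> convex hull {P0, S, d}" using Q unfolding xyz Int_iff by (rule conjunct2)
      then obtain u v where uv0: "0 \<le> u" "0 \<le> v" "u + v \<le> 1"
        and Q_eq: "(x, y, z) = P0 + u *\<^sub>R (S - P0) + v *\<^sub>R (d - P0)"
        unfolding convex_hull_3_alt by blast
      have uv1: "2 * x = 2 * X - 2 + 2 * u + v" "2 * y = 2 * Y + v" "z = - v"
        using Q_eq unfolding P0_def S_def d_def by (simp_all add: algebra_simps)
      note uv = uv0 uv1
      have cor: "X - 1 \<le> x" "Y \<le> y" "y \<le> Y + 1" using uv by linarith+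
      from Q consider "(x, y, z) \<in> K" | "(x, y, z) \<in> closed_segment S c" | "(x, y, z) \<in> closed_segment c P1"
        unfolding xyz Int_iff Un_iff by argo
      then have "x = X - 1 \<and> y = Y \<and> z = 0 \<or> x = X \<and> y = Y \<and> z = 0"
      proof cases
        case 1
        have "x = X - 1" "z = 0" using corner[OF 1 cor] by blast+
        moreover have "y = Y" using \<open>z = 0\<close> uv by linarith
        ultimately show ?thesis by blast
      next
        case 2
        have "4 * (y - Y) = v" using seg_Sc(4)[OF 2] uv(6) by simp
        moreover have "2 * (y - Y) = v" using uv(5) by simp
        ultimately have "y = Y" by simp
        then show ?thesis using seg_Sc(3,4)[OF 2] by simp
      next
        case 3
        have "4 * (y - Y) = 4 - v" using seg_cP1(4)[OF 3] uv(6) by simp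
        moreover have "2 * (y - Y) = v" using uv(5) by simp
        ultimately have False using uv(1,3) by argo
        then show ?thesis ..
      qed
      then show "Q \<in> {P0, S}" unfolding xyz P0_def S_def by blast
    qed
    fix x y :: real assume "x *\<^sub>R (S - P0) + y *\<^sub>R (d - P0) = 0"
    then show "x = 0 \<and> y = 0" by (auto simp: S_def P0_def d_def zero_prod_def)
  qed (intro closed_Un K closed_segment)
  also have "(K \<union> closed_segment S c \<union> closed_segment c P1) \<union> closed_segment P0 S =
     (K \<union> closed_segment c P1) \<union> (closed_segment P0 S \<union> closed_segment S c)" by auto
  also have "isotopic \<dots> ((K \<union> closed_segment c P1) \<union> closed_segment P0 c)"
  proof (intro isotopic_sym[OF triangle_move])
    show "(K \<union> closed_segment c P1) \<inter> convex hull {P0, c, S} \<subseteq> {P0, c}"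
    proof
      fix Q assume Q: "Q \<in> (K \<union> closed_segment c P1) \<inter> convex hull {P0, c, S}"
      obtain x y z where xyz: "Q = (x, y, z)" by (rule prod_cases3)
      have "(x, y, z) \<in> convex hull {P0, c, S}" using Q unfolding xyz Int_iff by (rule conjunct2)
      then obtain u v where uv0: "0 \<le> u" "0 \<le> v" "u + v \<le> 1"
        and Q_eq: "(x, y, z) = P0 + u *\<^sub>R (c - P0) + v *\<^sub>R (S - P0)"
        unfolding convex_hull_3_alt by blast
      have uv1: "2 * x = 2 * X - 2 + u + 2 * v" "2 * y = 2 * Y + u" "z = - 2 * u"
        using Q_eq unfolding P0_def S_def c_def by (simp_all add: algebra_simps)
      note uv = uv0 uv1
      have cor: "X - 1 \<le> x" "Y \<le> y" "y \<le> Y + 1" using uv by linarith+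
      from Q consider "(x, y, z) \<in> K" | "(x, y, z) \<in> closed_segment c P1"
        unfolding xyz Int_iff Un_iff by argo
      then have "x = X - 1 \<and> y = Y \<and> z = 0 \<or> x = X - 1/2 \<and> y = Y + 1/2 \<and> z = -2"
      proof cases
        case 1
        have "x = X - 1" "z = 0" using corner[OF 1 cor] by blast+
        moreover have "y = Y" using \<open>z = 0\<close> uv by linarith
        ultimately show ?thesis by blast
      next
        case 2
        have "x = X - 1/2" "y = Y + 1/2" "z = -2" using seg_cP1[OF 2] uv by linarith+
        then show ?thesis by blast
      qed
      then show "Q \<in> {P0, c}" unfolding xyz P0_def c_def by blast
    qed
    fix x y :: real assume "x *\<^sub>R (c - P0) + y *\<^sub>R (S - P0) = 0"
    then show "x = 0 \<and> y = 0" by (auto simp: S_def P0_def c_def zero_prod_def)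
  qed (intro closed_Un K closed_segment)
  also have "(K \<union> closed_segment c P1) \<union> closed_segment P0 c =
     K \<union> (closed_segment P0 c \<union> closed_segment c P1)" by auto
  also have "isotopic \<dots> (K \<union> closed_segment P0 P1)"
  proof (intro isotopic_sym[OF triangle_move] K)
    show "K \<inter> convex hull {P0, P1, c} \<subseteq> {P0, P1}"
    proof
      fix Q assume Q: "Q \<in> K \<inter> convex hull {P0, P1, c}"
      obtain x y z where xyz: "Q = (x, y, z)" by (rule prod_cases3)
      have "(x, y, z) \<in> convex hull {P0, P1, c}" using Q unfolding xyz Int_iff by (rule conjunct2)
      then obtain u v where uv0: "0 \<le> u" "0 \<le> v" "u + v \<le> 1"
        and Q_eq: "(x, y, z) = P0 + u *\<^sub>R (P1 - P0) + v *\<^sub>R (c - P0)"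
        unfolding convex_hull_3_alt by blast
      have uv1: "2 * x = 2 * X - 2 + v" "2 * y = 2 * Y + 2 * u + v"
        using Q_eq unfolding P0_def P1_def c_def by (simp_all add: algebra_simps)
      note uv = uv0 uv1
      have "X - 1 \<le> x" "Y \<le> y" "y \<le> Y + 1" using uv by linarith+
      moreover have "(x, y, z) \<in> K" using Q unfolding xyz by blast
      ultimately have "x = X - 1 \<and> z = 0 \<and> (y = Y \<or> y = Y + 1)" using corner by blast
      then show "Q \<in> {P0, P1}" unfolding xyz P0_def P1_def by blast
    qed
    fix x y :: real assume "x *\<^sub>R (P1 - P0) + y *\<^sub>R (c - P0) = 0"
    then show "x = 0 \<and> y = 0" by (auto simp: P1_def P0_def c_def zero_prod_def)
  qed
  finally show ?thesis unfolding A_def B_def C_def E_def .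
qed

text \<open>The level map \<open>Suc\<close> puts the strings s - 1 and s at levels 1 and 2, the
  depths of d and c in \<open>isotopic_stabilisation\<close>. Once the loop is gone, the last slab
  contains straight strings only. This is the letter of a crossing of width 0, and keeping it leaves
  the other closure arcs in place.\<close>

lemma word_closure_stabilisation:
  assumes s: "1 \<le> s"
    and w: "\<And>a. a \<in> set w \<Longrightarrow> fst a permutes {..<s} \<and> snd a s = 0" "\<And>a p. a \<in> set w \<Longrightarrow> 0 \<le> snd a p"
  shows "isotopic (word_closure (Suc s) (w @ [crossing_letter 2 (s - 1, Suc)]))
    (word_closure s (w @ [crossing_letter 0 (0, Suc)]))"
proof -
  define N where "N = length w"
  define X where "X = real s"
  define Y where "Y = real N"
  define D where "D = real s + 1"
  have rs: "real (s - 1) = X - 1" using s by (simp add: X_def of_nat_diff)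
  define U where "U = (\<Union>p<s - 1. closed_segment (real p, Y, 0 :: real) (real p, Y + 1, 0))"
  define K where "K = slabs s 0 w \<union> U \<union> arcs s (Suc N)"
  let ?A0 = "(X - 1, Y, 0 :: real)" and ?A1 = "(X - 1, Y + 1, 0 :: real)" and ?S = "(X, Y, 0 :: real)"
    and ?T = "(X, Y + 1, 0 :: real)" and ?d = "(X - 1/2, Y + 1/2, -1 :: real)" and ?c = "(X - 1/2, Y + 1/2, -2 :: real)"
  have Umem: "(x, y, z) \<in> U \<longleftrightarrow> (\<exists>p<s - 1. x = real p \<and> z = 0 \<and> Y \<le> y \<and> y \<le> Y + 1)" for x y z
    by (auto simp: U_def closed_segment_graph_y)
  have slabs_w: "0 \<le> x \<and> x \<le> X - 1 \<and> z \<le> 0 \<and> (y = Y \<longrightarrow> z = 0)" "0 \<le> y" "y \<le> Y"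
    if "(x, y, z) \<in> slabs s 0 w" for x y z
    using slabs_range[of w s x y z 0] slabs_bounds[of x y z s 0 w] w that by (auto simp: X_def Y_def N_def)
  have low: "{..<s} = insert (s - 1) {..<s - 1}" using s by auto
  have s1: "slab (Suc s) N (crossing_letter 2 (s - 1, Suc)) =
      U \<union> closed_segment ?A0 ?d \<union> closed_segment ?d ?T \<union> closed_segment ?S ?c \<union> closed_segment ?c ?A1"
  proof -
    define F where "F p = (if s - 1 \<le> p \<and> p < s - 1 + 2 then
         (let c = (real (s - 1) + (real 2 - 1) / 2, real N + 1/2, - real (Suc (p - (s - 1))))
          in closed_segment (real p, real N, 0) c \<union>
             closed_segment c (real (2 * (s - 1) + 2 - 1 - p), real N + 1, 0))
       else closed_segment (real p, real N, 0) (real p, real N + 1, 0))" for p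
    have "crossing_set (Suc s) 2 N (s - 1, Suc) = (\<Union>p<Suc s. F p)"
      by (simp only: crossing_set_def prod.case F_def)
    also have "{..<Suc s} = insert s (insert (s - 1) {..<s - 1})" using s by auto
    also have "(\<Union>p\<in>insert s (insert (s - 1) {..<s - 1}). F p) = (\<Union>p<s - 1. F p) \<union> F (s - 1) \<union> F s"
      by auto
    also have "(\<Union>p<s - 1. F p) = U"
      unfolding U_def by (rule SUP_cong) (simp_all add: F_def Y_def)
    also have "F (s - 1) = closed_segment ?A0 ?d \<union> closed_segment ?d ?T"
    proof -
      have a: "2 * (s - 1) + 2 - 1 - (s - 1) = s" using s by arith
      show ?thesis unfolding F_def Let_def a rs X_def[symmetric] Y_def[symmetric] by simp
    qed
    also have "F s = closed_segment ?S ?c \<union> closed_segment ?c ?A1"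
    proof -
      have "real (2 * (s - 1) + 2 - 1 - s) = X - 1" "s - (s - 1) = 1" "s - 1 \<le> s \<and> s < s - 1 + 2"
        using s by (auto simp: X_def of_nat_diff)
      then show ?thesis unfolding F_def Let_def by (simp add: rs X_def[symmetric] Y_def[symmetric])
    qed
    finally show ?thesis unfolding crossing_set_eq_slab by (simp only: Un_assoc)
  qed
  have s2: "slab s N (crossing_letter 0 (0, Suc)) = U \<union> closed_segment ?A0 ?A1"
    unfolding crossing_set_eq_slab[symmetric] crossing_set_def prod.case U_def low
    by (simp add: rs[simplified] Y_def[symmetric] Un_ac)
  have arc: "closure_arc (Suc N) s \<union> {(x, y, z). x = real s \<and> z = 0 \<and> 0 \<le> y \<and> y \<le> real N} =
      polyline [?T, (X, Y + 1 + D, 0), (- D, Y + 1 + D, 0), (- D, - D, 0), (X, - D, 0), ?S]"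
  proof -
    have Y1: "real (Suc N) = Y + 1" by (simp add: Y_def)
    have pos: "- D < 0" "- D < Y" by (auto simp: Y_def D_def)
    have "closure_arc (Suc N) s = closed_segment ?T (X, Y + 1 + D, 0) \<union>
        closed_segment (X, Y + 1 + D, 0) (- D, Y + 1 + D, 0) \<union> closed_segment (- D, Y + 1 + D, 0) (- D, - D, 0) \<union>
        closed_segment (- D, - D, 0) (X, - D, 0) \<union> closed_segment (X, - D, 0) (X, 0, 0)"
      by (simp only: closure_arc_def Let_def X_def D_def Y1)
    moreover have "closed_segment (X, - D, 0) (X, 0, 0) \<union> {(x, y, z). x = X \<and> z = 0 \<and> 0 \<le> y \<and> y \<le> Y} =
        closed_segment (X, - D, 0) ?S"
      unfolding closed_segment_graph_y[OF pos(1)] closed_segment_graph_y[OF pos(2)]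
      using pos by (auto simp: Y_def)
    ultimately show ?thesis
      unfolding polyline.simps X_def[symmetric] Y_def[symmetric] by (simp only: Un_assoc Un_empty_right)
  qed
  have arcs1: "arcs (Suc s) (Suc N) = arcs s (Suc N) \<union> closure_arc (Suc N) s"
    by (auto simp: arcs_def lessThan_Suc)
  have V: "{(x, y, z). x = real s \<and> z = 0 \<and> real 0 \<le> y \<and> y \<le> real 0 + real (length w)} =
      {(x, y, z). x = real s \<and> z = (0 :: real) \<and> 0 \<le> y \<and> y \<le> real N}"
    by (simp add: N_def)
  have pt: "(real s, real 0, 0) \<in> closure_arc (Suc N) s" by (simp add: mem_closure_arc)
  have "word_closure (Suc s) (w @ [crossing_letter 2 (s - 1, Suc)]) =
      slabs (Suc s) 0 w \<union> slab (Suc s) N (crossing_letter 2 (s - 1, Suc)) \<union> (arcs s (Suc N) \<union> closure_arc (Suc N) s)"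
    unfolding word_closure_def slabs_append arcs1[symmetric] by (simp add: N_def)
  also have "\<dots> =
      insert (real s, real 0, 0) (slabs (Suc s) 0 w) \<union> slab (Suc s) N (crossing_letter 2 (s - 1, Suc)) \<union>
      (arcs s (Suc N) \<union> closure_arc (Suc N) s)"
    using pt by blast
  also have "insert (real s, real 0, 0) (slabs (Suc s) 0 w) =
      slabs s 0 w \<union> {(x, y, z). x = real s \<and> z = 0 \<and> real 0 \<le> y \<and> y \<le> real 0 + real (length w)}"
    using w(1) by (rule slabs_Suc)
  also have "slabs s 0 w \<union> {(x, y, z). x = real s \<and> z = 0 \<and> real 0 \<le> y \<and> y \<le> real 0 + real (length w)} \<union>
      slab (Suc s) N (crossing_letter 2 (s - 1, Suc)) \<union> (arcs s (Suc N) \<union> closure_arc (Suc N) s) =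
      K \<union> closed_segment ?A0 ?d \<union> closed_segment ?d ?T \<union> closed_segment ?S ?c \<union> closed_segment ?c ?A1 \<union>
      polyline [?T, (X, Y + 1 + D, 0), (- D, Y + 1 + D, 0), (- D, - D, 0), (X, - D, 0), ?S]"
    unfolding V arc[symmetric] s1 K_def by (simp only: Un_ac)
  also have "isotopic \<dots> (K \<union> closed_segment ?A0 ?A1)"
  proof (rule isotopic_stabilisation)
    show "closed K" unfolding K_def U_def
      by (intro closed_Un closed_slabs closed_arcs closed_UN ballI) auto
    show "z \<le> 0 \<and> - D < x \<and> x < X \<and> - D < y \<and> y < Y + 1 + D" if "(x, y, z) \<in> K" for x y z
    proof -
      from that consider "(x, y, z) \<in> slabs s 0 w" | "(x, y, z) \<in> U" | "(x, y, z) \<in> arcs s (Suc N)"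
        unfolding K_def by blast
      then show ?thesis
      proof cases
        case 1
        then show ?thesis using slabs_w[of x y z] by (auto simp: D_def X_def)
      next
        case 2
        then show ?thesis unfolding Umem by (auto simp: D_def X_def Y_def)
      next
        case 3
        then obtain p where "p < s" "(x, y, z) \<in> closure_arc (Suc N) p" unfolding arcs_def by blast
        then show ?thesis by (auto simp: mem_closure_arc D_def X_def Y_def)
      qed
    qed
    show "x = X - 1 \<and> z = 0 \<and> (y = Y \<or> y = Y + 1)"
      if "(x, y, z) \<in> K" "X - 1 \<le> x" "Y \<le> y" "y \<le> Y + 1" for x y z
    proof -
      from that(1) consider "(x, y, z) \<in> slabs s 0 w" | "(x, y, z) \<in> U" | "(x, y, z) \<in> arcs s (Suc N)"
        unfolding K_def by blast
      then show ?thesis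
      proof cases
        case 1
        then show ?thesis using slabs_w[of x y z] that by auto
      next
        case 2
        then obtain p where "p < s - 1" "x = real p" unfolding Umem by blast
        then show ?thesis using that(2) rs by linarith
      next
        case 3
        then obtain p where p: "p < s" "(x, y, z) \<in> closure_arc (Suc N) p" unfolding arcs_def by blast
        have "real p \<le> X - 1" "0 \<le> Y" "0 \<le> X - 1" using p(1) s by (auto simp: X_def Y_def)
        then show ?thesis using p(2) that unfolding mem_closure_arc by (auto simp: Y_def)
      qed
    qed
    show "0 \<le> Y" "1 \<le> X" "1 < D" using s by (auto simp: Y_def X_def D_def)
  qed
  also have "K \<union> closed_segment ?A0 ?A1 = word_closure s (w @ [crossing_letter 0 (0, Suc)])"
    unfolding word_closure_def slabs_append K_def using s2 by (auto simp: N_def)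
  finally show ?thesis .
qed


text \<open>The straight slab is absorbed into the letter before it, as a composition with the
  identity.\<close>

lemma word_equiv_drop_identity:
  assumes "is_ncrossing_braid s m bs" "bs \<noteq> []"
  shows "word_equiv s (map (crossing_letter m) bs @ [crossing_letter 0 (0, Suc)]) (map (crossing_letter m) bs)"
proof -
  obtain cs b where bs: "bs = cs @ [b]" using assms(2) by (metis rev_exhaust)
  obtain j lev where b: "b = (j, lev)" by (rule prod.exhaust)
  have v: "valid_ncrossing s m (j, lev)" using assms(1) by (simp add: bs b is_ncrossing_braid_def)
  then have jm: "j + m \<le> s" by (simp add: valid_ncrossing_def)
  let ?r = "window_rev j m" and ?e = "window_rev 0 0"
  obtain l where l: "inj_on l {..<s}" "word_equiv s [crossing_letter m (j, lev)] [(?r, l)]"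
    using crossing_letter_injective[OF v] by blast
  have e: "?e p = p" for p by (simp add: window_rev_def)
  have ep: "?e permutes {..<s}" by (rule window_rev_permutes) simp
  have 1: "word_equiv s [crossing_letter 0 (0, Suc)] [(?e, l \<circ> ?r)]"
    unfolding crossing_letter_def fst_conv snd_conv by (rule word_equiv_levels[OF ep]) (simp add: e)
  have "word_equiv s [(?r, l), (?e, l \<circ> ?r)] [(?e \<circ> ?r, l)]"
    by (rule word_equiv_comp[OF window_rev_permutes[OF jm] ep l(1)]) (simp add: window_rev_involution)
  moreover have "?e \<circ> ?r = ?r" by (simp add: fun_eq_iff e)
  ultimately have 2: "word_equiv s ([(?r, l)] @ [(?e, l \<circ> ?r)]) [(?r, l)]" by simp
  have "word_equiv s ([crossing_letter m b] @ [crossing_letter 0 (0, Suc)]) ([(?r, l)] @ [(?e, l \<circ> ?r)])"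
    unfolding b by (rule word_equiv_append[OF l(2) 1])
  also note 2
  also have "word_equiv s [(?r, l)] [crossing_letter m b]" using l(2) unfolding b by (rule word_equiv_sym)
  finally show ?thesis
    using word_equiv_append[OF word_equiv_refl[of s "map (crossing_letter m) cs"]] by (simp add: bs)
qed

section \<open>Comparing the two braid indices\<close>

lemma realizable_letters:
  "(\<And>a. a \<in> set w \<Longrightarrow> realizable s n [a]) \<Longrightarrow> realizable s n w"
proof (induction w)
  case (Cons a w)
  then show ?case using realizable_append[of s n "[a]" w] by simp
qed (simp add: realizable_Nil)

lemma crossing_braid_index_le:
  assumes bs: "is_ncrossing_braid s m bs" "isotopic (braid_closure s m bs) L"
    and n: "even n" "n \<ge> 2" "m \<ge> n + 2"
  shows "odd (n div 2) \<or> even (m div 2) \<Longrightarrow> crossing_braid_index n L \<le> enat s"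
    and "crossing_braid_index n L \<le> enat s + 1"
proof -
  have iso: "isotopic (word_closure s (map (crossing_letter m) bs)) L"
    using bs(2) by (simp add: braid_closure_eq_word_closure)
  have small: "crossing_braid_index n L \<le> enat s" if "realizable s n (map (crossing_letter m) bs)"
    using realizable_index[OF that iso] .
  obtain w where w: "word_equiv s (map (crossing_letter m) bs) w" "length w = length bs"
    "\<And>a. a \<in> set w \<Longrightarrow> \<exists>j. j + m \<le> s \<and> fst a = window_rev j m \<and> inj_on (snd a) {..<s}"
    using crossing_word_injective[OF bs(1)] by blast
  have perm: "fst a permutes {..<s}" "n + 2 \<le> s" "evenperm (fst a) \<longleftrightarrow> even (m div 2)" "inj_on (snd a) {..<s}"
    if "a \<in> set w" for a
    using w(3)[OF that] n by (auto simp: evenperm_window_rev intro: window_rev_permutes)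
  show 1: "crossing_braid_index n L \<le> enat s" if cond: "odd (n div 2) \<or> even (m div 2)"
  proof (rule small[OF realizable_equiv[OF w(1) realizable_letters]])
    fix a assume a: "a \<in> set w"
    have "fst a \<in> rev_group s n"
    proof (cases "odd (n div 2)")
      case True
      then show ?thesis by (intro mem_rev_group n perm[OF a])
    next
      case False
      then show ?thesis using cond perm(3)[OF a] by (intro even_mem_rev_group n perm[OF a]) auto
    qed
    then have "realizable s n [(fst a, snd a)]"
      using perm(2)[OF a] by (intro realizable_rev_group perm[OF a]) auto
    then show "realizable s n [a]" by simp
  qed
  have le: "enat s \<le> enat s + 1" by (simp add: one_enat_def)
  show "crossing_braid_index n L \<le> enat s + 1"
  proof (cases "odd (n div 2) \<or> even (m div 2)")
    case True
    then show ?thesis using 1 le order_trans by blast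
  next
    case False
    show ?thesis
    proof (cases "even (length bs)")
      case True
      have "realizable s n w"
      \<comment> \<open>The bound n + 2 \<le> s comes from the presence of an m-crossing; without
        one there is nothing to factor.\<close>
      proof (cases "w = []")
        case False
        then obtain a where "a \<in> set w" by (cases w) auto
        then have "n + 2 \<le> s" by (rule perm)
        then show ?thesis
          using perm \<open>\<not> (odd (n div 2) \<or> even (m div 2))\<close> True w(2)
          by (intro realizable_even_length n) auto
      qed (simp add: realizable_Nil)
      then show ?thesis using small[OF realizable_equiv[OF w(1)]] le order_trans by blast
    next
      case odd: False
      then have ne: "bs \<noteq> []" by auto
      then obtain a where "a \<in> set w" using w(2) by (cases w) auto
      then have ns: "n + 2 \<le> s" by (rule perm)
      let ?w = "map (crossing_letter m) bs"
      let ?\<sigma> = "(s - 1, Suc)"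
      have valid: "valid_ncrossing s m cr" if "cr \<in> set bs" for cr
        using bs(1) that by (simp add: is_ncrossing_braid_def)
      have iso1: "isotopic (word_closure (Suc s) (?w @ [crossing_letter 2 ?\<sigma>])) L"
      proof -
        have "isotopic (word_closure (Suc s) (?w @ [crossing_letter 2 ?\<sigma>])) (word_closure s (?w @ [crossing_letter 0 (0, Suc)]))"
        proof (rule word_closure_stabilisation)
          show "1 \<le> s" using ns by simp
          show "fst a permutes {..<s} \<and> snd a s = 0" if a: "a \<in> set ?w" for a
          proof -
            obtain cr where cr: "cr \<in> set bs" "a = crossing_letter m cr" using a by auto
            then have "fst cr + m \<le> s"
              using valid[OF cr(1)] by (simp add: valid_ncrossing_def case_prod_beta)
            then show ?thesis by (simp add: cr(2) crossing_letter_def window_rev_permutes)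
          qed
          show "0 \<le> snd a p" if "a \<in> set ?w" for a p
            using that by (auto simp: crossing_letter_def)
        qed
        also have "isotopic \<dots> (word_closure s ?w)"
          by (rule word_equiv_isotopic[OF word_equiv_drop_identity[OF bs(1) ne]])
        also note iso
        finally show ?thesis .
      qed
      have "is_ncrossing_braid (Suc s) m bs"
        unfolding is_ncrossing_braid_def
      proof
        fix cr assume "cr \<in> set bs"
        then have v: "valid_ncrossing s m cr" by (rule valid)
        obtain j lev where cr: "cr = (j, lev)" by (rule prod.exhaust)
        show "valid_ncrossing (Suc s) m cr" using v unfolding cr by (simp add: valid_ncrossing_def)
      qed
      then obtain w' where w': "word_equiv (Suc s) ?w w'" "length w' = length bs"
        "\<And>a. a \<in> set w' \<Longrightarrow> \<exists>j. j + m \<le> Suc s \<and> fst a = window_rev j m \<and> inj_on (snd a) {..<Suc s}"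
        using crossing_word_injective by blast
      have bij: "bij_betw Suc {0..<2} {1..2}"
        by (simp add: bij_betw_def image_Suc_atLeastLessThan atLeastLessThanSuc_atLeastAtMost numeral_2_eq_2)
      then have "valid_ncrossing (Suc s) 2 ?\<sigma>" using ns by (simp add: valid_ncrossing_def)
      then obtain l where l: "inj_on l {..<Suc s}"
        "word_equiv (Suc s) [crossing_letter 2 ?\<sigma>] [(window_rev (s - 1) 2, l)]"
        using crossing_letter_injective by blast
      \<comment> \<open>Read on s + 1 strings, the old letters keep their parity because it depends
        on m only. All letters, including the new transposition, are odd, and their number is now
        even.\<close>
      have "realizable (Suc s) n (w' @ [(window_rev (s - 1) 2, l)])"
      proof (rule realizable_even_length[OF n(1,2)])
        show "n + 2 \<le> Suc s" using ns by simp
        show "even (length (w' @ [(window_rev (s - 1) 2, l)]))" using odd w'(2) by simp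
        fix a assume "a \<in> set (w' @ [(window_rev (s - 1) 2, l)])"
        then consider "a \<in> set w'" | "a = (window_rev (s - 1) 2, l)" by auto
        then show "fst a permutes {..<Suc s} \<and> \<not> evenperm (fst a) \<and> inj_on (snd a) {..<Suc s}"
        proof cases
          case 1
          then show ?thesis using w'(3)[OF 1] False by (auto simp: evenperm_window_rev intro: window_rev_permutes)
        next
          case 2
          then show ?thesis using l(1) ns by (auto simp: evenperm_window_rev intro!: window_rev_permutes)
        qed
      qed
      then have "realizable (Suc s) n (?w @ [crossing_letter 2 ?\<sigma>])"
        by (rule realizable_equiv[OF word_equiv_append[OF w'(1) l(2)]])
      then have "crossing_braid_index n L \<le> enat (Suc s)" using iso1 by (rule realizable_index)
      then show ?thesis by (simp add: one_enat_def)
    qed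
  qed
qed

theorem theorem5p2:
  fixes L :: "R3 set" and n m :: nat
  assumes "is_link L" and "\<not> is_unlink L"
    and "even n" and "n \<le> 202" and "m \<ge> n + 2"
  shows "((\<exists>k. n = 4 * k + 2) \<longrightarrow> crossing_braid_index n L \<le> crossing_braid_index m L)
    \<and> ((\<exists>k\<ge>1. n = 4 * k) \<longrightarrow>
           crossing_braid_index n L \<le> crossing_braid_index m L + 1 \<and>
           ((m mod 4 = 0 \<or> m mod 4 = 1) \<longrightarrow> crossing_braid_index n L \<le> crossing_braid_index m L))"
proof -
  let ?S = "{s. \<exists>bs. is_ncrossing_braid s m bs \<and> isotopic (braid_closure s m bs) L}"
  have sharp: "crossing_braid_index n L \<le> crossing_braid_index m L"
    if "n \<ge> 2" "odd (n div 2) \<or> even (m div 2)"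
    unfolding crossing_braid_index_def[of m]
  proof (rule INF_greatest)
    fix s assume "s \<in> ?S"
    then show "crossing_braid_index n L \<le> enat s"
      using crossing_braid_index_le(1) assms(3,5) that by blast
  qed
  have weak: "crossing_braid_index n L \<le> crossing_braid_index m L + 1" if "n \<ge> 2"
  \<comment> \<open>A nonempty infimum in \<open>enat\<close> is attained, which yields a concrete
    number of strings to stabilise from; the empty one is \<infinity>.\<close>
  proof (cases "?S = {}")
    case True
    then show ?thesis unfolding crossing_braid_index_def[of m] True by (simp add: top_enat_def)
  next
    case False
    then obtain s0 where "enat s0 \<in> enat ` ?S" by blast
    then have "(LEAST x. x \<in> enat ` ?S) \<in> enat ` ?S" by (rule LeastI)
    then have "crossing_braid_index m L \<in> enat ` ?S"
      using False unfolding crossing_braid_index_def[of m] Inf_enat_def by (simp only: image_is_empty if_False)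
    then obtain s where "s \<in> ?S" "crossing_braid_index m L = enat s" by blast
    then show ?thesis using crossing_braid_index_le(2) assms(3,5) that by force
  qed
  have "odd ((4 * k + 2) div 2)" for k :: nat by presburger
  \<comment> \<open>These residues are the ones for which an m-crossing is an even
    permutation.\<close>
  moreover have "even (m div 2)" if "m mod 4 = 0 \<or> m mod 4 = 1" using that by presburger
  ultimately show ?thesis using sharp weak by auto
qed

end
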